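(* Let $\sigma,p,\rho,a>0$, $0\le\nu<p$, $m,l\in\mathbb N$, $d,\tau,\Lambda\ge1$, let $\kappa(t)=t^{(p-\nu)/(a+\nu)}$ with inverse $\varphi(t)=t^{(a+\nu)/(p-\nu)}$, and suppose that the class $\mathcal F^m_\kappa$ (which depends on $\eta$) is nonempty for $\eta$ large. Let $\eta$ be sufficiently large (with threshold not depending on $n$) and let $\triangle\ge1$. Then there is a constant $C>0$ such that for every $n\ge1$ for which some $k^*\in\mathbb N$ satisfies $$\triangle^{-1}\le\sum_{|k|\le k^*}\frac{\gamma_{k^*}^{p-\nu}}{n\,\varphi(\gamma_k^{\nu-p})}\le\triangle$$ one has $$\inf_{\widetilde\beta}\ \sup_{\beta\in\mathcal W_p^\rho,\ (X,W)\in\mathcal F^m_\kappa,\ U\in\mathcal E^l_\eta}\mathbb E\|\widetilde\beta-\beta\|_\nu^2\ \ge\ C\,n^{-2(p-\nu)/[2(p+a)+1]},$$ where the infimum is over all estimators $\widetilde\beta$ based on an i.i.d. $n$-sample of $(Y,X,W)$, with $Y=\int_0^1\beta(t)X(t)\,dt+\sigma U$, and the supremum is over $\beta$ and joint distributions of $(X,W,U)$ in the indicated classes satisfying $\mathbb E[UW(t)]=0$, $t\in[0,1]$.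
   Context: Basic notation. $L^2[0,1]$ is the Hilbert space of square integrable complex-valued functions with $\langle f,g\rangle=\int_0^1 f(t)\overline{g(t)}dt$, $\|f\|=\langle f,f\rangle^{1/2}$; $\phi_k(t)=\exp(2\pi i k t)$, $k\in\mathbb Z$. Weights: $\gamma_k=1+|2\pi k|^2$. For $\nu\in\mathbb R$, $\|f\|_\nu^2=\sum_{k\in\mathbb Z}\gamma_k^\nu|\langle f,\phi_k\rangle|^2$ and $\mathcal W_\nu=\{f\in L^2[0,1]:\|f\|_\nu<\infty\}$, $\mathcal W_\nu^\rho=\{f\in\mathcal W_\nu:\|f\|_\nu^2\le\rho\}$. Model. $X,W$ are real-valued centered random functions on $[0,1]$ with $\mathbb E\|X\|^2<\infty$, $\mathbb E\|W\|^2<\infty$; $Y$ is real-valued, and the slope function $\beta$ is real-valued. Second order stationarity. $\mathcal F$ is the set of all centered second order stationary pairs $(X,W)$: covariances depend only on differences of arguments, in particular $\mathrm{Cov}(X(t),W(s))=c_{WX}(s-t)$. It is a standing property that the $\phi_k$ diagonalize the cross-covariance operator $[T_{WX}f](s)=\int_0^1 f(t)\,\mathrm{Cov}(X(t),W(s))dt$, i.e. $T_{WX}\phi_k=c_k\phi_k$; equivalently, with $c_k=\mathbb E[\langle\phi_k,X\rangle\langle W,\phi_k\rangle]$, one has $\mathbb E[\langle\phi_k,X\rangle\langle W,\phi_j\rangle]=0$ for $j\neq k$. It is also a standing assumption that $T_{WX}$ is injective, i.e. $c_k\ne0$ for all $k$. Put $x_k=\mathrm{Var}\langle X,\phi_k\rangle$,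 $w_k=\mathrm{Var}\langle W,\phi_k\rangle$ (variance of a complex variable meaning $\mathbb E|\cdot|^2$ after centering), $\lambda_k=|c_k|^2/w_k$. Moment classes. For $m\in\mathbb N$, $\eta,\tau\ge1$: $\mathcal F^m_{\eta,\tau}$ is the set of $(X,W)\in\mathcal F$ with $\sup_k\mathbb E|\langle X,\phi_k\rangle/\sqrt{x_k}|^m\le\eta$, $\sup_k\mathbb E|\langle W,\phi_k\rangle/\sqrt{w_k}|^m\le\eta$ and $\max(1,\sup_k\lambda_k/w_k)\le\tau$. $\mathcal E^m_\eta$ is the set of centered real random variables $U$ with variance one and $\mathbb E|U|^m\le\eta$. Link condition. For a nonnegative summable sequence $(\lambda_k)_{k\in\mathbb Z}$ let $\lambda_+=\max(1,\max_k\lambda_k)$. For $\kappa$ continuous strictly increasing with $\kappa(0+)=0$ and inverse $\varphi$, and $d\ge1$, $\mathcal S_{\kappa,d}$ is the set of nonnegative summable $(\lambda_k)$ with $\kappa\bigl(\frac{\lambda_k}{d\gamma_k^\nu\lambda_+}\bigr)\le\gamma_k^{\nu-p}\le\kappa\bigl(\frac{d\lambda_k}{\gamma_k^\nu\lambda_+}\bigr)$ for all $k$, understood as $d^{-1}\varphi(\gamma_k^{\nu-p})\le\frac{\lambda_k}{\gamma_k^\nu\lambda_+}\le d\,\varphi(\gamma_k^{\nu-p})$ for all $k\in\mathbb Z$. Finally, $\mathcal F^m_\kappa$ is the set of $(X,W)\in\mathcal F^m_{\eta,\tau}$ whose associated values satisfy $(\lambda_k)_{k\in\mathbb Z}\in\mathcal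 S_{\kappa,d}$ and with $\mathbb E\|X\|^2\le\Lambda$, $\mathbb E\|W\|^2\le\Lambda$. *)

theory Defs
  imports "HOL-Probability.Probability"
begin

text \<open>Elements of L2[0,1] are represented by functions on the real line of which only the
  values on [0,1] matter; they are not identified when they agree almost everywhere, so
  \<open>L2_norm\<close> is a seminorm on them.\<close>

definition lborel01 :: "real measure" where
  "lborel01 = restrict_space lborel {0..1}"

definition L2 :: "(real \<Rightarrow> 'b::{real_normed_vector, second_countable_topology}) set" where
  "L2 = {f. f \<in> borel_measurable lborel01 \<and> integrable lborel01 (\<lambda>t. (norm (f t))\<^sup>2)}"

definition L2_inner :: "(real \<Rightarrow> complex) \<Rightarrow> (real \<Rightarrow> complex) \<Rightarrow> complex" where
  "L2_inner f g = (\<integral>t. f t * cnj (g t) \<partial>lborel01)"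

definition L2_norm :: "(real \<Rightarrow> 'b::real_normed_vector) \<Rightarrow> real" where
  "L2_norm f = sqrt (\<integral>t. (norm (f t))\<^sup>2 \<partial>lborel01)"

text \<open>Since L2[0,1] is separable, the balls generate its Borel sigma-algebra.\<close>

definition L2_borel :: "(real \<Rightarrow> 'b::{real_normed_vector, second_countable_topology}) measure" where
  "L2_borel = sigma L2 {{f \<in> L2. L2_norm (\<lambda>t. f t - g t) < r} | g r. g \<in> L2}"

definition trig :: "int \<Rightarrow> real \<Rightarrow> complex" where
  "trig k t = exp (2 * of_real pi * \<i> * of_int k * of_real t)"

definition wt :: "int \<Rightarrow> real" where
  "wt k = 1 + \<bar>2 * pi * of_int k\<bar>\<^sup>2"

definition wnorm_sq :: "real \<Rightarrow> (real \<Rightarrow> complex) \<Rightarrow> ennreal" where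
  "wnorm_sq \<nu> f = (\<Sum>\<^sub>\<infinity>k. ennreal (wt k powr \<nu> * (cmod (L2_inner f (trig k)))\<^sup>2))"

definition sobolev :: "real \<Rightarrow> (real \<Rightarrow> complex) set" where
  "sobolev \<nu> = {f \<in> L2. wnorm_sq \<nu> f < \<infinity>}"

definition sobolev_ball :: "real \<Rightarrow> real \<Rightarrow> (real \<Rightarrow> complex) set" where
  "sobolev_ball \<nu> \<rho> = {f \<in> sobolev \<nu>. wnorm_sq \<nu> f \<le> ennreal \<rho>}"

abbreviation cpx :: "(real \<Rightarrow> real) \<Rightarrow> real \<Rightarrow> complex" where
  "cpx f \<equiv> (\<lambda>t. complex_of_real (f t))"

definition centered_random_function :: "'w measure \<Rightarrow> ('w \<Rightarrow> real \<Rightarrow> real) \<Rightarrow> bool" where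
  "centered_random_function M X \<longleftrightarrow>
     (\<lambda>(\<omega>, t). X \<omega> t) \<in> borel_measurable (M \<Otimes>\<^sub>M lborel01) \<and>
     (\<forall>\<omega>\<in>space M. X \<omega> \<in> L2) \<and>
     (\<integral>\<^sup>+\<omega>. ennreal ((L2_norm (X \<omega>))\<^sup>2) \<partial>M) < \<infinity> \<and>
     (\<forall>t\<in>{0..1}. integrable M (\<lambda>\<omega>. (X \<omega> t)\<^sup>2) \<and> (\<integral>\<omega>. X \<omega> t \<partial>M) = 0)"

definition Cov :: "'w measure \<Rightarrow> ('w \<Rightarrow> real) \<Rightarrow> ('w \<Rightarrow> real) \<Rightarrow> real" where
  "Cov M A B = (\<integral>\<omega>. (A \<omega> - (\<integral>\<omega>'. A \<omega>' \<partial>M)) * (B \<omega> - (\<integral>\<omega>'. B \<omega>' \<partial>M)) \<partial>M)"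

definition Var :: "'w measure \<Rightarrow> ('w \<Rightarrow> complex) \<Rightarrow> real" where
  "Var M Z = (\<integral>\<omega>. (cmod (Z \<omega> - (\<integral>\<omega>'. Z \<omega>' \<partial>M)))\<^sup>2 \<partial>M)"

definition cov_by_difference ::
  "'w measure \<Rightarrow> ('w \<Rightarrow> real \<Rightarrow> real) \<Rightarrow> ('w \<Rightarrow> real \<Rightarrow> real) \<Rightarrow> bool" where
  "cov_by_difference M X W \<longleftrightarrow>
     (\<exists>c. \<forall>t\<in>{0..1}. \<forall>s\<in>{0..1}. Cov M (\<lambda>\<omega>. X \<omega> t) (\<lambda>\<omega>. W \<omega> s) = c (s - t))"

definition cross_cov_op ::
  "'w measure \<Rightarrow> ('w \<Rightarrow> real \<Rightarrow> real) \<Rightarrow> ('w \<Rightarrow> real \<Rightarrow> real) \<Rightarrow> (real \<Rightarrow> complex) \<Rightarrow> real \<Rightarrow> complex" where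
  "cross_cov_op M X W f s = (\<integral>t. f t * of_real (Cov M (\<lambda>\<omega>. X \<omega> t) (\<lambda>\<omega>. W \<omega> s)) \<partial>lborel01)"

definition coef :: "('w \<Rightarrow> real \<Rightarrow> real) \<Rightarrow> int \<Rightarrow> 'w \<Rightarrow> complex" where
  "coef X k \<omega> = L2_inner (cpx (X \<omega>)) (trig k)"

definition cross_val ::
  "'w measure \<Rightarrow> ('w \<Rightarrow> real \<Rightarrow> real) \<Rightarrow> ('w \<Rightarrow> real \<Rightarrow> real) \<Rightarrow> int \<Rightarrow> complex" where
  "cross_val M X W k = (\<integral>\<omega>. L2_inner (trig k) (cpx (X \<omega>)) * L2_inner (cpx (W \<omega>)) (trig k) \<partial>M)"

definition var_val :: "'w measure \<Rightarrow> ('w \<Rightarrow> real \<Rightarrow> real) \<Rightarrow> int \<Rightarrow> real" where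
  "var_val M X k = Var M (coef X k)"

definition lam_val ::
  "'w measure \<Rightarrow> ('w \<Rightarrow> real \<Rightarrow> real) \<Rightarrow> ('w \<Rightarrow> real \<Rightarrow> real) \<Rightarrow> int \<Rightarrow> real" where
  "lam_val M X W k = (cmod (cross_val M X W k))\<^sup>2 / var_val M W k"

text \<open>On [0,1], covariances depending on the difference of the arguments alone do not make
  the trigonometric functions eigenfunctions of the cross-covariance operator (periodicity is
  needed), so this standing property is part of the definition, as is injectivity.\<close>

definition stationary_pair ::
  "'w measure \<Rightarrow> ('w \<Rightarrow> real \<Rightarrow> real) \<Rightarrow> ('w \<Rightarrow> real \<Rightarrow> real) \<Rightarrow> bool" where
  "stationary_pair M X W \<longleftrightarrow>
     prob_space M \<and> centered_random_function M X \<and> centered_random_function M W \<and>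
     cov_by_difference M X X \<and> cov_by_difference M W W \<and> cov_by_difference M X W \<and>
     (\<forall>k. AE s in lborel01. cross_cov_op M X W (trig k) s = cross_val M X W k * trig k s) \<and>
     (\<forall>k. cross_val M X W k \<noteq> 0)"

definition moment_class ::
  "nat \<Rightarrow> real \<Rightarrow> real \<Rightarrow> 'w measure \<Rightarrow> ('w \<Rightarrow> real \<Rightarrow> real) \<Rightarrow> ('w \<Rightarrow> real \<Rightarrow> real) \<Rightarrow> bool" where
  "moment_class m \<eta> \<tau> M X W \<longleftrightarrow>
     stationary_pair M X W \<and>
     (SUP k. \<integral>\<^sup>+\<omega>. ennreal (cmod (coef X k \<omega> / of_real (sqrt (var_val M X k))) ^ m) \<partial>M) \<le> ennreal \<eta> \<and>
     (SUP k. \<integral>\<^sup>+\<omega>. ennreal (cmod (coef W k \<omega> / of_real (sqrt (var_val M W k))) ^ m) \<partial>M) \<le> ennreal \<eta> \<and>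
     max 1 (SUP k. ennreal (lam_val M X W k / var_val M W k)) \<le> ennreal \<tau>"

definition error_class :: "nat \<Rightarrow> real \<Rightarrow> 'w measure \<Rightarrow> ('w \<Rightarrow> real) \<Rightarrow> bool" where
  "error_class l \<eta> M U \<longleftrightarrow>
     U \<in> borel_measurable M \<and> integrable M U \<and> (\<integral>\<omega>. U \<omega> \<partial>M) = 0 \<and>
     integrable M (\<lambda>\<omega>. (U \<omega>)\<^sup>2) \<and> (\<integral>\<omega>. (U \<omega>)\<^sup>2 \<partial>M) = 1 \<and>
     (\<integral>\<^sup>+\<omega>. ennreal (\<bar>U \<omega>\<bar> ^ l) \<partial>M) \<le> ennreal \<eta>"

definition lam_plus :: "(int \<Rightarrow> real) \<Rightarrow> real" where
  "lam_plus lam = max 1 (SUP k. lam k)"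

definition link_class :: "(real \<Rightarrow> real) \<Rightarrow> real \<Rightarrow> real \<Rightarrow> real \<Rightarrow> (int \<Rightarrow> real) set" where
  "link_class \<kappa> p \<nu> d = {lam. (\<forall>k. 0 \<le> lam k) \<and> lam summable_on UNIV \<and>
     (let \<phi> = the_inv_into {0..} \<kappa> in
      \<forall>k. inverse d * \<phi> (wt k powr (\<nu> - p)) \<le> lam k / (wt k powr \<nu> * lam_plus lam) \<and>
          lam k / (wt k powr \<nu> * lam_plus lam) \<le> d * \<phi> (wt k powr (\<nu> - p)))}"

text \<open>The classes range over all probability spaces on the type \<^typ>\<open>real\<close>. This loses no
  joint distribution: L2[0,1] x L2[0,1] x R is Polish, so every probability law on it
  is the law of a random element defined on such a space.\<close>

type_synonym process = "real \<Rightarrow> real \<Rightarrow> real"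

definition F_class ::
  "nat \<Rightarrow> real \<Rightarrow> real \<Rightarrow> (real \<Rightarrow> real) \<Rightarrow> real \<Rightarrow> real \<Rightarrow> real \<Rightarrow> real \<Rightarrow>
   (real measure \<times> process \<times> process) set" where
  "F_class m \<eta> \<tau> \<kappa> p \<nu> d \<Lambda> = {(M, X, W). moment_class m \<eta> \<tau> M X W \<and>
     lam_val M X W \<in> link_class \<kappa> p \<nu> d \<and>
     (\<integral>\<^sup>+\<omega>. ennreal ((L2_norm (X \<omega>))\<^sup>2) \<partial>M) \<le> ennreal \<Lambda> \<and>
     (\<integral>\<^sup>+\<omega>. ennreal ((L2_norm (W \<omega>))\<^sup>2) \<partial>M) \<le> ennreal \<Lambda>}"

definition obs_space :: "(real \<times> (real \<Rightarrow> real) \<times> (real \<Rightarrow> real)) measure" where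
  "obs_space = borel \<Otimes>\<^sub>M L2_borel \<Otimes>\<^sub>M L2_borel"

definition obs_law ::
  "real \<Rightarrow> (real \<Rightarrow> real) \<Rightarrow> 'w measure \<Rightarrow> ('w \<Rightarrow> real \<Rightarrow> real) \<Rightarrow> ('w \<Rightarrow> real \<Rightarrow> real) \<Rightarrow> ('w \<Rightarrow> real) \<Rightarrow>
   (real \<times> (real \<Rightarrow> real) \<times> (real \<Rightarrow> real)) measure" where
  "obs_law \<sigma> \<beta> M X W U =
     distr M obs_space (\<lambda>\<omega>. ((\<integral>t. \<beta> t * X \<omega> t \<partial>lborel01) + \<sigma> * U \<omega>, X \<omega>, W \<omega>))"

definition estimators ::
  "nat \<Rightarrow> ((nat \<Rightarrow> real \<times> (real \<Rightarrow> real) \<times> (real \<Rightarrow> real)) \<Rightarrow> real \<Rightarrow> complex) set" where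
  "estimators n = (\<Pi>\<^sub>M i\<in>{..<n}. obs_space) \<rightarrow>\<^sub>M L2_borel"

definition risk ::
  "real \<Rightarrow> nat \<Rightarrow> ((nat \<Rightarrow> real \<times> (real \<Rightarrow> real) \<times> (real \<Rightarrow> real)) \<Rightarrow> real \<Rightarrow> complex) \<Rightarrow> (real \<Rightarrow> real) \<Rightarrow>
   (real \<times> (real \<Rightarrow> real) \<times> (real \<Rightarrow> real)) measure \<Rightarrow> ennreal" where
  "risk \<nu> n est \<beta> P = (\<integral>\<^sup>+z. wnorm_sq \<nu> (\<lambda>t. est z t - cpx \<beta> t) \<partial>(\<Pi>\<^sub>M i\<in>{..<n}. P))"

definition models ::
  "nat \<Rightarrow> nat \<Rightarrow> real \<Rightarrow> real \<Rightarrow> (real \<Rightarrow> real) \<Rightarrow> real \<Rightarrow> real \<Rightarrow> real \<Rightarrow> real \<Rightarrow> real \<Rightarrow>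
   ((real \<Rightarrow> real) \<times> real measure \<times> process \<times> process \<times> (real \<Rightarrow> real)) set" where
  "models m l \<eta> \<tau> \<kappa> p \<nu> d \<Lambda> \<rho> = {(\<beta>, M, X, W, U).
     cpx \<beta> \<in> sobolev_ball p \<rho> \<and> (M, X, W) \<in> F_class m \<eta> \<tau> \<kappa> p \<nu> d \<Lambda> \<and> error_class l \<eta> M U \<and>
     (\<forall>t\<in>{0..1}. (\<integral>\<omega>. U \<omega> * W \<omega> t \<partial>M) = 0)}"

end

theory Submission
  imports Defs
begin

text \<open>
  The least favourable model takes the instrument equal to the regressor. Let
  \<open>X\<^sub>t = \<epsilon> g (t + V)\<close> with a random sign \<open>\<epsilon>\<close>, a uniform shift \<open>V\<close> and a 1-periodic \<open>g\<close> whose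
  Fourier coefficients have squares \<open>\<gamma>\<^sub>k\<^sup>-\<^sup>a / d\<close>, and let \<open>U\<close> be standard normal and independent
  of \<open>(\<epsilon>, V)\<close>. Then \<open>|\<langle>X, \<phi>\<^sub>k\<rangle>|\<close> is deterministic, which makes all moment conditions trivial.
  Nonemptiness of the given class enters only through the bound \<open>\<Sum>\<^sub>k \<gamma>\<^sub>k\<^sup>-\<^sup>a \<le> d \<Lambda>\<close>.

  For \<open>S \<subseteq> {0, \<dots>, k*}\<close> let \<open>\<beta>\<^sub>S = \<Sum>k\<in>S. b\<^sub>k cos (2 \<pi> k t)\<close> with \<open>b\<^sub>k\<^sup>2 = \<zeta> \<gamma>\<^sub>k\<^sup>a / n\<close>. The condition on \<open>k*\<close>
  places these slopes in the Sobolev ball. Adding one frequency to \<open>S\<close> shifts the Gaussian response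
  by at most a constant times \<open>n ^ (- 1 / 2)\<close>, so the two laws of the \<open>n\<close>-sample cannot be told apart, and
  Assouad's argument bounds the maximal risk from below by a multiple of
  \<open>\<Sum>\<^sub>k \<gamma>\<^sub>k\<^sup>\<nu> b\<^sub>k\<^sup>2\<close>, which has the order of \<open>\<gamma> ^ (\<nu> - p)\<close> at \<open>k*\<close>.
\<close>

text \<open>The classes evaluate \<open>X\<close> at every single t, while \<open>g\<close> is known
  only through square summable coefficients. The uniform shift bridges this: averaging over
  \<open>V\<close> turns the L2 norm of \<open>g\<close> into a finite second moment at each t. It
  also makes the covariance a circular autocorrelation, which the trigonometric functions
  diagonalize. The sign centres frequency 0, where a shift alone leaves the coefficient constant.
  The law of (X, W, U) is the same for all n and only the slopes change, so the threshold for \<eta>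
  does not see n. As the moduli of the coefficients are deterministic, the shift of the response is
  bounded on every path, which controls the second moment of the likelihood ratio. The exponent
  comes from counting: about \<gamma> ^ (1 / 2) frequencies lie below k*, so the sum in the
  condition on k* is at least of order \<gamma> ^ (p + a + 1 / 2) / n. Its upper bound thus limits
  \<gamma> ^ (p - \<nu>) by a multiple of n ^ ((p - \<nu>) / (p + a + 1 / 2)), the inverse of the
  rate; its lower bound makes the perturbations large enough.\<close>

lemma borel_measurable_frac [measurable]: "frac \<in> borel_measurable (borel :: real measure)"
proof -
  have "(\<lambda>x::real. x - real_of_int \<lfloor>x\<rfloor>) \<in> borel_measurable borel" by measurable
  then show ?thesis by (simp add: frac_def[abs_def])
qed

section \<open>Integration over [0,1] and rotation of periodic functions\<close>

lemma space_lborel01 [simp]: "space lborel01 = {0..1}"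
  by (simp add: lborel01_def space_restrict_space)

lemma measurable_ident_lborel01: "(\<lambda>t. t) \<in> borel_measurable lborel01"
  unfolding lborel01_def by (rule measurable_restrict_space1) simp

lemma measurable_lborel01_borel:
  assumes "f \<in> borel \<rightarrow>\<^sub>M N" shows "f \<in> lborel01 \<rightarrow>\<^sub>M N"
  using measurable_compose[OF measurable_ident_lborel01 assms] by simp

lemma nn_integral_lborel01:
  "(\<integral>\<^sup>+t. f t \<partial>lborel01) = (\<integral>\<^sup>+t. f t * indicator {0..1} t \<partial>lborel)"
  unfolding lborel01_def by (rule nn_integral_restrict_space) simp

lemma prob_space_lborel01: "prob_space lborel01"
proof
  show "emeasure lborel01 (space lborel01) = 1"
    unfolding lborel01_def by (simp add: space_restrict_space emeasure_restrict_space)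
qed

interpretation lborel01: prob_space lborel01
  by (rule prob_space_lborel01)

lemma periodic_shift_int:
  fixes f :: "real \<Rightarrow> 'a"
  assumes "\<And>t. f (t + 1) = f t"
  shows "f (t + real_of_int j) = f t"
proof -
  have nat: "f (t + real n) = f t" for n t
  proof (induction n)
    case (Suc n)
    then show ?case using assms[of "t + real n"] by (simp add: add_ac)
  qed simp
  show ?thesis
  proof (cases j)
    case (nonneg n)
    then show ?thesis using nat by simp
  next
    case (neg n)
    then show ?thesis using nat[of "t + real_of_int j" "Suc n"] by simp
  qed
qed

lemma periodic_frac:
  fixes f :: "real \<Rightarrow> 'a"
  assumes "\<And>t. f (t + 1) = f t"
  shows "f (frac t) = f t"
  using periodic_shift_int[of f t "- \<lfloor>t\<rfloor>", OF assms] by (simp add: frac_def)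

text \<open>The interval [v, 1 + v] is cut at 1, and the piece beyond 1 is moved back by one
  period.\<close>

lemma nn_integral_periodic_shift:
  fixes f :: "real \<Rightarrow> ennreal"
  assumes [measurable]: "f \<in> borel_measurable borel" and per: "\<And>t. f (t + 1) = f t"
    and v: "v \<in> {0..1}"
  shows "(\<integral>\<^sup>+t. f (t + v) \<partial>lborel01) = (\<integral>\<^sup>+t. f t \<partial>lborel01)"
proof -
  have split: "(\<integral>\<^sup>+t. f t * indicator {a..c} t \<partial>lborel) =
      (\<integral>\<^sup>+t. f t * indicator {a..b} t \<partial>lborel) + (\<integral>\<^sup>+t. f t * indicator {b..c} t \<partial>lborel)"
    if "a \<le> b" "b \<le> c" for a b c
  proof -
    \<comment> \<open>The two closed intervals overlap in the null set {b}.\<close>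
    have "AE t in lborel. t \<noteq> b"
      by (rule AE_lborel_singleton)
    then have "(\<integral>\<^sup>+t. f t * indicator {a..c} t \<partial>lborel) =
      (\<integral>\<^sup>+t. f t * indicator {a..b} t + f t * indicator {b..c} t \<partial>lborel)"
      by (intro nn_integral_cong_AE, elim eventually_mono) (use that in \<open>auto simp: indicator_def\<close>)
    then show ?thesis
      by (simp add: nn_integral_add)
  qed
  have shift: "(\<integral>\<^sup>+t. f (t + b) * indicator {a..c} t \<partial>lborel) = (\<integral>\<^sup>+t. f t * indicator {a + b..c + b} t \<partial>lborel)"
    for a b c
  proof -
    have "(\<integral>\<^sup>+t. f t * indicator {a + b..c + b} t \<partial>lborel) = (\<integral>\<^sup>+t. f (b + t) * indicator {a + b..c + b} (b + t) \<partial>lborel)"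
      using nn_integral_real_affine[of "\<lambda>t. f t * indicator {a + b..c + b} t" 1 b] by simp
    also have "\<dots> = (\<integral>\<^sup>+t. f (t + b) * indicator {a..c} t \<partial>lborel)"
      by (intro nn_integral_cong) (auto simp: indicator_def add.commute)
    finally show ?thesis ..
  qed
  have "(\<integral>\<^sup>+t. f (t + v) \<partial>lborel01) = (\<integral>\<^sup>+t. f t * indicator {v..1+v} t \<partial>lborel)"
    using shift[of v 0 1] by (simp add: nn_integral_lborel01)
  also have "\<dots> = (\<integral>\<^sup>+t. f t * indicator {v..1} t \<partial>lborel) + (\<integral>\<^sup>+t. f t * indicator {1..1+v} t \<partial>lborel)"
    using v by (intro split) auto
  also have "(\<integral>\<^sup>+t. f t * indicator {1..1+v} t \<partial>lborel) = (\<integral>\<^sup>+t. f t * indicator {0..v} t \<partial>lborel)"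
    using shift[of 1 0 v] by (simp add: per add.commute)
  also have "(\<integral>\<^sup>+t. f t * indicator {v..1} t \<partial>lborel) + \<dots> = (\<integral>\<^sup>+t. f t * indicator {0..1} t \<partial>lborel)"
    using split[of 0 v 1] v by (simp add: add.commute)
  finally show ?thesis
    by (simp add: nn_integral_lborel01)
qed

text \<open>Rotation invariance as an equality of laws carries the shift rule from nonnegative
  functions to Bochner integrals: a 1-periodic \<open>f\<close> satisfies
  \<open>f t = f (frac t)\<close>, so its integral depends on the law of \<open>frac (t + v)\<close>
  only.\<close>

lemma distr_frac_shift:
  assumes v: "v \<in> {0..1}"
  shows "distr lborel01 borel (\<lambda>t. frac (t + v)) = distr lborel01 borel frac"
proof (rule measure_eqI)
  fix B assume "B \<in> sets (distr lborel01 borel (\<lambda>t. frac (t + v)))"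
  then have [measurable]: "B \<in> sets borel" by simp
  have [measurable]: "(\<lambda>t. frac (t + v)) \<in> borel_measurable lborel01"
    by (intro measurable_lborel01_borel) measurable
  have [measurable]: "frac \<in> borel_measurable lborel01"
    by (intro measurable_lborel01_borel) measurable
  have "(\<integral>\<^sup>+t. indicator B (frac (t + v)) \<partial>lborel01) = (\<integral>\<^sup>+t. indicator B (frac t) \<partial>lborel01)"
    using v by (intro nn_integral_periodic_shift) (auto simp: frac_1_eq)
  also have "(\<integral>\<^sup>+t. indicator B (frac (t + v)) \<partial>lborel01) = (\<integral>\<^sup>+t. indicator B t \<partial>distr lborel01 borel (\<lambda>t. frac (t + v)))"
    by (subst nn_integral_distr) auto
  also have "(\<integral>\<^sup>+t. indicator B (frac t) \<partial>lborel01) = (\<integral>\<^sup>+t. indicator B t \<partial>distr lborel01 borel frac)"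
    by (subst nn_integral_distr) auto
  finally show "emeasure (distr lborel01 borel (\<lambda>t. frac (t + v))) B = emeasure (distr lborel01 borel frac) B"
    by simp
qed simp

lemma
  fixes f :: "real \<Rightarrow> 'a::{banach, second_countable_topology}"
  assumes [measurable]: "f \<in> borel_measurable borel" and per: "\<And>t. f (t + 1) = f t"
    and v: "v \<in> {0..1}"
  shows integral_periodic_shift: "(\<integral>t. f (t + v) \<partial>lborel01) = (\<integral>t. f t \<partial>lborel01)"
    and integrable_periodic_shift: "integrable lborel01 (\<lambda>t. f (t + v)) \<longleftrightarrow> integrable lborel01 f"
proof -
  have [measurable]: "(\<lambda>t. frac (t + v)) \<in> borel_measurable lborel01"
    by (intro measurable_lborel01_borel) measurable
  have [measurable]: "frac \<in> borel_measurable lborel01"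
    by (intro measurable_lborel01_borel) measurable
  have "(\<integral>t. f (frac (t + v)) \<partial>lborel01) = (\<integral>t. f t \<partial>distr lborel01 borel (\<lambda>t. frac (t + v)))"
    by (subst integral_distr) auto
  also have "\<dots> = (\<integral>t. f (frac t) \<partial>lborel01)"
    unfolding distr_frac_shift[OF v] by (subst integral_distr) auto
  finally show "(\<integral>t. f (t + v) \<partial>lborel01) = (\<integral>t. f t \<partial>lborel01)"
    by (simp add: periodic_frac[of f, OF per])
  have "integrable lborel01 (\<lambda>t. f (frac (t + v))) \<longleftrightarrow> integrable (distr lborel01 borel (\<lambda>t. frac (t + v))) f"
    by (subst integrable_distr_eq) auto
  also have "\<dots> \<longleftrightarrow> integrable lborel01 (\<lambda>t. f (frac t))"
    unfolding distr_frac_shift[OF v] by (subst integrable_distr_eq) auto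
  finally show "integrable lborel01 (\<lambda>t. f (t + v)) \<longleftrightarrow> integrable lborel01 f"
    by (simp add: periodic_frac[of f, OF per])
qed

section \<open>The trigonometric system\<close>

lemma cmod_trig [simp]: "cmod (trig k t) = 1"
  by (simp add: trig_def)

lemma trig_add: "trig k (s + t) = trig k s * trig k t"
  by (simp add: trig_def exp_add[symmetric] algebra_simps)

lemma trig_periodic: "trig k (t + 1) = trig k t"
proof -
  have "trig k 1 = 1"
    using exp_integer_2pi[of "of_int k"] by (simp add: trig_def mult_ac)
  then show ?thesis by (simp add: trig_add)
qed

lemma cnj_trig: "cnj (trig k t) = trig (- k) t"
  by (simp add: trig_def exp_cnj)

lemma trig_mult: "trig j t * trig k t = trig (j + k) t"
  by (simp add: trig_def exp_add[symmetric] algebra_simps)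

lemma trig_mult_cnj: "trig k t * cnj (trig k t) = 1"
  by (metis cmod_trig complex_norm_square of_real_1 power_one)

lemma borel_measurable_trig [measurable]: "trig k \<in> borel_measurable borel"
  unfolding trig_def by measurable

lemma integrable_bounded_lborel01:
  fixes f :: "real \<Rightarrow> 'a::{banach, second_countable_topology}"
  assumes "f \<in> borel_measurable lborel01" "\<And>t. norm (f t) \<le> B"
  shows "integrable lborel01 f"
  using assms by (intro lborel01.integrable_const_bound[where B = B]) auto

lemma integral_trig: "(\<integral>t. trig k t \<partial>lborel01) = (if k = 0 then 1 else 0)"
proof (cases "k = 0")
  case True
  then show ?thesis using lborel01.prob_space by (simp add: trig_def)
next
  case False
  let ?c = "2 * of_real pi * \<i> * of_int k :: complex"
  have c: "?c \<noteq> 0" using False by simp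
  have "((\<lambda>t. exp (?c * of_real t)) has_integral (exp (?c * of_real 1) / ?c - exp (?c * of_real 0) / ?c)) {0..1}"
    using c by (intro fundamental_theorem_of_calculus)
      (auto intro!: derivative_eq_intros has_vector_derivative_real_field simp: has_real_derivative_iff_has_vector_derivative[symmetric])
  moreover have "exp (?c * of_real 1) = 1"
    using exp_integer_2pi[of "of_int k"] by (simp add: mult_ac)
  ultimately have "(trig k has_integral 0) {0..1}"
    by (simp add: trig_def[abs_def])
  moreover have "set_integrable lborel {0..1} (trig k)"
    by (intro borel_integrable_atLeastAtMost') (auto simp: trig_def[abs_def] intro!: continuous_intros)
  ultimately have "(LINT t:{0..1}|lborel. trig k t) = 0"
    by (simp add: set_borel_integral_eq_integral(2) integral_unique)
  then show ?thesis
    using False unfolding lborel01_def set_lebesgue_integral_def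
    by (subst integral_restrict_space) auto
qed

section \<open>Square integrable functions and Fourier coefficients\<close>

lemma L2_borel_measurable: "f \<in> L2 \<Longrightarrow> f \<in> borel_measurable lborel01"
  and L2_integrable_norm_square: "f \<in> L2 \<Longrightarrow> integrable lborel01 (\<lambda>t. (norm (f t))\<^sup>2)"
  by (auto simp: L2_def)

lemma L2_norm_square: "(L2_norm f)\<^sup>2 = (\<integral>t. (norm (f t))\<^sup>2 \<partial>lborel01)"
  unfolding L2_norm_def by (simp add: integral_nonneg_AE)

lemma ennreal_L2_norm_square:
  "f \<in> L2 \<Longrightarrow> ennreal ((L2_norm f)\<^sup>2) = (\<integral>\<^sup>+t. ennreal ((norm (f t))\<^sup>2) \<partial>lborel01)"
  unfolding L2_norm_square by (rule nn_integral_eq_integral[symmetric]) (auto simp: L2_def)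

lemma L2_zero [simp]: "(\<lambda>t. 0) \<in> L2"
  by (simp add: L2_def)

lemma norm_diff_square_le:
  fixes x y :: "'b::real_normed_vector"
  shows "(norm (x - y))\<^sup>2 \<le> 2 * (norm x)\<^sup>2 + 2 * (norm y)\<^sup>2"
proof -
  have "(norm (x - y))\<^sup>2 \<le> (norm x + norm y)\<^sup>2"
    by (intro power_mono norm_triangle_ineq4) simp
  also have "\<dots> \<le> 2 * (norm x)\<^sup>2 + 2 * (norm y)\<^sup>2"
    using sum_squares_bound[of "norm x" "norm y"] by (simp add: power2_eq_square algebra_simps)
  finally show ?thesis .
qed

lemma L2_integrable:
  fixes f :: "real \<Rightarrow> 'b::{banach, second_countable_topology}"
  assumes "f \<in> L2" shows "integrable lborel01 f"
proof -
  note [measurable] = assms[THEN L2_borel_measurable]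
  have "integrable lborel01 (\<lambda>t. 1 + (norm (f t))\<^sup>2)"
    using assms by (auto simp: L2_def)
  moreover have "x \<le> \<bar>1 + x\<^sup>2\<bar>" for x :: real
    using sum_squares_bound[of x 1] zero_le_power2[of x] by (simp add: abs_if)
  ultimately show ?thesis
    by (elim Bochner_Integration.integrable_bound) auto
qed

lemma L2_bounded:
  fixes f :: "real \<Rightarrow> 'b::{banach, second_countable_topology}"
  assumes [measurable]: "f \<in> borel_measurable lborel01" and B: "\<And>t. norm (f t) \<le> B"
  shows "f \<in> L2"
  unfolding L2_def using B
  by (auto intro!: integrable_bounded_lborel01[where B = "B\<^sup>2"] power_mono)

lemma trig_L2 [simp]: "trig k \<in> L2"
  by (rule L2_bounded[where B = 1]) (auto intro!: measurable_lborel01_borel)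

lemma cpx_L2: "f \<in> L2 \<Longrightarrow> cpx f \<in> L2"
  by (auto simp: L2_def)

lemma L2_integrable_inner:
  fixes f g :: "real \<Rightarrow> 'b::{euclidean_space}"
  assumes "f \<in> L2" "g \<in> L2"
  shows "integrable lborel01 (\<lambda>t. f t \<bullet> g t)"
proof -
  note [measurable] = assms[THEN L2_borel_measurable]
  have "integrable lborel01 (\<lambda>t. (norm (f t))\<^sup>2 + (norm (g t))\<^sup>2)"
    using assms by (auto simp: L2_def)
  moreover have "\<bar>x \<bullet> y\<bar> \<le> (norm x)\<^sup>2 + (norm y)\<^sup>2" for x y :: 'b
  proof -
    have "\<bar>x \<bullet> y\<bar> \<le> norm x * norm y" by (rule Cauchy_Schwarz_ineq2)
    also have "\<dots> \<le> (norm x)\<^sup>2 + (norm y)\<^sup>2"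
      using sum_squares_bound[of "norm x" "norm y"] mult_nonneg_nonneg[OF norm_ge_zero norm_ge_zero, of x y]
      by linarith
    finally show ?thesis .
  qed
  ultimately show ?thesis
    by (elim Bochner_Integration.integrable_bound) auto
qed

section \<open>Measurability for the sigma-algebra generated by L2 balls\<close>

lemma L2_inner_polarization:
  fixes f g :: "real \<Rightarrow> 'b::{euclidean_space}"
  assumes "f \<in> L2" "g \<in> L2"
  shows "(\<integral>t. f t \<bullet> g t \<partial>lborel01) = ((L2_norm f)\<^sup>2 + (L2_norm g)\<^sup>2 - (L2_norm (\<lambda>t. f t - g t))\<^sup>2) / 2"
proof -
  have "(norm (f t - g t))\<^sup>2 = (norm (f t))\<^sup>2 + (norm (g t))\<^sup>2 - 2 * (f t \<bullet> g t)" for t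
    by (simp add: power2_norm_eq_inner inner_diff inner_commute)
  then show ?thesis
    using assms L2_integrable_inner[OF assms] unfolding L2_norm_square by (simp add: L2_def)
qed

lemma space_L2_borel [simp]: "space L2_borel = L2"
  unfolding L2_borel_def by (auto simp: space_measure_of_conv)

lemma borel_measurable_L2_norm_diff [measurable]:
  fixes g :: "real \<Rightarrow> 'b::{real_normed_vector, second_countable_topology}"
  assumes "g \<in> L2"
  shows "(\<lambda>f. L2_norm (\<lambda>t. f t - g t)) \<in> borel_measurable L2_borel"
proof (rule borel_measurableI_less)
  fix r
  show "{f \<in> space L2_borel. L2_norm (\<lambda>t. f t - g t) < r} \<in> sets L2_borel"
    unfolding space_L2_borel unfolding L2_borel_def
    by (rule in_measure_of) (use assms in auto)
qed

text \<open>Joint measurability makes the distance from \<open>X \<omega>\<close> to a fixed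
  \<open>g\<close> a measurable function of \<omega>, and the preimages of the generating balls are
  its sublevel sets.\<close>

lemma measurable_L2_borelI:
  fixes X :: "'w \<Rightarrow> real \<Rightarrow> 'b::{banach, second_countable_topology}"
  assumes X [measurable]: "(\<lambda>(\<omega>, t). X \<omega> t) \<in> borel_measurable (M \<Otimes>\<^sub>M lborel01)"
    and L2: "\<And>\<omega>. \<omega> \<in> space M \<Longrightarrow> X \<omega> \<in> L2"
  shows "X \<in> M \<rightarrow>\<^sub>M L2_borel"
  unfolding L2_borel_def
proof (rule measurable_measure_of)
  fix B :: "(real \<Rightarrow> 'b) set"
  assume "B \<in> {{f \<in> L2. L2_norm (\<lambda>t. f t - g t) < r} |g r. g \<in> L2}"
  then obtain g :: "real \<Rightarrow> 'b" and r where B: "B = {f \<in> L2. L2_norm (\<lambda>t. f t - g t) < r}" and g: "g \<in> L2"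
    by auto
  note [measurable] = L2_borel_measurable[OF g]
  have [measurable]: "(\<lambda>\<omega>. L2_norm (\<lambda>t. X \<omega> t - g t)) \<in> borel_measurable M"
    unfolding L2_norm_def by measurable
  have "X -` B \<inter> space M = {\<omega> \<in> space M. L2_norm (\<lambda>t. X \<omega> t - g t) < r}"
    using L2 by (auto simp: B)
  then show "X -` B \<inter> space M \<in> sets M"
    by simp
qed (use L2 in auto)

text \<open>The generating balls give measurability of distances only. Polarization expresses the
  pairing with \<open>g\<close> through the distances of \<open>f\<close> to 0 and to
  \<open>g\<close>. The real inner product serves real and complex functions alike.\<close>

lemma borel_measurable_integral_inner_L2:
  fixes g :: "real \<Rightarrow> 'b::{euclidean_space}"
  assumes "g \<in> L2"
  shows "(\<lambda>f. \<integral>t. f t \<bullet> g t \<partial>lborel01) \<in> borel_measurable L2_borel"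
proof -
  have "(\<lambda>f :: real \<Rightarrow> 'b. L2_norm f) \<in> borel_measurable L2_borel"
    using borel_measurable_L2_norm_diff[OF L2_zero] by simp
  then have "(\<lambda>f. ((L2_norm f)\<^sup>2 + (L2_norm g)\<^sup>2 - (L2_norm (\<lambda>t. f t - g t))\<^sup>2) / 2) \<in> borel_measurable L2_borel"
    using borel_measurable_L2_norm_diff[OF assms] by measurable
  then show ?thesis
    by (rule measurable_cong[THEN iffD1, rotated]) (simp add: L2_inner_polarization assms)
qed

lemma L2_integrable_mult_cnj:
  assumes "f \<in> L2" "g \<in> L2"
  shows "integrable lborel01 (\<lambda>t. f t * cnj (g t))"
proof -
  note [measurable] = assms[THEN L2_borel_measurable]
  \<comment> \<open>Pairing with \<open>g\<close> in the real inner product yields the real part of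
    \<open>f t * cnj (g t)\<close>, and pairing with \<open>\<i> * g t\<close> yields the imaginary
    part.\<close>
  have "(\<lambda>t. \<i> * g t) \<in> L2"
    using assms by (auto simp: L2_def norm_mult)
  then have "integrable lborel01 (\<lambda>t. Complex (f t \<bullet> g t) (f t \<bullet> (\<i> * g t)))"
    using assms L2_integrable_inner unfolding Complex_eq
    by (intro Bochner_Integration.integrable_add integrable_mult_right integrable_of_real) auto
  moreover have "Complex (f t \<bullet> g t) (f t \<bullet> (\<i> * g t)) = f t * cnj (g t)" for t
    by (auto simp: complex_eq_iff inner_complex_def)
  ultimately show ?thesis by simp
qed

lemma borel_measurable_L2_inner:
  assumes "g \<in> L2"
  shows "(\<lambda>f. L2_inner f g) \<in> borel_measurable L2_borel"
proof -
  have ig: "(\<lambda>t. \<i> * g t) \<in> L2"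
    using assms L2_borel_measurable[OF assms] by (auto simp: L2_def norm_mult)
  have "(\<lambda>f. Complex (\<integral>t. f t \<bullet> g t \<partial>lborel01) (\<integral>t. f t \<bullet> (\<i> * g t) \<partial>lborel01)) \<in> borel_measurable L2_borel"
    using borel_measurable_integral_inner_L2[OF assms] borel_measurable_integral_inner_L2[OF ig]
    unfolding Complex_eq by measurable
  moreover have "L2_inner f g = Complex (\<integral>t. f t \<bullet> g t \<partial>lborel01) (\<integral>t. f t \<bullet> (\<i> * g t) \<partial>lborel01)" if "f \<in> L2" for f
  proof -
    have "integrable lborel01 (\<lambda>t. f t * cnj (g t))"
      by (rule L2_integrable_mult_cnj) fact+
    from integral_Re[OF this] integral_Im[OF this] show ?thesis
      by (auto simp: complex_eq_iff inner_complex_def L2_inner_def algebra_simps)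
  qed
  ultimately show ?thesis
    by (elim measurable_cong[THEN iffD1, rotated]) simp
qed

section \<open>Fourier coefficients of trigonometric polynomials and Bessel's inequality\<close>

lemma L2_inner_diff_left:
  assumes "f \<in> L2" "g \<in> L2" "h \<in> L2"
  shows "L2_inner (\<lambda>t. f t - g t) h = L2_inner f h - L2_inner g h"
  using assms by (simp add: L2_inner_def left_diff_distrib L2_integrable_mult_cnj)

lemma L2_inner_sum_left:
  assumes "\<And>i. i \<in> I \<Longrightarrow> f i \<in> L2" "h \<in> L2"
  shows "L2_inner (\<lambda>t. \<Sum>i\<in>I. c i * f i t) h = (\<Sum>i\<in>I. c i * L2_inner (f i) h)"
proof -
  have "L2_inner (\<lambda>t. \<Sum>i\<in>I. c i * f i t) h = (\<integral>t. (\<Sum>i\<in>I. c i * (f i t * cnj (h t))) \<partial>lborel01)"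
    by (simp add: L2_inner_def sum_distrib_right mult.assoc)
  also have "\<dots> = (\<Sum>i\<in>I. (\<integral>t. c i * (f i t * cnj (h t)) \<partial>lborel01))"
    using assms by (intro Bochner_Integration.integral_sum) (auto intro!: L2_integrable_mult_cnj)
  finally show ?thesis by (simp add: L2_inner_def)
qed

lemma L2_inner_commute: "cnj (L2_inner f g) = L2_inner g f"
  unfolding L2_inner_def Bochner_Integration.integral_cnj[symmetric] by (simp add: mult.commute)

lemma L2_inner_trig: "L2_inner (trig j) (trig k) = (if j = k then 1 else 0)"
  by (auto simp: L2_inner_def cnj_trig trig_mult integral_trig)

lemma trig_sum_L2: "(\<lambda>t. \<Sum>k\<in>I. c k * trig k t) \<in> L2"
proof (rule L2_bounded[where B = "\<Sum>k\<in>I. cmod (c k)"])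
  show "(\<lambda>t. \<Sum>k\<in>I. c k * trig k t) \<in> borel_measurable lborel01"
    by (intro measurable_lborel01_borel) measurable
  show "cmod (\<Sum>k\<in>I. c k * trig k t) \<le> (\<Sum>k\<in>I. cmod (c k))" for t
    by (rule order_trans[OF norm_sum]) (simp add: norm_mult)
qed

lemma L2_inner_trig_sum:
  "finite I \<Longrightarrow> L2_inner (\<lambda>t. \<Sum>j\<in>I. c j * trig j t) (trig k) = (if k \<in> I then c k else 0)"
  by (subst L2_inner_sum_left) (auto simp: L2_inner_trig if_distrib cong: if_cong)

lemma L2_norm_square_eq_L2_inner:
  "of_real ((L2_norm f)\<^sup>2) = L2_inner f f"
  unfolding L2_norm_square L2_inner_def
  by (simp add: complex_norm_square[symmetric] of_real_power[symmetric] del: of_real_power)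

lemma L2_norm_trig_sum:
  assumes "finite I"
  shows "(L2_norm (\<lambda>t. \<Sum>k\<in>I. c k * trig k t))\<^sup>2 = (\<Sum>k\<in>I. (cmod (c k))\<^sup>2)"
proof -
  let ?f = "\<lambda>t. \<Sum>k\<in>I. c k * trig k t"
  have "complex_of_real ((L2_norm ?f)\<^sup>2) = (\<Sum>k\<in>I. c k * L2_inner (trig k) ?f)"
    unfolding L2_norm_square_eq_L2_inner by (rule L2_inner_sum_left) (auto intro: trig_sum_L2)
  also have "\<dots> = (\<Sum>k\<in>I. c k * cnj (c k))"
    using assms by (intro sum.cong refl) (simp add: L2_inner_commute[symmetric, of "trig _"] L2_inner_trig_sum)
  also have "\<dots> = complex_of_real (\<Sum>k\<in>I. (cmod (c k))\<^sup>2)"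
    by (simp add: complex_norm_square[symmetric])
  finally show ?thesis
    using of_real_eq_iff by blast
qed

text \<open>Let \<open>?p\<close> be the trigonometric polynomial with the coefficients of
  \<open>f\<close>. Its pairing with \<open>f\<close> and its squared norm both equal the sum s on
  the left, so polarization gives s = n - e with n the squared norm of \<open>f\<close> and e that
  of \<open>f - ?p\<close>.\<close>

lemma bessel_inequality:
  assumes f: "f \<in> L2" and I: "finite I"
  shows "(\<Sum>k\<in>I. (cmod (L2_inner f (trig k)))\<^sup>2) \<le> (L2_norm f)\<^sup>2"
proof -
  define c where "c k = L2_inner f (trig k)" for k
  let ?p = "\<lambda>t. \<Sum>k\<in>I. c k * trig k t"
  have p: "?p \<in> L2" by (rule trig_sum_L2)
  have "L2_inner ?p f = (\<Sum>k\<in>I. c k * L2_inner (trig k) f)"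
    using f by (intro L2_inner_sum_left) auto
  also have "\<dots> = (\<Sum>k\<in>I. c k * cnj (c k))"
    by (simp add: c_def L2_inner_commute)
  also have "\<dots> = complex_of_real (\<Sum>k\<in>I. (cmod (c k))\<^sup>2)"
    by (simp add: complex_norm_square[symmetric])
  finally have pf: "L2_inner ?p f = complex_of_real (\<Sum>k\<in>I. (cmod (c k))\<^sup>2)" .
  have "(\<integral>t. f t \<bullet> ?p t \<partial>lborel01) = Re (L2_inner ?p f)"
    unfolding L2_inner_def
    by (subst integral_Re[symmetric]) (use L2_integrable_mult_cnj[OF p f] in \<open>auto simp: inner_complex_def mult_ac\<close>)
  then have "(\<Sum>k\<in>I. (cmod (c k))\<^sup>2) = ((L2_norm f)\<^sup>2 + (\<Sum>k\<in>I. (cmod (c k))\<^sup>2) - (L2_norm (\<lambda>t. f t - ?p t))\<^sup>2) / 2"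
    unfolding L2_inner_polarization[OF f p] pf L2_norm_trig_sum[OF I] by simp
  moreover have "s \<le> n" if "s = (n + s - e) / 2" "0 \<le> e" for s n e :: real
    using that by (simp add: field_simps)
  ultimately show ?thesis
    unfolding c_def using zero_le_power2 by blast
qed

section \<open>The Riesz-Fischer theorem\<close>

text \<open>The pointwise bound x \<le> e / 2 + x^2 / (2 e) replaces Cauchy-Schwarz; since [0,1] has
  mass 1, integrating it gives e / 2 + e / 2.\<close>

lemma integral_norm_le_L2:
  fixes f :: "real \<Rightarrow> 'b::{banach, second_countable_topology}"
  assumes f: "f \<in> L2" and e: "e > 0" "(L2_norm f)\<^sup>2 \<le> e\<^sup>2"
  shows "(\<integral>t. norm (f t) \<partial>lborel01) \<le> e"
proof -
  have amgm: "x \<le> e / 2 + x\<^sup>2 / (2 * e)" for x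
    using sum_squares_bound[of x e] e(1) by (simp add: field_simps power2_eq_square)
  have int: "integrable lborel01 (\<lambda>t. (norm (f t))\<^sup>2)"
    by (rule L2_integrable_norm_square) fact
  have "(\<integral>t. norm (f t) \<partial>lborel01) \<le> (\<integral>t. e / 2 + (norm (f t))\<^sup>2 / (2 * e) \<partial>lborel01)"
    using L2_integrable[OF f] int by (intro integral_mono amgm) auto
  also have "\<dots> = e / 2 + (L2_norm f)\<^sup>2 / (2 * e)"
    using int lborel01.prob_space by (simp add: L2_norm_square)
  also have "\<dots> \<le> e / 2 + e\<^sup>2 / (2 * e)"
    using e by (intro add_left_mono divide_right_mono) auto
  also have "\<dots> = e"
    using e(1) by (simp add: power2_eq_square)
  finally show ?thesis .
qed

lemma cmod_L2_inner_trig_le: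
  assumes "f \<in> L2" "e > 0" "(L2_norm f)\<^sup>2 \<le> e\<^sup>2"
  shows "cmod (L2_inner f (trig k)) \<le> e"
proof -
  have "cmod (L2_inner f (trig k)) \<le> (\<integral>t. cmod (f t * cnj (trig k t)) \<partial>lborel01)"
    unfolding L2_inner_def by simp
  also have "\<dots> \<le> e"
    using integral_norm_le_L2[OF assms] by (simp add: norm_mult)
  finally show ?thesis .
qed

text \<open>The partial sums along a subsequence with tails at most \<open>4 ^ (-j)\<close> converge almost
  everywhere, and Fatou's lemma transfers their L2 bounds to the limit.\<close>

theorem riesz_fischer:
  fixes r :: "int \<Rightarrow> complex"
  assumes sum: "(\<lambda>k. (cmod (r k))\<^sup>2) summable_on UNIV"
  obtains g where "g \<in> borel_measurable borel" "\<And>t. g (t + 1) = g t" "g \<in> L2"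
    "\<And>k. L2_inner g (trig k) = r k" "(L2_norm g)\<^sup>2 \<le> (\<Sum>\<^sub>\<infinity>k. (cmod (r k))\<^sup>2)"
proof -
  define J where "J n = {- int n..int n}" for n
  define T where "T n t = (\<Sum>k\<in>J n. r k * trig k t)" for n t
  define s where "s n = (\<Sum>k\<in>J n. (cmod (r k))\<^sup>2)" for n
  define S where "S = (\<Sum>\<^sub>\<infinity>k. (cmod (r k))\<^sup>2)"
  have J_mono: "J n \<subseteq> J m" if "n \<le> m" for n m
    using that by (auto simp: J_def)
  have fin [simp]: "finite (J n)" for n
    by (simp add: J_def)
  have s_mono: "s n \<le> s m" if "n \<le> m" for n m
    unfolding s_def by (rule sum_mono2) (use J_mono[OF that] in auto)
  have s_le: "s n \<le> S" for n
    unfolding s_def S_def by (rule finite_sum_le_infsum[OF sum]) auto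
  have T_meas [measurable]: "T n \<in> borel_measurable borel" for n
    unfolding T_def[abs_def] by measurable
  have T_diff: "(\<lambda>t. T m t - T n t) \<in> L2" "(L2_norm (\<lambda>t. T m t - T n t))\<^sup>2 = s m - s n" if "n \<le> m" for n m
  proof -
    have eq: "T m t - T n t = (\<Sum>k\<in>J m - J n. r k * trig k t)" for t
      unfolding T_def using J_mono[OF that] by (simp add: sum_diff)
    show "(\<lambda>t. T m t - T n t) \<in> L2"
      unfolding eq by (rule trig_sum_L2)
    show "(L2_norm (\<lambda>t. T m t - T n t))\<^sup>2 = s m - s n"
      unfolding eq s_def using J_mono[OF that] by (subst L2_norm_trig_sum) (auto simp: sum_diff)
  qed
  have "\<exists>n. S - s n \<le> e" if "e > 0" for e
  proof -
    obtain F where F: "finite F" "dist (\<Sum>k\<in>F. (cmod (r k))\<^sup>2) S \<le> e"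
      using infsum_finite_approximation[OF sum \<open>e > 0\<close>] unfolding S_def by blast
    obtain b where b: "\<And>k. k \<in> F \<Longrightarrow> \<bar>k\<bar> \<le> b"
      using bdd_above_finite[of "abs ` F"] F(1) by (auto simp: bdd_above_def)
    then have "F \<subseteq> J (nat \<bar>b\<bar>)"
      by (force simp: J_def)
    then have "(\<Sum>k\<in>F. (cmod (r k))\<^sup>2) \<le> s (nat \<bar>b\<bar>)"
      unfolding s_def by (intro sum_mono2) auto
    then have "S - s (nat \<bar>b\<bar>) \<le> e"
      using F(2) by (simp add: dist_real_def)
    then show ?thesis ..
  qed
  \<comment> \<open>Tails of size \<open>(1 / 4) ^ j\<close> bound the L2 norms of the increments by
    \<open>(1 / 2) ^ j\<close>, hence also their L1 norms, and these are summable.\<close>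
  then have "\<exists>n. S - s n \<le> (1 / 4) ^ j" for j :: nat
    by simp
  then obtain f where f: "S - s (f j) \<le> (1 / 4) ^ j" for j
    by metis
  \<comment> \<open>Cumulative sums make the indices monotone in j and keep them above
    \<open>f j\<close>, so the tail bound survives.\<close>
  define N where "N j = (\<Sum>i\<le>j. f i)" for j
  have N_mono: "N i \<le> N j" if "i \<le> j" for i j
    unfolding N_def using that by (intro sum_mono2) auto
  have tail: "S - s (N j) \<le> (1 / 4) ^ j" for j
  proof -
    have "f j \<le> N j" unfolding N_def by (rule member_le_sum) auto
    then show ?thesis using f[of j] s_mono[of "f j" "N j"] by simp
  qed
  define D where "D j t = T (N (Suc j)) t - T (N j) t" for j t
  have D_L2: "D j \<in> L2" for j
    unfolding D_def[abs_def] by (rule T_diff) (simp add: N_mono)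
  note [measurable] = D_L2[THEN L2_borel_measurable]
  have D_le: "(\<integral>t. cmod (D j t) \<partial>lborel01) \<le> (1 / 2) ^ j" for j
  proof (rule integral_norm_le_L2[OF D_L2])
    have "(L2_norm (D j))\<^sup>2 = s (N (Suc j)) - s (N j)"
      unfolding D_def[abs_def] by (rule T_diff) (simp add: N_mono)
    also have "\<dots> \<le> (1 / 4) ^ j"
      using tail[of j] s_le[of "N (Suc j)"] by simp
    also have "\<dots> = ((1 / 2) ^ j)\<^sup>2"
      by (simp add: power2_eq_square power_mult_distrib[symmetric])
    finally show "(L2_norm (D j))\<^sup>2 \<le> ((1 / 2) ^ j)\<^sup>2" .
  qed simp
  have "(\<integral>\<^sup>+t. (\<Sum>j. ennreal (cmod (D j t))) \<partial>lborel01) = (\<Sum>j. (\<integral>\<^sup>+t. ennreal (cmod (D j t)) \<partial>lborel01))"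
    by (rule nn_integral_suminf) measurable
  also have "\<dots> \<le> (\<Sum>j. ennreal ((1 / 2) ^ j))"
  proof (rule suminf_le)
    fix j
    have "(\<integral>\<^sup>+t. ennreal (cmod (D j t)) \<partial>lborel01) = ennreal (\<integral>t. cmod (D j t) \<partial>lborel01)"
      using L2_integrable[OF D_L2] by (intro nn_integral_eq_integral) auto
    then show "(\<integral>\<^sup>+t. ennreal (cmod (D j t)) \<partial>lborel01) \<le> ennreal ((1 / 2) ^ j)"
      using D_le by (simp add: ennreal_leI)
  qed auto
  also have "\<dots> < \<infinity>"
    by (subst suminf_ennreal2) (auto simp: summable_geometric)
  finally have "(\<integral>\<^sup>+t. (\<Sum>j. ennreal (cmod (D j t))) \<partial>lborel01) \<noteq> \<infinity>"
    by simp
  then have "AE t in lborel01. (\<Sum>j. ennreal (cmod (D j t))) \<noteq> \<infinity>"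
    by (rule nn_integral_PInf_AE[rotated]) measurable
  then have conv: "AE t in lborel01. convergent (\<lambda>j. T (N j) t)"
  proof eventually_elim
    case (elim t)
    then have "summable (\<lambda>j. cmod (D j t))"
      by (intro summable_suminf_not_top) auto
    then have "summable (\<lambda>j. D j t)"
      by (rule summable_norm_cancel)
    then have "convergent (\<lambda>j. T (N 0) t + (\<Sum>i<j. D i t))"
      by (intro convergent_add convergent_const) (simp add: summable_iff_convergent)
    moreover have "T (N 0) t + (\<Sum>i<j. D i t) = T (N j) t" for j
      unfolding D_def sum_lessThan_telescope[of "\<lambda>j. T (N j) t"] by simp
    ultimately show ?case by simp
  qed
  \<comment> \<open>Since \<open>lim\<close> has some value at points of divergence too,
    \<open>g\<close> is measurable and 1-periodic at every point, not merely almost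
    everywhere.\<close>
  define g where "g t = lim (\<lambda>j. T (N j) t)" for t
  have g_meas [measurable]: "g \<in> borel_measurable borel"
    unfolding g_def[abs_def] by measurable
  have g_per: "g (t + 1) = g t" for t
    by (simp add: g_def T_def trig_periodic)
  note [measurable] = measurable_lborel01_borel[OF g_meas] measurable_lborel01_borel[OF T_meas]
  \<comment> \<open>Applied with q = 0 for the norm of \<open>g\<close> and with q =
    \<open>T (N i)\<close> for the distance of \<open>g\<close> to its partial sums.\<close>
  have fatou: "(\<integral>\<^sup>+t. ennreal ((cmod (g t - q t))\<^sup>2) \<partial>lborel01) \<le> ennreal B"
    if q [measurable]: "q \<in> borel_measurable lborel01"
      and B: "\<And>j. j \<ge> i \<Longrightarrow> (\<lambda>t. T (N j) t - q t) \<in> L2 \<and> (L2_norm (\<lambda>t. T (N j) t - q t))\<^sup>2 \<le> B"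
    for q B i
  proof -
    have "(\<integral>\<^sup>+t. ennreal ((cmod (g t - q t))\<^sup>2) \<partial>lborel01) = (\<integral>\<^sup>+t. liminf (\<lambda>j. ennreal ((cmod (T (N j) t - q t))\<^sup>2)) \<partial>lborel01)"
    proof (rule nn_integral_cong_AE, use conv in eventually_elim)
      fix t assume "convergent (\<lambda>j. T (N j) t)"
      then have "(\<lambda>j. T (N j) t) \<longlonglongrightarrow> g t"
        by (simp add: convergent_LIMSEQ_iff g_def)
      then have "(\<lambda>j. ennreal ((cmod (T (N j) t - q t))\<^sup>2)) \<longlonglongrightarrow> ennreal ((cmod (g t - q t))\<^sup>2)"
        by (intro tendsto_intros)
      then show "ennreal ((cmod (g t - q t))\<^sup>2) = liminf (\<lambda>j. ennreal ((cmod (T (N j) t - q t))\<^sup>2))"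
        by (intro lim_imp_Liminf[symmetric]) auto
    qed
    also have "\<dots> \<le> liminf (\<lambda>j. \<integral>\<^sup>+t. ennreal ((cmod (T (N j) t - q t))\<^sup>2) \<partial>lborel01)"
      by (rule nn_integral_liminf) measurable
    also have "\<dots> \<le> liminf (\<lambda>j. ennreal B)"
    proof (rule Liminf_mono)
      show "\<forall>\<^sub>F j in sequentially. (\<integral>\<^sup>+t. ennreal ((cmod (T (N j) t - q t))\<^sup>2) \<partial>lborel01) \<le> ennreal B"
        using eventually_ge_at_top[of i]
        by eventually_elim (use B in \<open>auto simp: ennreal_L2_norm_square[symmetric] intro!: ennreal_leI\<close>)
    qed
    also have "\<dots> = ennreal B"
      by (simp add: Liminf_const)
    finally show ?thesis .
  qed
  have L2I: "h \<in> L2 \<and> (L2_norm h)\<^sup>2 \<le> B"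
    if [measurable]: "h \<in> borel_measurable lborel01"
      and le: "(\<integral>\<^sup>+t. ennreal ((cmod (h t))\<^sup>2) \<partial>lborel01) \<le> ennreal B" and "B \<ge> 0" for h B
  proof
    show "h \<in> L2"
      unfolding L2_def using le by (auto simp: integrable_iff_bounded intro: le_less_trans)
    then show "(L2_norm h)\<^sup>2 \<le> B"
      using le \<open>B \<ge> 0\<close> by (simp add: ennreal_L2_norm_square[symmetric])
  qed
  have S_nonneg: "S \<ge> 0"
    unfolding S_def by (rule infsum_nonneg) simp
  have g_bound: "g \<in> L2 \<and> (L2_norm g)\<^sup>2 \<le> S"
  proof (rule L2I)
    show "(\<integral>\<^sup>+t. ennreal ((cmod (g t))\<^sup>2) \<partial>lborel01) \<le> ennreal S"
      using fatou[of "\<lambda>t. 0" 0 S] s_le by (simp add: T_def[abs_def] trig_sum_L2 L2_norm_trig_sum s_def)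
  qed (auto simp: S_nonneg)
  have approx: "(\<lambda>t. g t - T (N i) t) \<in> L2 \<and> (L2_norm (\<lambda>t. g t - T (N i) t))\<^sup>2 \<le> ((1 / 2) ^ i)\<^sup>2" for i
  proof (rule L2I)
    have "(1 / 4) ^ i = ((1 / 2) ^ i :: real)\<^sup>2"
      by (simp add: power2_eq_square power_mult_distrib[symmetric])
    then have "(L2_norm (\<lambda>t. T (N j) t - T (N i) t))\<^sup>2 \<le> ((1 / 2) ^ i)\<^sup>2" if "j \<ge> i" for j
      using T_diff(2)[OF N_mono[OF that]] tail[of i] s_le[of "N j"] by simp
    then show "(\<integral>\<^sup>+t. ennreal ((cmod (g t - T (N i) t))\<^sup>2) \<partial>lborel01) \<le> ennreal (((1 / 2) ^ i)\<^sup>2)"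
      by (intro fatou[of _ i]) (auto intro: T_diff(1) N_mono)
  qed auto
  \<comment> \<open>\<open>N\<close> need not tend to infinity, for instance if only finitely many
    \<open>r k\<close> are nonzero. A nonzero \<open>r k\<close> still enters eventually, because
    outside \<open>J (N i)\<close> it would be part of a tail of size at most
    \<open>(1 / 4) ^ i\<close>.\<close>
  have J_N: "\<exists>i0. \<forall>i\<ge>i0. r k = 0 \<or> k \<in> J (N i)" for k
  proof (cases "r k = 0")
    case False
    define i0 where "i0 = (SOME i. (1 / 4 :: real) ^ i < (cmod (r k))\<^sup>2)"
    have "\<exists>i. (1 / 4 :: real) ^ i < (cmod (r k))\<^sup>2"
      using False by (intro real_arch_pow_inv) auto
    then have i0: "(1 / 4 :: real) ^ i0 < (cmod (r k))\<^sup>2"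
      unfolding i0_def by (rule someI_ex)
    have "k \<in> J (N i)" if "i \<ge> i0" for i
    proof (rule ccontr)
      assume k: "k \<notin> J (N i)"
      have "(\<Sum>j\<in>insert k (J (N i)). (cmod (r j))\<^sup>2) \<le> S"
        unfolding S_def by (rule finite_sum_le_infsum[OF sum]) auto
      then have "(cmod (r k))\<^sup>2 \<le> S - s (N i)"
        using k by (simp add: s_def)
      also have "\<dots> \<le> (1 / 4) ^ i" by (rule tail)
      also have "\<dots> \<le> (1 / 4) ^ i0" using that by (intro power_decreasing) auto
      finally show False using i0 by simp
    qed
    then show ?thesis by blast
  qed simp
  have coef: "L2_inner g (trig k) = r k" for k
  proof -
    obtain i0 where i0: "\<And>i. i \<ge> i0 \<Longrightarrow> r k = 0 \<or> k \<in> J (N i)"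
      using J_N by blast
    have T_L2: "T n \<in> L2" for n
      unfolding T_def[abs_def] by (rule trig_sum_L2)
    have "cmod (L2_inner g (trig k) - r k) \<le> (1 / 2) ^ i" if "i \<ge> i0" for i
    proof -
      have "L2_inner (T (N i)) (trig k) = r k"
        unfolding T_def[abs_def] using i0[OF that] by (auto simp: L2_inner_trig_sum)
      then have "L2_inner g (trig k) - r k = L2_inner (\<lambda>t. g t - T (N i) t) (trig k)"
        using g_bound T_L2 by (simp add: L2_inner_diff_left)
      then show ?thesis
        using approx[of i] by (simp add: cmod_L2_inner_trig_le)
    qed
    then have "eventually (\<lambda>i. cmod (L2_inner g (trig k) - r k) \<le> (1 / 2) ^ i) sequentially"
      by (auto simp: eventually_sequentially)
    moreover have "(\<lambda>i. (1 / 2 :: real) ^ i) \<longlonglongrightarrow> 0"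
      by (rule LIMSEQ_power_zero) simp
    ultimately have "cmod (L2_inner g (trig k) - r k) \<le> 0"
      by (intro tendsto_le[OF _ _ tendsto_const]) auto
    then show ?thesis by simp
  qed
  show ?thesis
    by (rule that[of g]) (use g_bound in \<open>auto simp: g_per coef S_def\<close>)
qed

text \<open>Passing to the real part averages the coefficient at k with the conjugate of the one at
  -k; for real symmetric \<open>r\<close> this changes nothing.\<close>

corollary riesz_fischer_real:
  fixes r :: "int \<Rightarrow> real"
  assumes sum: "(\<lambda>k. (r k)\<^sup>2) summable_on UNIV" and sym: "\<And>k. r (- k) = r k"
  obtains g where "g \<in> borel_measurable borel" "\<And>t. g (t + 1) = g t" "g \<in> L2"
    "\<And>k. L2_inner (cpx g) (trig k) = of_real (r k)" "(L2_norm g)\<^sup>2 \<le> (\<Sum>\<^sub>\<infinity>k. (r k)\<^sup>2)"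
proof -
  obtain g where g: "g \<in> borel_measurable borel" "\<And>t. g (t + 1) = g t" "g \<in> L2"
    "\<And>k. L2_inner g (trig k) = of_real (r k)" "(L2_norm g)\<^sup>2 \<le> (\<Sum>\<^sub>\<infinity>k. (cmod (of_real (r k)))\<^sup>2)"
    using riesz_fischer[of "\<lambda>k. of_real (r k)"] sum by auto
  note [measurable] = g(1) L2_borel_measurable[OF g(3)]
  let ?h = "\<lambda>t. Re (g t)"
  have sq_le: "(norm (Re z))\<^sup>2 \<le> (cmod z)\<^sup>2" for z
    by (simp add: cmod_power2)
  have h: "?h \<in> L2"
    unfolding L2_def
    using Bochner_Integration.integrable_bound[OF L2_integrable_norm_square[OF g(3)], of "\<lambda>t. (norm (Re (g t)))\<^sup>2"] sq_le
    by auto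
  have "(L2_norm ?h)\<^sup>2 \<le> (L2_norm g)\<^sup>2"
    unfolding L2_norm_square
    by (intro integral_mono L2_integrable_norm_square sq_le h g(3))
  also have "\<dots> \<le> (\<Sum>\<^sub>\<infinity>k. (r k)\<^sup>2)"
    using g(5) by simp
  finally have norm: "(L2_norm ?h)\<^sup>2 \<le> (\<Sum>\<^sub>\<infinity>k. (r k)\<^sup>2)" .
  have "L2_inner (cpx ?h) (trig k) = of_real (r k)" for k
  proof -
    have "cpx ?h t * cnj (trig k t) = (g t * cnj (trig k t) + cnj (g t * cnj (trig (- k) t))) / 2" for t
      by (simp add: cnj_trig complex_eq_iff algebra_simps)
    then have "L2_inner (cpx ?h) (trig k) = (\<integral>t. (g t * cnj (trig k t) + cnj (g t * cnj (trig (- k) t))) / 2 \<partial>lborel01)"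
      unfolding L2_inner_def by (simp only:)
    also have "\<dots> = (L2_inner g (trig k) + cnj (L2_inner g (trig (- k)))) / 2"
      unfolding L2_inner_def integral_divide_zero
      by (subst Bochner_Integration.integral_add)
        (auto simp: L2_integrable_mult_cnj g(3) simp del: complex_cnj_mult intro!: integrable_cnj)
    finally show ?thesis
      by (simp add: g(4) sym)
  qed
  then show ?thesis
    using g(2) h norm by (intro that[of ?h]) auto
qed

section \<open>Random shifts with a random sign and Gaussian noise\<close>

definition std_gaussian :: "real measure" where
  "std_gaussian = density lborel (\<lambda>x. ennreal (std_normal_density x))"

definition coin :: "bool measure" where
  "coin = measure_pmf (bernoulli_pmf (1 / 2))"

text \<open>The coordinates are the shift \<open>V\<close>, the sign (\<open>True\<close> for + 1)
  and the noise \<open>U\<close>, independent by construction.\<close>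

definition shift_space :: "(real \<times> bool \<times> real) measure" where
  "shift_space = lborel01 \<Otimes>\<^sub>M (coin \<Otimes>\<^sub>M std_gaussian)"

lemma sets_std_gaussian [measurable_cong, simp]: "sets std_gaussian = sets borel"
  and space_std_gaussian [simp]: "space std_gaussian = UNIV"
  by (simp_all add: std_gaussian_def)

lemma sets_coin [measurable_cong, simp]: "sets coin = sets (count_space UNIV)"
  and space_coin [simp]: "space coin = UNIV"
  by (simp_all add: coin_def)

lemma prob_space_std_gaussian: "prob_space std_gaussian"
  unfolding std_gaussian_def by (rule prob_space_normal_density) simp

interpretation std_gaussian: prob_space std_gaussian
  by (rule prob_space_std_gaussian)

interpretation coin: prob_space coin
  unfolding coin_def by (rule prob_space_measure_pmf)

interpretation coin_gaussian: pair_prob_space coin std_gaussian ..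

interpretation shift_space: pair_prob_space lborel01 "coin \<Otimes>\<^sub>M std_gaussian" ..

lemma prob_space_shift_space: "prob_space shift_space"
  unfolding shift_space_def by unfold_locales

lemma space_shift_space: "space shift_space = {0..1} \<times> UNIV"
  by (simp add: shift_space_def space_pair_measure)

lemma nn_integral_coin: "(\<integral>\<^sup>+b. f b \<partial>coin) = (f True + f False) / 2"
  by (simp add: coin_def nn_integral_measure_pmf nn_integral_count_space_finite UNIV_bool
      divide_ennreal_def ennreal_divide_numeral[symmetric] algebra_simps)

lemma nn_integral_shift_space:
  assumes f [measurable]: "f \<in> borel_measurable shift_space"
  shows "(\<integral>\<^sup>+z. f z \<partial>shift_space) = (\<integral>\<^sup>+v. \<integral>\<^sup>+b. \<integral>\<^sup>+u. f (v, b, u) \<partial>std_gaussian \<partial>coin \<partial>lborel01)"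
proof -
  note [measurable] = f[unfolded shift_space_def]
  have "(\<integral>\<^sup>+z. f z \<partial>shift_space) = (\<integral>\<^sup>+v. \<integral>\<^sup>+c. f (v, c) \<partial>(coin \<Otimes>\<^sub>M std_gaussian) \<partial>lborel01)"
    unfolding shift_space_def by (rule coin_gaussian.nn_integral_fst[symmetric]) measurable
  also have "\<dots> = (\<integral>\<^sup>+v. \<integral>\<^sup>+b. \<integral>\<^sup>+u. f (v, b, u) \<partial>std_gaussian \<partial>coin \<partial>lborel01)"
    by (intro nn_integral_cong std_gaussian.nn_integral_fst[symmetric]) measurable
  finally show ?thesis .
qed

lemma distr_shift_space_flip:
  "distr shift_space shift_space (\<lambda>(v, b, u). (v, \<not> b, u)) = shift_space"
proof (rule measure_eqI)
  fix A assume "A \<in> sets (distr shift_space shift_space (\<lambda>(v, b, u). (v, \<not> b, u)))"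
  then have [measurable]: "A \<in> sets shift_space" by simp
  have [measurable]: "(\<lambda>(v, b, u). (v, \<not> b, u)) \<in> shift_space \<rightarrow>\<^sub>M shift_space"
    unfolding shift_space_def by measurable
  have "emeasure (distr shift_space shift_space (\<lambda>(v, b, u). (v, \<not> b, u))) A
      = (\<integral>\<^sup>+z. indicator A z \<partial>distr shift_space shift_space (\<lambda>(v, b, u). (v, \<not> b, u)))"
    by simp
  also have "\<dots> = (\<integral>\<^sup>+z. indicator A (case z of (v, b, u) \<Rightarrow> (v, \<not> b, u)) \<partial>shift_space)"
    by (rule nn_integral_distr) measurable
  also have "\<dots> = (\<integral>\<^sup>+z. indicator A z \<partial>shift_space)"
  proof -
    have m: "(\<lambda>z. indicator A (case z of (v, b, u) \<Rightarrow> (v, \<not> b, u))) \<in> borel_measurable shift_space"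
      "indicator A \<in> borel_measurable shift_space"
      by measurable
    show ?thesis
      unfolding nn_integral_shift_space[OF m(1)] nn_integral_shift_space[OF m(2)]
      by (simp add: nn_integral_coin add.commute)
  qed
  finally show "emeasure (distr shift_space shift_space (\<lambda>(v, b, u). (v, \<not> b, u))) A = emeasure shift_space A"
    by simp
qed simp

text \<open>Flipping the sign preserves the law, so the integral equals its own negative. The
  centering of the constructed process and of its coefficients, and its orthogonality to the noise,
  come from here.\<close>

lemma integral_shift_space_odd:
  fixes F :: "_ \<Rightarrow> 'b::{banach, second_countable_topology}"
  assumes [measurable]: "F \<in> borel_measurable shift_space"
    and odd: "\<And>v b u. F (v, \<not> b, u) = - F (v, b, u)"
  shows "(\<integral>z. F z \<partial>shift_space) = 0"
proof -
  have [measurable]: "(\<lambda>(v, b, u). (v, \<not> b, u)) \<in> shift_space \<rightarrow>\<^sub>M shift_space"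
    unfolding shift_space_def by measurable
  have "(\<integral>z. F z \<partial>shift_space) = (\<integral>z. F z \<partial>distr shift_space shift_space (\<lambda>(v, b, u). (v, \<not> b, u)))"
    by (simp only: distr_shift_space_flip)
  also have "\<dots> = (\<integral>z. F (case z of (v, b, u) \<Rightarrow> (v, \<not> b, u)) \<partial>shift_space)"
    by (rule integral_distr) measurable
  also have "\<dots> = (\<integral>z. - F z \<partial>shift_space)"
    by (intro Bochner_Integration.integral_cong) (auto simp: odd)
  finally have "(\<integral>z. F z \<partial>shift_space) = - (\<integral>z. F z \<partial>shift_space)"
    by simp
  then have "2 *\<^sub>R (\<integral>z. F z \<partial>shift_space) = 0"
    by (simp add: scaleR_2 eq_neg_iff_add_eq_0)
  then show ?thesis by simp
qed

lemma distr_shift_space_shift: "distr shift_space lborel01 fst = lborel01"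
  unfolding shift_space_def by (rule coin_gaussian.distr_pair_fst)

lemma distr_shift_space_gaussian: "distr shift_space std_gaussian (\<lambda>z. snd (snd z)) = std_gaussian"
proof (rule measure_eqI)
  fix A assume "A \<in> sets (distr shift_space std_gaussian (\<lambda>z. snd (snd z)))"
  then have [measurable]: "A \<in> sets borel" by simp
  have snd: "(\<lambda>z. snd (snd z)) \<in> shift_space \<rightarrow>\<^sub>M std_gaussian"
    unfolding shift_space_def by measurable
  have "emeasure (distr shift_space std_gaussian (\<lambda>z. snd (snd z))) A
      = (\<integral>\<^sup>+z. indicator A z \<partial>distr shift_space std_gaussian (\<lambda>z. snd (snd z)))"
    by simp
  also have "\<dots> = (\<integral>\<^sup>+z. indicator A (snd (snd z)) \<partial>shift_space)"
    using snd by (rule nn_integral_distr) (rule borel_measurable_indicator, simp)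
  also have "\<dots> = emeasure std_gaussian A"
    using snd by (simp add: measurable_compose[OF snd] nn_integral_shift_space coin.emeasure_space_1[simplified] lborel01.emeasure_space_1[simplified])
  finally show "emeasure (distr shift_space std_gaussian (\<lambda>z. snd (snd z))) A = emeasure std_gaussian A" .
qed simp

text \<open>The one-dimensional Cameron-Martin formula: the translation is moved into the density,
  where completing the square leaves the exponential factor.\<close>

lemma nn_integral_gaussian_shift:
  assumes [measurable]: "f \<in> borel_measurable borel"
  shows "(\<integral>\<^sup>+u. f (u + s) \<partial>std_gaussian) = (\<integral>\<^sup>+u. f u * ennreal (exp (u * s - s\<^sup>2 / 2)) \<partial>std_gaussian)"
proof -
  have "(\<integral>\<^sup>+u. f (u + s) \<partial>std_gaussian) = (\<integral>\<^sup>+u. ennreal (std_normal_density u) * f (u + s) \<partial>lborel)"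
    unfolding std_gaussian_def by (subst nn_integral_density) auto
  also have "\<dots> = (\<integral>\<^sup>+u. ennreal (std_normal_density (u - s)) * f u \<partial>lborel)"
    using nn_integral_real_affine[of "\<lambda>u. ennreal (std_normal_density (u - s)) * f u" 1 s]
    by (simp add: add.commute)
  also have "\<dots> = (\<integral>\<^sup>+u. ennreal (std_normal_density u) * (f u * ennreal (exp (u * s - s\<^sup>2 / 2))) \<partial>lborel)"
  proof (rule nn_integral_cong)
    fix u
    have "std_normal_density (u - s) = std_normal_density u * exp (u * s - s\<^sup>2 / 2)"
      by (simp add: std_normal_density_def exp_add[symmetric] power2_eq_square field_simps)
    then show "ennreal (std_normal_density (u - s)) * f u = ennreal (std_normal_density u) * (f u * ennreal (exp (u * s - s\<^sup>2 / 2)))"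
      by (simp add: ennreal_mult mult_ac)
  qed
  also have "\<dots> = (\<integral>\<^sup>+u. f u * ennreal (exp (u * s - s\<^sup>2 / 2)) \<partial>std_gaussian)"
    unfolding std_gaussian_def by (subst nn_integral_density) auto
  finally show ?thesis .
qed

text \<open>Given shift and sign, the translation \<open>s (v, b)\<close> is a constant, so the
  one-dimensional formula applies under the outer integrals.\<close>

lemma nn_integral_shift_space_gaussian_shift:
  assumes f [measurable]: "f \<in> borel_measurable shift_space"
    and s [measurable]: "s \<in> borel_measurable (lborel01 \<Otimes>\<^sub>M coin)"
  shows "(\<integral>\<^sup>+(v, b, u). f (v, b, u + s (v, b)) \<partial>shift_space) =
    (\<integral>\<^sup>+(v, b, u). f (v, b, u) * ennreal (exp (u * s (v, b) - (s (v, b))\<^sup>2 / 2)) \<partial>shift_space)"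
proof -
  have f' [measurable]: "f \<in> borel_measurable (lborel01 \<Otimes>\<^sub>M (coin \<Otimes>\<^sub>M borel))"
  proof -
    have "sets shift_space = sets (lborel01 \<Otimes>\<^sub>M (coin \<Otimes>\<^sub>M borel))"
      unfolding shift_space_def by (intro sets_pair_measure_cong) auto
    from measurable_cong_sets[OF this refl] f show ?thesis by blast
  qed
  have m [measurable]: "(\<lambda>(v, b, u). f (v, b, u + s (v, b))) \<in> borel_measurable shift_space"
    "(\<lambda>(v, b, u). f (v, b, u) * ennreal (exp (u * s (v, b) - (s (v, b))\<^sup>2 / 2))) \<in> borel_measurable shift_space"
    unfolding shift_space_def by measurable
  have "(\<integral>\<^sup>+u. f (v, b, u + s (v, b)) \<partial>std_gaussian) =
    (\<integral>\<^sup>+u. f (v, b, u) * ennreal (exp (u * s (v, b) - (s (v, b))\<^sup>2 / 2)) \<partial>std_gaussian)"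
    if "v \<in> {0..1}" for v b
  proof (rule nn_integral_gaussian_shift)
    have "v \<in> space lborel01" using that by simp
    then show "(\<lambda>u. f (v, b, u)) \<in> borel_measurable borel"
      by measurable
  qed
  then show ?thesis
    unfolding nn_integral_shift_space[OF m(1)] nn_integral_shift_space[OF m(2)]
    by (auto simp: nn_integral_coin intro!: nn_integral_cong)
qed

text \<open>The models live on probability spaces over \<open>real\<close>, so \<open>shift_space\<close> is carried over
  along an injection that exists for cardinality reasons.\<close>

lemma shift_space_on_reals:
  obtains M :: "real measure" and \<pi> where "prob_space M" "\<pi> \<in> M \<rightarrow>\<^sub>M shift_space"
    "distr M shift_space \<pi> = shift_space"
proof -
  \<comment> \<open>The bijection may be non-measurable: \<open>embed_measure\<close> transports the
    sigma-algebra along the injection built from it.\<close>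
  obtain j :: "real \<times> real \<Rightarrow> real" where "bij_betw j (UNIV \<times> UNIV) UNIV"
    using card_of_Times_same_infinite[OF infinite_UNIV_char_0[where 'a = real]]
    unfolding card_of_ordIso[symmetric] by blast
  then have j: "inj j" by (simp add: bij_betw_def)
  define h where "h = (\<lambda>(v, b, u). j (v, j (of_bool b, u)))"
  have h: "inj h"
    unfolding h_def by (rule injI) (auto dest!: injD[OF j])
  have 1: "h \<in> shift_space \<rightarrow>\<^sub>M embed_measure shift_space h"
    by (rule measurable_embed_measure2) (rule h)
  have 2: "inv h \<in> embed_measure shift_space h \<rightarrow>\<^sub>M shift_space"
    by (rule measurable_embed_measure1) (simp add: h)
  have M: "embed_measure shift_space h = distr shift_space (embed_measure shift_space h) h"
    by (rule embed_measure_eq_distr) (rule h)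
  show ?thesis
  proof (rule that)
    show "prob_space (embed_measure shift_space h)"
      by (subst M) (intro prob_space.prob_space_distr prob_space_shift_space 1)
    show "inv h \<in> embed_measure shift_space h \<rightarrow>\<^sub>M shift_space" by (rule 2)
    show "distr (embed_measure shift_space h) shift_space (inv h) = shift_space"
      by (subst M, subst distr_distr[OF 2 1]) (simp add: comp_def h distr_id2)
  qed
qed

section \<open>Two-point bounds and Assouad's lemma\<close>

text \<open>It suffices to compare measures on rectangles, where both the density and the indicator
  factor over the coordinates.\<close>

lemma PiM_density:
  assumes I: "finite I" and P: "prob_space P" and Q: "prob_space (density P L)"
    and L [measurable]: "L \<in> borel_measurable P"
  shows "(\<Pi>\<^sub>M i\<in>I. density P L) = density (\<Pi>\<^sub>M i\<in>I. P) (\<lambda>z. \<Prod>i\<in>I. L (z i))"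
proof -
  interpret P: prob_space P by fact
  interpret Q: prob_space "density P L" by fact
  interpret PP: product_sigma_finite "\<lambda>i. P" ..
  interpret QQ: product_sigma_finite "\<lambda>i. density P L" ..
  have "density (\<Pi>\<^sub>M i\<in>I. P) (\<lambda>z. \<Prod>i\<in>I. L (z i)) = (\<Pi>\<^sub>M i\<in>I. density P L)"
  proof (rule QQ.PiM_eqI[OF I])
    show "sets (density (Pi\<^sub>M I (\<lambda>i. P)) (\<lambda>z. \<Prod>i\<in>I. L (z i))) = sets (Pi\<^sub>M I (\<lambda>i. density P L))"
      by (simp cong: sets_PiM_cong)
  next
    fix A assume A: "\<And>i. i \<in> I \<Longrightarrow> A i \<in> sets (density P L)"
    then have [measurable]: "Pi\<^sub>E I A \<in> sets (Pi\<^sub>M I (\<lambda>i. P))"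
      using I by (intro sets_PiM_I_finite) auto
    have "emeasure (density (\<Pi>\<^sub>M i\<in>I. P) (\<lambda>z. \<Prod>i\<in>I. L (z i))) (Pi\<^sub>E I A)
        = (\<integral>\<^sup>+z. (\<Prod>i\<in>I. L (z i)) * indicator (Pi\<^sub>E I A) z \<partial>(\<Pi>\<^sub>M i\<in>I. P))"
      by (rule emeasure_density) measurable
    also have "\<dots> = (\<integral>\<^sup>+z. (\<Prod>i\<in>I. L (z i) * indicator (A i) (z i)) \<partial>(\<Pi>\<^sub>M i\<in>I. P))"
    proof (rule nn_integral_cong)
      fix z assume "z \<in> space (\<Pi>\<^sub>M i\<in>I. P)"
      then have z: "z \<in> extensional I" by (auto simp: space_PiM PiE_def)
      show "(\<Prod>i\<in>I. L (z i)) * indicator (Pi\<^sub>E I A) z = (\<Prod>i\<in>I. L (z i) * indicator (A i) (z i))"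
      proof (cases "\<forall>i\<in>I. z i \<in> A i")
        case True
        then show ?thesis using z by (simp add: PiE_def Pi_iff)
      next
        case False
        then obtain j where j: "j \<in> I" "z j \<notin> A j" by blast
        then have "(\<Prod>i\<in>I. L (z i) * indicator (A i) (z i)) = 0"
          using I by (intro prod_zero bexI[of _ j]) auto
        then show ?thesis using j by (auto simp: indicator_def)
      qed
    qed
    also have "\<dots> = (\<Prod>i\<in>I. \<integral>\<^sup>+x. L x * indicator (A i) x \<partial>P)"
      using A by (intro PP.product_nn_integral_prod I) (auto intro!: borel_measurable_times_ennreal)
    also have "\<dots> = (\<Prod>i\<in>I. emeasure (density P L) (A i))"
      using A by (intro prod.cong refl emeasure_density[symmetric]) auto
    finally show "emeasure (density (\<Pi>\<^sub>M i\<in>I. P) (\<lambda>z. \<Prod>i\<in>I. L (z i))) (Pi\<^sub>E I A)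
      = (\<Prod>i\<in>I. emeasure (density P L) (A i))" .
  qed
  then show ?thesis ..
qed

text \<open>The pointwise bound \<open>min 1 x \<ge> x - x\<^sup>2 / 4\<close> reduces the affinity of two laws to the
  second moment of the likelihood ratio, which is multiplicative over the sample.\<close>

lemma le_cam_two_point:
  fixes L :: "'a \<Rightarrow> real"
  assumes I: "finite I" and P: "prob_space P" and Q: "prob_space (density P (\<lambda>x. ennreal (L x)))"
    and L [measurable]: "L \<in> borel_measurable P" and L_nonneg: "\<And>x. L x \<ge> 0"
    and q: "(\<integral>\<^sup>+x. ennreal ((L x)\<^sup>2) \<partial>P) \<le> ennreal q" "q \<ge> 0" "q ^ card I \<le> 2"
    and A [measurable]: "A \<in> borel_measurable (\<Pi>\<^sub>M i\<in>I. P)"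
    and B [measurable]: "B \<in> borel_measurable (\<Pi>\<^sub>M i\<in>I. P)"
    and c: "\<And>z. z \<in> space (\<Pi>\<^sub>M i\<in>I. P) \<Longrightarrow> c \<le> A z + B z"
  shows "c / 2 \<le> (\<integral>\<^sup>+z. A z \<partial>(\<Pi>\<^sub>M i\<in>I. P)) + (\<integral>\<^sup>+z. B z \<partial>(\<Pi>\<^sub>M i\<in>I. density P (\<lambda>x. ennreal (L x))))"
proof -
  interpret P: prob_space P by fact
  interpret PP: product_prob_space "\<lambda>i. P" I ..
  interpret PP: finite_product_prob_space "\<lambda>i. P" I by standard fact
  let ?P = "\<Pi>\<^sub>M i\<in>I. P"
  define Ln where "Ln z = (\<Prod>i\<in>I. L (z i))" for z :: "'b \<Rightarrow> 'a"
  have [measurable]: "Ln \<in> borel_measurable ?P"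
    unfolding Ln_def[abs_def] by measurable
  have Ln_nonneg: "Ln z \<ge> 0" for z
    unfolding Ln_def by (intro prod_nonneg) (simp add: L_nonneg)
  have dens: "(\<Pi>\<^sub>M i\<in>I. density P (\<lambda>x. ennreal (L x))) = density ?P (\<lambda>z. ennreal (Ln z))"
    unfolding Ln_def by (subst PiM_density[OF I P Q]) (simp_all add: prod_ennreal L_nonneg)
  have "emeasure (\<Pi>\<^sub>M i\<in>I. density P (\<lambda>x. ennreal (L x))) (space (\<Pi>\<^sub>M i\<in>I. density P (\<lambda>x. ennreal (L x)))) = 1"
    by (intro prob_space.emeasure_space_1 prob_space_PiM Q)
  then have one: "(\<integral>\<^sup>+z. ennreal (Ln z) \<partial>?P) = 1"
    unfolding dens by (simp add: emeasure_density cong: nn_integral_cong)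
  have "(\<integral>\<^sup>+z. ennreal ((Ln z)\<^sup>2) \<partial>?P) = (\<integral>\<^sup>+z. (\<Prod>i\<in>I. ennreal ((L (z i))\<^sup>2)) \<partial>?P)"
    by (simp add: Ln_def prod_power_distrib prod_ennreal)
  also have "\<dots> = (\<Prod>i\<in>I. \<integral>\<^sup>+x. ennreal ((L x)\<^sup>2) \<partial>P)"
    by (rule PP.product_nn_integral_prod[OF I]) simp
  also have "\<dots> \<le> (\<Prod>i\<in>I. ennreal q)"
    by (intro prod_mono_ennreal) (simp add: q)
  also have "\<dots> \<le> ennreal 2"
    using q by (simp add: ennreal_power ennreal_leI del: ennreal_numeral)
  finally have sq: "(\<integral>\<^sup>+z. ennreal ((Ln z)\<^sup>2) \<partial>?P) \<le> 2" by simp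
  \<comment> \<open>For \<open>Ln z\<close> above 1 the pointwise bound is (1 - L / 2)^2 \<ge> 0.
    With second moment at most 2, the affinity is at least 1 - 2 / 4 = 1 / 2, which is the factor in
    the conclusion.\<close>
  have "1 \<le> (\<integral>\<^sup>+z. ennreal (min 1 (Ln z)) + ennreal (1 / 4) * ennreal ((Ln z)\<^sup>2) \<partial>?P)"
    unfolding one[symmetric]
  proof (rule nn_integral_mono)
    fix z
    have "Ln z \<le> min 1 (Ln z) + 1 / 4 * (Ln z)\<^sup>2"
      using zero_le_power2[of "1 - Ln z / 2"] by (simp add: min_def power2_eq_square field_simps)
    then have "ennreal (Ln z) \<le> ennreal (min 1 (Ln z) + 1 / 4 * (Ln z)\<^sup>2)"
      by (rule ennreal_leI)
    also have "\<dots> = ennreal (min 1 (Ln z)) + ennreal (1 / 4) * ennreal ((Ln z)\<^sup>2)"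
      by (subst ennreal_plus) (auto simp: Ln_nonneg ennreal_mult[symmetric] simp del: ennreal_plus)
    finally show "ennreal (Ln z) \<le> ennreal (min 1 (Ln z)) + ennreal (1 / 4) * ennreal ((Ln z)\<^sup>2)" .
  qed
  also have "\<dots> = (\<integral>\<^sup>+z. ennreal (min 1 (Ln z)) \<partial>?P) + ennreal (1 / 4) * (\<integral>\<^sup>+z. ennreal ((Ln z)\<^sup>2) \<partial>?P)"
    by (simp add: nn_integral_add nn_integral_cmult)
  also have "\<dots> \<le> (\<integral>\<^sup>+z. ennreal (min 1 (Ln z)) \<partial>?P) + ennreal (1 / 4) * 2"
    by (intro add_left_mono mult_left_mono sq) simp
  also have "ennreal (1 / 4) * 2 = ennreal (1 / 2)"
    using ennreal_mult[of "1 / 4" 2, symmetric] by simp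
  finally have half: "ennreal (1 / 2) \<le> (\<integral>\<^sup>+z. ennreal (min 1 (Ln z)) \<partial>?P)"
    by (cases "\<integral>\<^sup>+z. ennreal (min 1 (Ln z)) \<partial>?P" rule: ennreal_cases)
      (auto simp: ennreal_plus[symmetric] ennreal_1[symmetric] simp del: ennreal_plus ennreal_1 ennreal_half)
  have "c / 2 = c * ennreal (1 / 2)"
    by (simp add: divide_ennreal_def)
  also have "\<dots> \<le> c * (\<integral>\<^sup>+z. ennreal (min 1 (Ln z)) \<partial>?P)"
    by (intro mult_left_mono half) simp
  also have "\<dots> = (\<integral>\<^sup>+z. c * ennreal (min 1 (Ln z)) \<partial>?P)"
    by (simp add: nn_integral_cmult)
  also have "\<dots> \<le> (\<integral>\<^sup>+z. A z + ennreal (Ln z) * B z \<partial>?P)"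
  proof (rule nn_integral_mono)
    fix z assume z: "z \<in> space ?P"
    have "c * ennreal (min 1 (Ln z)) \<le> (A z + B z) * ennreal (min 1 (Ln z))"
      by (intro mult_right_mono c z) simp
    also have "\<dots> = ennreal (min 1 (Ln z)) * A z + ennreal (min 1 (Ln z)) * B z"
      by (simp add: distrib_left mult.commute)
    also have "\<dots> \<le> 1 * A z + ennreal (Ln z) * B z"
      by (intro add_mono mult_right_mono) (auto simp: ennreal_1[symmetric] intro!: ennreal_leI simp del: ennreal_1)
    finally show "c * ennreal (min 1 (Ln z)) \<le> A z + ennreal (Ln z) * B z" by simp
  qed
  also have "\<dots> = (\<integral>\<^sup>+z. A z \<partial>?P) + (\<integral>\<^sup>+z. B z \<partial>density ?P (\<lambda>z. ennreal (Ln z)))"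
    by (simp add: nn_integral_add nn_integral_density)
  finally show ?thesis
    unfolding dens .
qed

lemma sum_Pow_split:
  fixes h :: "'a set \<Rightarrow> 'b::comm_monoid_add"
  assumes "finite J" "j \<in> J"
  shows "(\<Sum>S\<in>Pow J. h S) = (\<Sum>S\<in>Pow (J - {j}). h S + h (insert j S))"
proof -
  have "Pow J = Pow (J - {j}) \<union> insert j ` Pow (J - {j})"
    using assms Pow_insert[of j "J - {j}"] by (simp add: insert_absorb)
  moreover have "Pow (J - {j}) \<inter> insert j ` Pow (J - {j}) = {}"
    by auto
  moreover have "inj_on (insert j) (Pow (J - {j}))"
    by (rule inj_onI) (auto simp: insert_eq_iff)
  ultimately show ?thesis
    using assms by (simp add: sum.union_disjoint sum.reindex sum.distrib)
qed

text \<open>The vertex sums are averaged over the cube. Direction j splits the vertices into pairs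
  S, \<open>insert j S\<close>, half as many as there are vertices, and each pair contributes at
  least \<open>c j\<close>; this halving is the factor 2.\<close>

lemma assouad:
  fixes a :: "'i \<Rightarrow> 'i set \<Rightarrow> ennreal"
  assumes J: "finite J"
    and R: "\<And>S. S \<subseteq> J \<Longrightarrow> (\<Sum>j\<in>J. a j S) \<le> R"
    and c: "\<And>j S. S \<subseteq> J \<Longrightarrow> j \<in> J \<Longrightarrow> j \<notin> S \<Longrightarrow> c j \<le> a j S + a j (insert j S)"
  shows "(\<Sum>j\<in>J. c j) \<le> 2 * R"
proof (cases "J = {}")
  case False
  then obtain n where n: "card J = Suc n"
    using J by (metis card_eq_0_iff not0_implies_Suc)
  have "2 ^ n * (\<Sum>j\<in>J. c j) = (\<Sum>j\<in>J. \<Sum>S\<in>Pow (J - {j}). c j)"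
    using J n by (simp add: card_Pow sum_distrib_left)
  also have "\<dots> \<le> (\<Sum>j\<in>J. \<Sum>S\<in>Pow (J - {j}). a j S + a j (insert j S))"
    by (intro sum_mono c) auto
  also have "\<dots> = (\<Sum>j\<in>J. \<Sum>S\<in>Pow J. a j S)"
    by (rule sum.cong[OF refl]) (rule sum_Pow_split[OF J, symmetric])
  also have "\<dots> = (\<Sum>S\<in>Pow J. \<Sum>j\<in>J. a j S)"
    by (rule sum.swap)
  also have "\<dots> \<le> (\<Sum>S\<in>Pow J. R)"
    by (intro sum_mono R) auto
  also have "\<dots> = 2 ^ n * (2 * R)"
    using J n by (simp add: card_Pow mult_ac)
  finally show ?thesis
    by (simp add: ennreal_mult_le_mult_iff power_eq_top_ennreal)
qed simp

section \<open>The randomly shifted process\<close>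

text \<open>The path as a function of shift and sign alone, separated from the noise, so that it can
  be used both on \<open>shift_space\<close> and, through \<open>\<pi>\<close>, on the carrier of
  the model.\<close>

definition wave :: "(real \<Rightarrow> real) \<Rightarrow> real \<times> bool \<Rightarrow> real \<Rightarrow> real" where
  "wave g = (\<lambda>(v, b) t. (if b then 1 else - 1) * g (t + v))"

text \<open>\<open>M\<close> is any space that carries a copy of \<open>shift_space\<close> through
  \<open>\<pi>\<close>; expectations are computed on the canonical space. The numbers
  \<open>r k\<close> are the square roots of the eigenvalues to be realized.\<close>

locale random_shift = prob_space M for M :: "'w measure" +
  fixes \<pi> :: "'w \<Rightarrow> real \<times> bool \<times> real" and g :: "real \<Rightarrow> real" and r :: "int \<Rightarrow> real"
  assumes measurable_pi [measurable]: "\<pi> \<in> M \<rightarrow>\<^sub>M shift_space"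
    and distr_pi: "distr M shift_space \<pi> = shift_space"
    and measurable_g [measurable]: "g \<in> borel_measurable borel"
    and g_periodic: "\<And>t. g (t + 1) = g t"
    and g_L2: "g \<in> L2"
    and coef_g: "\<And>k. L2_inner (cpx g) (trig k) = of_real (r k)"
    and r_pos: "\<And>k. r k > 0"
begin

definition proc :: "'w \<Rightarrow> real \<Rightarrow> real" where
  "proc \<omega> = wave g (fst (\<pi> \<omega>), fst (snd (\<pi> \<omega>)))"

definition err :: "'w \<Rightarrow> real" where
  "err \<omega> = snd (snd (\<pi> \<omega>))"

lemma integral_pi:
  fixes F :: "_ \<Rightarrow> 'b::{banach, second_countable_topology}"
  shows "F \<in> borel_measurable shift_space \<Longrightarrow> (\<integral>\<omega>. F (\<pi> \<omega>) \<partial>M) = (\<integral>z. F z \<partial>shift_space)"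
  by (subst distr_pi[symmetric]) (simp add: integral_distr)

lemma measurable_fst_shift [measurable]: "fst \<in> shift_space \<rightarrow>\<^sub>M lborel01"
  and measurable_fst_shift_borel [measurable]: "fst \<in> borel_measurable shift_space"
  and measurable_coin_shift [measurable]: "(\<lambda>z. fst (snd z)) \<in> shift_space \<rightarrow>\<^sub>M coin"
  and measurable_gauss_shift [measurable]: "(\<lambda>z. snd (snd z)) \<in> borel_measurable shift_space"
proof -
  show 1: "fst \<in> shift_space \<rightarrow>\<^sub>M lborel01"
    unfolding shift_space_def by measurable
  show "fst \<in> borel_measurable shift_space"
    using measurable_compose[OF 1 measurable_ident_lborel01] by simp
  show "(\<lambda>z. fst (snd z)) \<in> shift_space \<rightarrow>\<^sub>M coin"
    unfolding shift_space_def by measurable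
  show "(\<lambda>z. snd (snd z)) \<in> borel_measurable shift_space"
    unfolding shift_space_def by measurable
qed

lemma distr_fst_pi: "distr M lborel01 (\<lambda>\<omega>. fst (\<pi> \<omega>)) = lborel01"
proof -
  have "distr M lborel01 (\<lambda>\<omega>. fst (\<pi> \<omega>)) = distr (distr M shift_space \<pi>) lborel01 fst"
    by (subst distr_distr) (auto simp: comp_def)
  then show ?thesis by (simp add: distr_pi distr_shift_space_shift)
qed

lemma measurable_fst_pi [measurable]: "(\<lambda>\<omega>. fst (\<pi> \<omega>)) \<in> M \<rightarrow>\<^sub>M lborel01"
  using measurable_compose[OF measurable_pi measurable_fst_shift] .

lemma
  fixes F :: "real \<Rightarrow> 'b::{banach, second_countable_topology}"
  assumes [measurable]: "F \<in> borel_measurable lborel01"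
  shows integral_fst_pi: "(\<integral>\<omega>. F (fst (\<pi> \<omega>)) \<partial>M) = (\<integral>v. F v \<partial>lborel01)"
    and integrable_fst_pi: "integrable M (\<lambda>\<omega>. F (fst (\<pi> \<omega>))) \<longleftrightarrow> integrable lborel01 F"
proof -
  show "(\<integral>\<omega>. F (fst (\<pi> \<omega>)) \<partial>M) = (\<integral>v. F v \<partial>lborel01)"
    by (subst distr_fst_pi[symmetric]) (simp add: integral_distr)
  show "integrable M (\<lambda>\<omega>. F (fst (\<pi> \<omega>))) \<longleftrightarrow> integrable lborel01 F"
    by (subst distr_fst_pi[symmetric]) (simp add: integrable_distr_eq)
qed

lemma distr_err: "distr M std_gaussian err = std_gaussian"
proof -
  have [measurable]: "(\<lambda>z. snd (snd z)) \<in> shift_space \<rightarrow>\<^sub>M std_gaussian"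
    unfolding shift_space_def by measurable
  have "distr M std_gaussian err = distr (distr M shift_space \<pi>) std_gaussian (\<lambda>z. snd (snd z))"
    by (subst distr_distr) (auto simp: comp_def err_def[abs_def])
  then show ?thesis by (simp add: distr_pi distr_shift_space_gaussian)
qed

lemma measurable_err [measurable]: "err \<in> borel_measurable M"
  using measurable_compose[OF measurable_pi measurable_gauss_shift] by (simp add: err_def[abs_def])

lemma fst_pi_bounds: "\<omega> \<in> space M \<Longrightarrow> fst (\<pi> \<omega>) \<in> {0..1}"
  using measurable_space[OF measurable_fst_pi] by simp

lemma proc_eq: "proc \<omega> t = (if fst (snd (\<pi> \<omega>)) then 1 else - 1) * g (t + fst (\<pi> \<omega>))"
  by (simp add: proc_def wave_def)

lemma g_shift_measurable: "(\<lambda>t. g (t + v)) \<in> borel_measurable lborel01"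
  by (intro measurable_lborel01_borel) measurable

lemma g_shift_L2: "v \<in> {0..1} \<Longrightarrow> (\<lambda>t. g (t + v)) \<in> L2"
  using g_L2 g_shift_measurable integrable_periodic_shift[of "\<lambda>t. (norm (g t))\<^sup>2" v]
  by (simp add: L2_def g_periodic)

lemma wave_L2: "v \<in> {0..1} \<Longrightarrow> wave g (v, b) \<in> L2"
  using g_shift_L2[of v] by (auto simp: wave_def L2_def)

lemma proc_L2: "\<omega> \<in> space M \<Longrightarrow> proc \<omega> \<in> L2"
  unfolding proc_def by (rule wave_L2[OF fst_pi_bounds])

lemma L2_norm_proc: "\<omega> \<in> space M \<Longrightarrow> (L2_norm (proc \<omega>))\<^sup>2 = (L2_norm g)\<^sup>2"
  using integral_periodic_shift[of "\<lambda>t. (norm (g t))\<^sup>2" "fst (\<pi> \<omega>)"] fst_pi_bounds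
  unfolding L2_norm_square by (simp add: proc_eq g_periodic norm_mult if_distrib cong: if_cong)

lemma measurable_wave_pair: "(\<lambda>(c, t). wave g c t) \<in> borel_measurable ((lborel01 \<Otimes>\<^sub>M coin) \<Otimes>\<^sub>M lborel01)"
proof -
  have [measurable]: "(\<lambda>x. x) \<in> borel_measurable lborel01" by (rule measurable_ident_lborel01)
  have [measurable]: "snd \<in> borel_measurable ((lborel01 \<Otimes>\<^sub>M coin) \<Otimes>\<^sub>M lborel01)"
    using measurable_compose[OF measurable_snd measurable_ident_lborel01] by simp
  have [measurable]: "(\<lambda>c. fst (fst c)) \<in> borel_measurable ((lborel01 \<Otimes>\<^sub>M coin) \<Otimes>\<^sub>M lborel01)"
    using measurable_compose[OF measurable_compose[OF measurable_fst measurable_fst] measurable_ident_lborel01] by simp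
  have [measurable]: "(\<lambda>c. snd (fst c)) \<in> (lborel01 \<Otimes>\<^sub>M coin) \<Otimes>\<^sub>M lborel01 \<rightarrow>\<^sub>M count_space UNIV"
    using measurable_compose[OF measurable_fst measurable_snd] by (simp cong: measurable_cong_sets)
  have "(\<lambda>c. (if snd (fst c) then 1 else - 1) * g (snd c + fst (fst c))) \<in> borel_measurable ((lborel01 \<Otimes>\<^sub>M coin) \<Otimes>\<^sub>M lborel01)"
    by measurable
  then show ?thesis by (simp add: wave_def case_prod_beta')
qed

lemma measurable_wave_index: "(\<lambda>z. (fst z, fst (snd z))) \<in> shift_space \<rightarrow>\<^sub>M lborel01 \<Otimes>\<^sub>M coin"
  by measurable

lemma measurable_proc_pair: "(\<lambda>(\<omega>, t). proc \<omega> t) \<in> borel_measurable (M \<Otimes>\<^sub>M lborel01)"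
proof -
  have "(\<lambda>x. ((fst (\<pi> (fst x)), fst (snd (\<pi> (fst x)))), snd x)) \<in> M \<Otimes>\<^sub>M lborel01 \<rightarrow>\<^sub>M (lborel01 \<Otimes>\<^sub>M coin) \<Otimes>\<^sub>M lborel01"
    by measurable
  from measurable_compose[OF this measurable_wave_pair] show ?thesis
    by (simp add: proc_def case_prod_beta')
qed

lemma measurable_wave_at: "t \<in> {0..1} \<Longrightarrow> (\<lambda>c. wave g c t) \<in> borel_measurable (lborel01 \<Otimes>\<^sub>M coin)"
  using measurable_compose[OF _ measurable_wave_pair, of "\<lambda>c. (c, t)"] by simp

lemma measurable_proc [measurable]: "proc \<in> M \<rightarrow>\<^sub>M L2_borel"
  by (rule measurable_L2_borelI[OF measurable_proc_pair proc_L2])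

lemma measurable_wave [measurable]: "wave g \<in> lborel01 \<Otimes>\<^sub>M coin \<rightarrow>\<^sub>M L2_borel"
  by (rule measurable_L2_borelI[OF measurable_wave_pair]) (auto simp: space_pair_measure intro: wave_L2)

lemma integral_odd:
  fixes F :: "real \<Rightarrow> bool \<Rightarrow> real \<Rightarrow> 'b::{banach, second_countable_topology}"
  assumes "(\<lambda>z. F (fst z) (fst (snd z)) (snd (snd z))) \<in> borel_measurable shift_space"
    and "\<And>v b u. F v (\<not> b) u = - F v b u"
  shows "(\<integral>\<omega>. F (fst (\<pi> \<omega>)) (fst (snd (\<pi> \<omega>))) (snd (snd (\<pi> \<omega>))) \<partial>M) = 0"
  using integral_pi[OF assms(1)] integral_shift_space_odd[OF assms(1)] assms(2) by simp

lemma measurable_wave_shift: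
  assumes "t \<in> {0..1}"
  shows "(\<lambda>z. wave g (fst z, fst (snd z)) t) \<in> borel_measurable shift_space"
  using measurable_compose[OF measurable_wave_index measurable_wave_at[OF assms]] .

lemma mean_proc:
  assumes "t \<in> {0..1}"
  shows "(\<integral>\<omega>. proc \<omega> t \<partial>M) = 0"
  using integral_odd[of "\<lambda>v b u. wave g (v, b) t"] measurable_wave_shift[OF assms]
  by (simp add: proc_def wave_def case_prod_beta')

lemma mean_err_proc:
  assumes "t \<in> {0..1}"
  shows "(\<integral>\<omega>. err \<omega> * proc \<omega> t \<partial>M) = 0"
  using integral_odd[of "\<lambda>v b u. u * wave g (v, b) t"] measurable_wave_shift[OF assms]
  by (simp add: proc_def err_def wave_def case_prod_beta')

lemma centered_random_function_proc: "centered_random_function M proc"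
  unfolding centered_random_function_def
proof (intro conjI ballI)
  show "(\<lambda>(\<omega>, t). proc \<omega> t) \<in> borel_measurable (M \<Otimes>\<^sub>M lborel01)" by (rule measurable_proc_pair)
  show "proc \<omega> \<in> L2" if "\<omega> \<in> space M" for \<omega> using that by (rule proc_L2)
  show "(\<integral>\<^sup>+\<omega>. ennreal ((L2_norm (proc \<omega>))\<^sup>2) \<partial>M) < \<infinity>"
    by (simp add: L2_norm_proc emeasure_space_1 cong: nn_integral_cong)
  fix t :: real assume t: "t \<in> {0..1}"
  show "(\<integral>\<omega>. proc \<omega> t \<partial>M) = 0" using t by (rule mean_proc)
  \<comment> \<open>At a fixed t the second moment is an integral over the shift, so square
    integrability of \<open>g\<close> suffices at every t.\<close>
  have "integrable lborel01 (\<lambda>v. (g (v + t))\<^sup>2)"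
    using g_shift_L2[OF t] by (simp add: L2_def)
  then have "integrable M (\<lambda>\<omega>. (g (fst (\<pi> \<omega>) + t))\<^sup>2)"
    using g_shift_measurable[of t] by (subst integrable_fst_pi) auto
  moreover have "(proc \<omega> t)\<^sup>2 = (g (fst (\<pi> \<omega>) + t))\<^sup>2" for \<omega>
    by (simp add: proc_eq add.commute)
  ultimately show "integrable M (\<lambda>\<omega>. (proc \<omega> t)\<^sup>2)"
    by simp
qed

section \<open>Covariance, spectrum and class membership of the shifted process\<close>

lemma Cov_proc:
  assumes "t \<in> {0..1}" "s \<in> {0..1}"
  shows "Cov M (\<lambda>\<omega>. proc \<omega> t) (\<lambda>\<omega>. proc \<omega> s) = (\<integral>v. g (v + t) * g (v + s) \<partial>lborel01)"
proof -
  have [measurable]: "(\<lambda>v. g (v + t) * g (v + s)) \<in> borel_measurable lborel01"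
    by (intro measurable_lborel01_borel) measurable
  have "Cov M (\<lambda>\<omega>. proc \<omega> t) (\<lambda>\<omega>. proc \<omega> s) = (\<integral>\<omega>. proc \<omega> t * proc \<omega> s \<partial>M)"
    using assms by (simp add: Cov_def mean_proc)
  also have "\<dots> = (\<integral>\<omega>. g (fst (\<pi> \<omega>) + t) * g (fst (\<pi> \<omega>) + s) \<partial>M)"
    by (intro Bochner_Integration.integral_cong) (auto simp: proc_eq add.commute)
  also have "\<dots> = (\<integral>v. g (v + t) * g (v + s) \<partial>lborel01)"
    by (rule integral_fst_pi) measurable
  finally show ?thesis .
qed

lemma cov_by_difference_proc: "cov_by_difference M proc proc"
  unfolding cov_by_difference_def
proof (intro exI ballI)
  fix t s :: real assume ts: "t \<in> {0..1}" "s \<in> {0..1}"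
  \<comment> \<open>Rotating the integration variable by t leaves the autocorrelation of
    \<open>g\<close> at lag s - t, the witness for \<open>c\<close>.\<close>
  have "(\<integral>v. g (v + t) * g (v + t + (s - t)) \<partial>lborel01) = (\<integral>v. g v * g (v + (s - t)) \<partial>lborel01)"
    using ts g_periodic[of "_ + (s - t)"]
    by (intro integral_periodic_shift) (auto simp: g_periodic add_ac)
  then show "Cov M (\<lambda>\<omega>. proc \<omega> t) (\<lambda>\<omega>. proc \<omega> s) = (\<lambda>h. \<integral>v. g v * g (v + h) \<partial>lborel01) (s - t)"
    using ts by (simp add: Cov_proc)
qed

text \<open>Inserting \<open>trig k v * cnj (trig k v) = 1\<close> turns
  \<open>cnj (trig k t)\<close> into \<open>cnj (trig k (t + v))\<close>; rotation invariance then
  removes the shift and only the phase \<open>trig k v\<close> remains.\<close>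

lemma integral_g_shift_trig:
  assumes v: "v \<in> {0..1}"
  shows "(\<integral>t. of_real (g (t + v)) * cnj (trig k t) \<partial>lborel01) = trig k v * of_real (r k)"
proof -
  have [measurable]: "(\<lambda>t. of_real (g t) * cnj (trig k t)) \<in> borel_measurable borel"
    unfolding cnj_trig by measurable
  have eq: "of_real (g (t + v)) * cnj (trig k t) = trig k v * (of_real (g (t + v)) * cnj (trig k (t + v)))" for t
    using trig_mult_cnj[of k v] by (simp add: trig_add mult_ac)
  have "(\<integral>t. of_real (g (t + v)) * cnj (trig k t) \<partial>lborel01) = trig k v * (\<integral>t. of_real (g (t + v)) * cnj (trig k (t + v)) \<partial>lborel01)"
    unfolding eq by simp
  also have "(\<integral>t. of_real (g (t + v)) * cnj (trig k (t + v)) \<partial>lborel01) = (\<integral>t. of_real (g t) * cnj (trig k t) \<partial>lborel01)"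
    using v by (intro integral_periodic_shift) (auto simp: g_periodic trig_periodic)
  also have "\<dots> = of_real (r k)"
    using coef_g by (simp add: L2_inner_def)
  finally show ?thesis .
qed

lemma coef_wave:
  assumes v: "v \<in> {0..1}"
  shows "L2_inner (cpx (wave g (v, b))) (trig k) = (if b then 1 else - 1) * trig k v * of_real (r k)"
  using integral_g_shift_trig[OF v, of k] by (simp add: L2_inner_def wave_def)

lemma coef_proc:
  assumes "\<omega> \<in> space M"
  shows "coef proc k \<omega> = (if fst (snd (\<pi> \<omega>)) then 1 else - 1) * trig k (fst (\<pi> \<omega>)) * of_real (r k)"
  using coef_wave[OF fst_pi_bounds[OF assms]] by (simp add: coef_def proc_def)

lemma cmod_coef_proc: "\<omega> \<in> space M \<Longrightarrow> cmod (coef proc k \<omega>) = r k"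
  using r_pos[of k] by (simp add: coef_proc norm_mult)

lemma var_val_proc: "var_val M proc k = (r k)\<^sup>2"
proof -
  have [measurable]: "trig k \<in> borel_measurable lborel01"
    by (intro measurable_lborel01_borel) measurable
  define e :: "bool \<Rightarrow> complex" where "e b = (if b then 1 else - 1)" for b
  have "e \<in> borel_measurable coin"
    by (simp cong: measurable_cong_sets)
  note [measurable] = measurable_compose[OF measurable_coin_shift this]
  have "(\<integral>\<omega>. coef proc k \<omega> \<partial>M) = (\<integral>\<omega>. e (fst (snd (\<pi> \<omega>))) * trig k (fst (\<pi> \<omega>)) * of_real (r k) \<partial>M)"
    by (intro Bochner_Integration.integral_cong) (auto simp: coef_proc e_def)
  also have "\<dots> = 0"
    by (rule integral_odd[of "\<lambda>v b u. e b * trig k v * of_real (r k)"]) (measurable, auto simp: e_def)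
  finally have "var_val M proc k = (\<integral>\<omega>. (cmod (coef proc k \<omega>))\<^sup>2 \<partial>M)"
    by (simp add: var_val_def Var_def)
  also have "\<dots> = (\<integral>\<omega>. (r k)\<^sup>2 \<partial>M)"
    by (intro Bochner_Integration.integral_cong) (auto simp: cmod_coef_proc)
  finally show ?thesis by (simp add: prob_space)
qed

lemma cross_val_proc: "cross_val M proc proc k = of_real ((r k)\<^sup>2)"
proof -
  have "cross_val M proc proc k = (\<integral>\<omega>. of_real ((r k)\<^sup>2) \<partial>M)"
    unfolding cross_val_def
  proof (intro Bochner_Integration.integral_cong refl)
    fix \<omega> assume \<omega>: "\<omega> \<in> space M"
    have "L2_inner (trig k) (cpx (proc \<omega>)) * L2_inner (cpx (proc \<omega>)) (trig k) = coef proc k \<omega> * cnj (coef proc k \<omega>)"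
      by (simp add: coef_def L2_inner_commute mult.commute)
    then show "L2_inner (trig k) (cpx (proc \<omega>)) * L2_inner (cpx (proc \<omega>)) (trig k) = of_real ((r k)\<^sup>2)"
      by (simp only: complex_norm_square[symmetric] cmod_coef_proc[OF \<omega>])
  qed
  then show ?thesis by (simp add: prob_space)
qed

lemma lam_val_proc: "lam_val M proc proc k = (r k)\<^sup>2"
  using r_pos[of k]
  by (simp add: lam_val_def cross_val_proc var_val_proc norm_power)
    (simp add: power2_eq_square power4_eq_xxxx)

text \<open>The covariance is an integral over the shift v. After Fubini the inner integral over t
  is the coefficient at -k of \<open>g\<close> shifted by v, and the remaining integral over v is
  the coefficient at k of \<open>g\<close> shifted by s. The eigenvalue is therefore
  \<open>r (- k) * r k\<close>.\<close>

lemma cross_cov_op_proc: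
  assumes s: "s \<in> {0..1}"
  shows "cross_cov_op M proc proc (trig k) s = of_real ((r k)\<^sup>2) * trig k s"
proof -
  interpret LL: pair_prob_space lborel01 lborel01 ..
  let ?f = "\<lambda>t v. trig k t * of_real (g (v + t) * g (v + s))"
  have gs [measurable]: "(\<lambda>v. g (v + s)) \<in> borel_measurable lborel01"
    by (rule g_shift_measurable)
  have [measurable]: "trig k \<in> borel_measurable lborel01"
    by (intro measurable_lborel01_borel) measurable
  have [measurable]: "fst \<in> borel_measurable (lborel01 \<Otimes>\<^sub>M lborel01)"
    by (rule measurable_compose[OF measurable_fst measurable_ident_lborel01])
  have [measurable]: "snd \<in> borel_measurable (lborel01 \<Otimes>\<^sub>M lborel01)"
    by (rule measurable_compose[OF measurable_snd measurable_ident_lborel01])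
  have f [measurable]: "(\<lambda>(t, v). ?f t v) \<in> borel_measurable (lborel01 \<Otimes>\<^sub>M lborel01)"
    by measurable
  have prod_int: "integrable lborel01 (\<lambda>v. g (v + t) * g (v + s))" if "t \<in> {0..1}" for t
    using L2_integrable_inner[OF g_shift_L2[OF that] g_shift_L2[OF s]] by simp
  have int: "integrable (lborel01 \<Otimes>\<^sub>M lborel01) (\<lambda>(t, v). ?f t v)"
  proof (rule LL.Fubini_integrable)
    show "(\<lambda>(t, v). ?f t v) \<in> borel_measurable (lborel01 \<Otimes>\<^sub>M lborel01)" by (rule f)
    show "AE t in lborel01. integrable lborel01 (\<lambda>v. case (t, v) of (t, v) \<Rightarrow> ?f t v)"
      by (rule AE_I2) (simp add: prod_int[simplified] integrable_of_real del: of_real_mult)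
    \<comment> \<open>Both factors are rotations of \<open>g\<close>, so xy \<le> x^2 + y^2 bounds
      the inner integral uniformly in t, as Fubini on a probability space requires.\<close>
    have bound: "\<bar>\<integral>v. norm (?f t v) \<partial>lborel01\<bar> \<le> 2 * (L2_norm g)\<^sup>2" if t: "t \<in> {0..1}" for t
    proof -
      have sq: "integrable lborel01 (\<lambda>v. (g (v + x))\<^sup>2)" "(\<integral>v. (g (v + x))\<^sup>2 \<partial>lborel01) = (L2_norm g)\<^sup>2"
        if "x \<in> {0..1}" for x
        using that g_shift_L2[OF that] integral_periodic_shift[of "\<lambda>t. (g t)\<^sup>2" x]
        by (auto simp: L2_def g_periodic L2_norm_square)
      have "(\<integral>v. norm (?f t v) \<partial>lborel01) \<le> (\<integral>v. (g (v + t))\<^sup>2 + (g (v + s))\<^sup>2 \<partial>lborel01)"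
      proof (rule integral_mono)
        show "integrable lborel01 (\<lambda>v. norm (?f t v))"
          using prod_int[OF t] by (intro integrable_norm integrable_mult_right integrable_of_real)
        show "integrable lborel01 (\<lambda>v. (g (v + t))\<^sup>2 + (g (v + s))\<^sup>2)"
          using sq t s by simp
        fix v
        have "\<bar>x\<bar> * \<bar>y\<bar> \<le> x\<^sup>2 + y\<^sup>2" for x y :: real
          using sum_squares_bound[of "\<bar>x\<bar>" "\<bar>y\<bar>"] mult_nonneg_nonneg[OF abs_ge_zero abs_ge_zero, of x y]
          unfolding power2_abs by linarith
        from this[of "g (v + t)" "g (v + s)"]
        show "norm (?f t v) \<le> (g (v + t))\<^sup>2 + (g (v + s))\<^sup>2"
          by (simp add: norm_mult)
      qed
      also have "\<dots> = 2 * (L2_norm g)\<^sup>2"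
        using sq t s by simp
      finally show ?thesis by (simp add: abs_of_nonneg)
    qed
    show "integrable lborel01 (\<lambda>t. \<integral>v. norm (case (t, v) of (t, v) \<Rightarrow> ?f t v) \<partial>lborel01)"
      by (rule lborel01.integrable_const_bound[where B = "2 * (L2_norm g)\<^sup>2"])
        (use bound in \<open>auto intro!: AE_I2\<close>)
  qed
  have "cross_cov_op M proc proc (trig k) s = (\<integral>t. (\<integral>v. ?f t v \<partial>lborel01) \<partial>lborel01)"
    unfolding cross_cov_op_def
  proof (intro Bochner_Integration.integral_cong refl)
    fix t assume "t \<in> space lborel01"
    then have "t \<in> {0..1}" by simp
    then show "trig k t * of_real (Cov M (\<lambda>\<omega>. proc \<omega> t) (\<lambda>\<omega>. proc \<omega> s)) = (\<integral>v. ?f t v \<partial>lborel01)"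
      unfolding Cov_proc[OF \<open>t \<in> {0..1}\<close> s] by (simp del: of_real_mult)
  qed
  also have "\<dots> = (\<integral>v. (\<integral>t. ?f t v \<partial>lborel01) \<partial>lborel01)"
    using LL.Fubini_integral[OF int] by simp
  also have "\<dots> = (\<integral>v. of_real (g (v + s)) * cnj (trig k v) * of_real (r k) \<partial>lborel01)"
  proof (intro Bochner_Integration.integral_cong refl)
    fix v assume "v \<in> space lborel01"
    then have v: "v \<in> {0..1}" by simp
    have "(\<integral>t. ?f t v \<partial>lborel01) = (\<integral>t. of_real (g (v + s)) * (of_real (g (t + v)) * cnj (trig (- k) t)) \<partial>lborel01)"
      by (intro Bochner_Integration.integral_cong) (auto simp: cnj_trig add.commute)
    also have "\<dots> = of_real (g (v + s)) * (trig (- k) v * of_real (r (- k)))"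
      by (simp add: integral_g_shift_trig[OF v])
    \<comment> \<open>The coefficients at k and -k of the real function \<open>g\<close> are
      conjugate, and \<open>r\<close> is real.\<close>
    also have "r (- k) = r k"
    proof -
      have "complex_of_real (r (- k)) = cnj (of_real (r k))"
        unfolding coef_g[symmetric] L2_inner_def Bochner_Integration.integral_cnj[symmetric]
        by (simp add: cnj_trig)
      then show ?thesis by simp
    qed
    finally show "(\<integral>t. ?f t v \<partial>lborel01) = of_real (g (v + s)) * cnj (trig k v) * of_real (r k)"
      by (simp add: cnj_trig)
  qed
  also have "\<dots> = of_real ((r k)\<^sup>2) * trig k s"
    using integral_g_shift_trig[OF s, of k] by (simp add: power2_eq_square)
  finally show ?thesis .
qed

lemma stationary_pair_proc: "stationary_pair M proc proc"
  unfolding stationary_pair_def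
proof (intro conjI allI)
  show "prob_space M" by unfold_locales
  show "AE s in lborel01. cross_cov_op M proc proc (trig k) s = cross_val M proc proc k * trig k s" for k
    by (rule AE_I2) (simp only: space_lborel01 cross_cov_op_proc cross_val_proc)
  show "cross_val M proc proc k \<noteq> 0" for k
    using r_pos[of k] by (simp add: cross_val_proc)
qed (intro centered_random_function_proc cov_by_difference_proc)+

lemma moment_class_proc:
  assumes "\<eta> \<ge> 1" "\<tau> \<ge> 1"
  shows "moment_class m \<eta> \<tau> M proc proc"
proof -
  have moments: "(\<integral>\<^sup>+\<omega>. ennreal (cmod (coef proc k \<omega> / of_real (sqrt (var_val M proc k))) ^ m) \<partial>M) = 1" for k
  proof -
    have "(\<integral>\<^sup>+\<omega>. ennreal (cmod (coef proc k \<omega> / of_real (sqrt (var_val M proc k))) ^ m) \<partial>M) = (\<integral>\<^sup>+\<omega>. 1 \<partial>M)"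
      using r_pos[of k]
      by (intro nn_integral_cong) (simp add: norm_divide cmod_coef_proc var_val_proc)
    then show ?thesis by (simp add: emeasure_space_1)
  qed
  have ratio: "lam_val M proc proc k / var_val M proc k = 1" for k
    using r_pos[of k] by (simp add: lam_val_proc var_val_proc)
  show ?thesis
    unfolding moment_class_def moments ratio using assms stationary_pair_proc by simp
qed

lemma error_class_err:
  assumes "ennreal \<eta> \<ge> (\<integral>\<^sup>+u. ennreal (\<bar>u\<bar> ^ l) \<partial>std_gaussian)"
  shows "error_class l \<eta> M err"
proof -
  have [measurable]: "err \<in> M \<rightarrow>\<^sub>M std_gaussian"
    using measurable_err by (simp cong: measurable_cong_sets)
  have int_err: "integrable M (\<lambda>\<omega>. F (err \<omega>)) \<longleftrightarrow> integrable std_gaussian F"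
    if [measurable]: "F \<in> borel_measurable borel" for F :: "real \<Rightarrow> real"
    by (subst distr_err[symmetric]) (simp add: integrable_distr_eq)
  have integral_err: "(\<integral>\<omega>. F (err \<omega>) \<partial>M) = (\<integral>u. F u \<partial>std_gaussian)"
    if [measurable]: "F \<in> borel_measurable borel" for F :: "real \<Rightarrow> real"
    by (subst distr_err[symmetric]) (simp add: integral_distr)
  have gauss: "integrable std_gaussian (\<lambda>u. u ^ i)" "(\<integral>u. u ^ i \<partial>std_gaussian) = (\<integral>u. std_normal_density u * u ^ i \<partial>lborel)" for i
    unfolding std_gaussian_def
    by (subst integrable_density) (auto simp: integrable_std_normal_moment integral_density)
  have "(\<integral>u. std_normal_density u * u ^ 1 \<partial>lborel) = 0"
    using integral_std_normal_moment_odd[of 0] by simp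
  moreover have "(\<integral>u. std_normal_density u * u ^ 2 \<partial>lborel) = 1"
    using integral_std_normal_moment_even[of 1] by (simp add: fact_numeral)
  moreover have "(\<integral>\<^sup>+\<omega>. ennreal (\<bar>err \<omega>\<bar> ^ l) \<partial>M) = (\<integral>\<^sup>+u. ennreal (\<bar>u\<bar> ^ l) \<partial>std_gaussian)"
    by (subst distr_err[symmetric]) (simp add: nn_integral_distr)
  ultimately show ?thesis
    using assms int_err[of "\<lambda>u. u ^ 1"] int_err[of "\<lambda>u. u ^ 2"]
      integral_err[of "\<lambda>u. u ^ 1"] integral_err[of "\<lambda>u. u ^ 2"] gauss[of 1] gauss[of 2]
    by (simp add: error_class_def)
qed

end

section \<open>Laws of the observations\<close>

definition lin_form :: "(real \<Rightarrow> real) \<Rightarrow> (real \<Rightarrow> real) \<Rightarrow> real" where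
  "lin_form \<beta> x = (\<integral>t. \<beta> t * x t \<partial>lborel01)"

lemma measurable_lin_form: "\<beta> \<in> L2 \<Longrightarrow> lin_form \<beta> \<in> borel_measurable L2_borel"
  using borel_measurable_integral_inner_L2[of \<beta>] by (simp add: lin_form_def[abs_def] mult.commute)

text \<open>The density of the law under \<open>\<beta>'\<close> relative to that under
  \<open>\<beta>\<close>. Given X, the response is normal with standard deviation \<sigma>; the
  standardized residual takes the place of u in the Cameron-Martin factor, and the standardized
  difference of means that of s.\<close>

definition lik_ratio ::
  "real \<Rightarrow> (real \<Rightarrow> real) \<Rightarrow> (real \<Rightarrow> real) \<Rightarrow> real \<times> (real \<Rightarrow> real) \<times> (real \<Rightarrow> real) \<Rightarrow> real" where
  "lik_ratio \<sigma> \<beta> \<beta>' = (\<lambda>(y, x, w).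
     exp ((y - lin_form \<beta> x) / \<sigma> * ((lin_form \<beta>' x - lin_form \<beta> x) / \<sigma>)
          - ((lin_form \<beta>' x - lin_form \<beta> x) / \<sigma>)\<^sup>2 / 2))"

lemma measurable_lik_ratio:
  assumes "\<beta> \<in> L2" "\<beta>' \<in> L2"
  shows "lik_ratio \<sigma> \<beta> \<beta>' \<in> borel_measurable obs_space"
proof -
  note [measurable] = assms[THEN measurable_lin_form]
  show ?thesis unfolding lik_ratio_def obs_space_def by measurable
qed

context random_shift
begin

abbreviation obs :: "real \<Rightarrow> (real \<Rightarrow> real) \<Rightarrow> (real \<times> (real \<Rightarrow> real) \<times> (real \<Rightarrow> real)) measure" where
  "obs \<sigma> \<beta> \<equiv> obs_law \<sigma> \<beta> M proc proc err"

definition obs_map :: "real \<Rightarrow> (real \<Rightarrow> real) \<Rightarrow> real \<times> bool \<times> real \<Rightarrow> real \<times> (real \<Rightarrow> real) \<times> (real \<Rightarrow> real)" where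
  "obs_map \<sigma> \<beta> z = (let x = wave g (fst z, fst (snd z)) in (lin_form \<beta> x + \<sigma> * snd (snd z), x, x))"

lemma measurable_obs_map [measurable]:
  assumes "\<beta> \<in> L2"
  shows "obs_map \<sigma> \<beta> \<in> shift_space \<rightarrow>\<^sub>M obs_space"
proof -
  have w [measurable]: "(\<lambda>z. wave g (fst z, fst (snd z))) \<in> shift_space \<rightarrow>\<^sub>M L2_borel"
    by (rule measurable_compose[OF measurable_wave_index measurable_wave])
  have [measurable]: "(\<lambda>z. lin_form \<beta> (wave g (fst z, fst (snd z)))) \<in> borel_measurable shift_space"
    by (rule measurable_compose[OF w measurable_lin_form[OF assms]])
  show ?thesis
    unfolding obs_map_def[abs_def] obs_space_def Let_def by measurable
qed

lemma obs_eq_distr: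
  assumes "\<beta> \<in> L2"
  shows "obs \<sigma> \<beta> = distr shift_space obs_space (obs_map \<sigma> \<beta>)"
proof -
  have "obs \<sigma> \<beta> = distr M obs_space (obs_map \<sigma> \<beta> \<circ> \<pi>)"
    unfolding obs_law_def by (intro distr_cong) (auto simp: obs_map_def proc_def err_def lin_form_def Let_def)
  also have "\<dots> = distr (distr M shift_space \<pi>) obs_space (obs_map \<sigma> \<beta>)"
    using assms by (intro distr_distr[symmetric]) auto
  finally show ?thesis by (simp add: distr_pi)
qed

lemma sets_obs [measurable_cong, simp]: "sets (obs \<sigma> \<beta>) = sets obs_space"
  and space_obs [simp]: "space (obs \<sigma> \<beta>) = space obs_space"
  by (simp_all add: obs_law_def)

lemma prob_space_obs: "\<beta> \<in> L2 \<Longrightarrow> prob_space (obs \<sigma> \<beta>)"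
  unfolding obs_eq_distr
  by (intro prob_space.prob_space_distr prob_space_shift_space measurable_obs_map)

text \<open>Given shift and sign, replacing \<open>\<beta>\<close> by \<open>\<beta>'\<close>
  amounts to translating the noise by \<open>s (v, b)\<close>, and the Gaussian translation formula
  supplies the density.\<close>

lemma obs_density:
  assumes \<beta>: "\<beta> \<in> L2" "\<beta>' \<in> L2" and \<sigma>: "\<sigma> > 0"
  shows "obs \<sigma> \<beta>' = density (obs \<sigma> \<beta>) (\<lambda>x. ennreal (lik_ratio \<sigma> \<beta> \<beta>' x))"
proof (rule measure_eqI)
  fix A assume "A \<in> sets (obs \<sigma> \<beta>')"
  then have A [measurable]: "A \<in> sets obs_space" by simp
  note [measurable] = measurable_lik_ratio[OF \<beta>] measurable_obs_map[OF \<beta>(1)] measurable_obs_map[OF \<beta>(2)]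
  define s where "s c = (lin_form \<beta>' (wave g c) - lin_form \<beta> (wave g c)) / \<sigma>" for c
  have s [measurable]: "s \<in> borel_measurable (lborel01 \<Otimes>\<^sub>M coin)"
    unfolding s_def[abs_def]
    using measurable_compose[OF measurable_wave measurable_lin_form[OF \<beta>(1)]]
      measurable_compose[OF measurable_wave measurable_lin_form[OF \<beta>(2)]] by measurable
  define f where "f z = (indicator A (obs_map \<sigma> \<beta> z) :: ennreal)" for z
  have f: "f \<in> borel_measurable shift_space"
    unfolding f_def[abs_def] by measurable
  have "emeasure (obs \<sigma> \<beta>') A = (\<integral>\<^sup>+x. indicator A x \<partial>obs \<sigma> \<beta>')"
    by simp
  also have "\<dots> = (\<integral>\<^sup>+z. indicator A (obs_map \<sigma> \<beta>' z) \<partial>shift_space)"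
    unfolding obs_eq_distr[OF \<beta>(2)] by (rule nn_integral_distr) measurable
  also have "\<dots> = (\<integral>\<^sup>+(v, b, u). f (v, b, u + s (v, b)) \<partial>shift_space)"
  proof -
    have "obs_map \<sigma> \<beta> (v, b, u + s (v, b)) = obs_map \<sigma> \<beta>' (v, b, u)" for v b u
      using \<sigma> by (simp add: s_def obs_map_def Let_def distrib_left)
    then show ?thesis
      by (intro nn_integral_cong) (auto simp: f_def)
  qed
  also have "\<dots> = (\<integral>\<^sup>+(v, b, u). f (v, b, u) * ennreal (exp (u * s (v, b) - (s (v, b))\<^sup>2 / 2)) \<partial>shift_space)"
    by (rule nn_integral_shift_space_gaussian_shift[OF f s])
  also have "\<dots> = (\<integral>\<^sup>+z. ennreal (lik_ratio \<sigma> \<beta> \<beta>' (obs_map \<sigma> \<beta> z)) * indicator A (obs_map \<sigma> \<beta> z) \<partial>shift_space)"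
    using \<sigma> by (intro nn_integral_cong) (auto simp: f_def s_def obs_map_def Let_def lik_ratio_def mult.commute)
  also have "\<dots> = (\<integral>\<^sup>+x. ennreal (lik_ratio \<sigma> \<beta> \<beta>' x) * indicator A x \<partial>obs \<sigma> \<beta>)"
    unfolding obs_eq_distr[OF \<beta>(1)] by (rule nn_integral_distr[symmetric]) measurable
  also have "\<dots> = emeasure (density (obs \<sigma> \<beta>) (\<lambda>x. ennreal (lik_ratio \<sigma> \<beta> \<beta>' x))) A"
    by (rule emeasure_density[symmetric]) measurable
  finally show "emeasure (obs \<sigma> \<beta>') A = emeasure (density (obs \<sigma> \<beta>) (\<lambda>x. ennreal (lik_ratio \<sigma> \<beta> \<beta>' x))) A" .
qed simp

text \<open>One factor of the square is absorbed by the change of measure, leaving the mean of the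
  ratio under \<open>\<beta>'\<close>. There the residual is u + s, so the exponent is s^2 + (u s -
  s^2 / 2): the first term is at most q, and the exponential of the second integrates to 1.\<close>

lemma obs_lik_ratio_square:
  assumes \<beta>: "\<beta> \<in> L2" "\<beta>' \<in> L2" and \<sigma>: "\<sigma> > 0"
    and bound: "\<And>v b. v \<in> {0..1} \<Longrightarrow> ((lin_form \<beta>' (wave g (v, b)) - lin_form \<beta> (wave g (v, b))) / \<sigma>)\<^sup>2 \<le> q"
  shows "(\<integral>\<^sup>+x. ennreal ((lik_ratio \<sigma> \<beta> \<beta>' x)\<^sup>2) \<partial>obs \<sigma> \<beta>) \<le> ennreal (exp q)"
proof -
  note [measurable] = measurable_lik_ratio[OF \<beta>] measurable_obs_map[OF \<beta>(1)] measurable_obs_map[OF \<beta>(2)]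
  define s where "s c = (lin_form \<beta>' (wave g c) - lin_form \<beta> (wave g c)) / \<sigma>" for c
  have s [measurable]: "s \<in> borel_measurable (lborel01 \<Otimes>\<^sub>M coin)"
    unfolding s_def[abs_def]
    using measurable_compose[OF measurable_wave measurable_lin_form[OF \<beta>(1)]]
      measurable_compose[OF measurable_wave measurable_lin_form[OF \<beta>(2)]] by measurable
  have s_idx [measurable]: "(\<lambda>z. s (fst z, fst (snd z))) \<in> borel_measurable shift_space"
    by (rule measurable_compose[OF measurable_wave_index s])
  have nonneg: "lik_ratio \<sigma> \<beta> \<beta>' x \<ge> 0" for x
    by (simp add: lik_ratio_def split: prod.split)
  have m: "(\<lambda>x. ennreal (lik_ratio \<sigma> \<beta> \<beta>' x)) \<in> borel_measurable (obs \<sigma> \<beta>)"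
    by measurable
  have "(\<integral>\<^sup>+x. ennreal ((lik_ratio \<sigma> \<beta> \<beta>' x)\<^sup>2) \<partial>obs \<sigma> \<beta>)
      = (\<integral>\<^sup>+x. ennreal (lik_ratio \<sigma> \<beta> \<beta>' x) \<partial>density (obs \<sigma> \<beta>) (\<lambda>x. ennreal (lik_ratio \<sigma> \<beta> \<beta>' x)))"
    unfolding nn_integral_density[OF m m] by (simp add: nonneg ennreal_mult power2_eq_square)
  also have "\<dots> = (\<integral>\<^sup>+z. ennreal (lik_ratio \<sigma> \<beta> \<beta>' (obs_map \<sigma> \<beta>' z)) \<partial>shift_space)"
    unfolding obs_density[OF \<beta> \<sigma>, symmetric] obs_eq_distr[OF \<beta>(2)] by (rule nn_integral_distr) measurable
  also have "\<dots> \<le> (\<integral>\<^sup>+z. ennreal (exp q) * ennreal (exp (snd (snd z) * s (fst z, fst (snd z)) - (s (fst z, fst (snd z)))\<^sup>2 / 2)) \<partial>shift_space)"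
  proof (rule nn_integral_mono)
    fix z assume "z \<in> space shift_space"
    then have v: "fst z \<in> {0..1}" by (auto simp: space_shift_space)
    let ?s = "s (fst z, fst (snd z))"
    have "lik_ratio \<sigma> \<beta> \<beta>' (obs_map \<sigma> \<beta>' z) = exp (?s\<^sup>2 + (snd (snd z) * ?s - ?s\<^sup>2 / 2))"
      using \<sigma> by (simp add: lik_ratio_def obs_map_def Let_def s_def power2_eq_square field_simps)
    also have "\<dots> \<le> exp (q + (snd (snd z) * ?s - ?s\<^sup>2 / 2))"
      using bound[OF v, of "fst (snd z)"] by (simp add: s_def)
    also have "\<dots> = exp q * exp (snd (snd z) * ?s - ?s\<^sup>2 / 2)"
      by (rule exp_add)
    finally show "ennreal (lik_ratio \<sigma> \<beta> \<beta>' (obs_map \<sigma> \<beta>' z)) \<le> ennreal (exp q) * ennreal (exp (snd (snd z) * ?s - ?s\<^sup>2 / 2))"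
      by (simp add: ennreal_mult[symmetric] ennreal_leI)
  qed
  also have "\<dots> = ennreal (exp q) * (\<integral>\<^sup>+z. ennreal (exp (snd (snd z) * s (fst z, fst (snd z)) - (s (fst z, fst (snd z)))\<^sup>2 / 2)) \<partial>shift_space)"
    by (rule nn_integral_cmult) measurable
  also have "(\<integral>\<^sup>+z. ennreal (exp (snd (snd z) * s (fst z, fst (snd z)) - (s (fst z, fst (snd z)))\<^sup>2 / 2)) \<partial>shift_space) = 1"
    using nn_integral_shift_space_gaussian_shift[of "\<lambda>z. 1" s] s
    by (simp add: case_prod_beta' prob_space.emeasure_space_1[OF prob_space_shift_space])
  finally show ?thesis by simp
qed

end

section \<open>Necessary conditions for a nonempty class\<close>

lemma coef_measurable:
  assumes "centered_random_function M X"
  shows "coef X k \<in> borel_measurable M"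
proof -
  have [measurable]: "(\<lambda>x. X (fst x) (snd x)) \<in> borel_measurable (M \<Otimes>\<^sub>M lborel01)"
    using assms by (simp add: centered_random_function_def case_prod_beta')
  have "(\<lambda>\<omega>. cpx (X \<omega>)) \<in> M \<rightarrow>\<^sub>M L2_borel"
  proof (rule measurable_L2_borelI)
    show "(\<lambda>(\<omega>, t). cpx (X \<omega>) t) \<in> borel_measurable (M \<Otimes>\<^sub>M lborel01)"
      unfolding case_prod_beta' by measurable
  qed (use assms in \<open>auto simp: centered_random_function_def intro: cpx_L2\<close>)
  from measurable_compose[OF this borel_measurable_L2_inner[OF trig_L2]]
  show ?thesis by (simp add: coef_def[abs_def])
qed

text \<open>Fubini exchanges expectation and Fourier integral, and the pointwise means vanish. The
  integrability it needs follows from |x| \<le> 1 + x^2.\<close>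

lemma coef_mean_zero:
  assumes M: "prob_space M" and X: "centered_random_function M X"
  shows "(\<integral>\<omega>. coef X k \<omega> \<partial>M) = 0"
proof -
  interpret prob_space M by fact
  interpret MT: pair_prob_space M lborel01 ..
  note Xm [measurable] = X[unfolded centered_random_function_def, THEN conjunct1]
  have XL2: "X \<omega> \<in> L2" if "\<omega> \<in> space M" for \<omega>
    using X that by (auto simp: centered_random_function_def)
  have [measurable]: "trig k \<in> borel_measurable lborel01"
    by (intro measurable_lborel01_borel) measurable
  let ?f = "\<lambda>(\<omega>, t). of_real (X \<omega> t) * trig (- k) t"
  have [measurable]: "trig (- k) \<in> borel_measurable lborel01"
    by (intro measurable_lborel01_borel) measurable
  have f [measurable]: "?f \<in> borel_measurable (M \<Otimes>\<^sub>M lborel01)"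
    using Xm unfolding case_prod_beta' by measurable
  have "integrable (M \<Otimes>\<^sub>M lborel01) ?f"
  proof (rule integrableI_bounded[OF f])
    have "(\<integral>\<^sup>+z. ennreal (norm (?f z)) \<partial>(M \<Otimes>\<^sub>M lborel01)) = (\<integral>\<^sup>+\<omega>. \<integral>\<^sup>+t. ennreal \<bar>X \<omega> t\<bar> \<partial>lborel01 \<partial>M)"
      by (subst lborel01.nn_integral_fst[symmetric]) (auto simp: norm_mult)
    also have "\<dots> \<le> (\<integral>\<^sup>+\<omega>. 1 + ennreal ((L2_norm (X \<omega>))\<^sup>2) \<partial>M)"
    proof (rule nn_integral_mono)
      fix \<omega> assume \<omega>: "\<omega> \<in> space M"
      note [measurable] = L2_borel_measurable[OF XL2[OF \<omega>]]
      have "(\<integral>\<^sup>+t. ennreal \<bar>X \<omega> t\<bar> \<partial>lborel01) \<le> (\<integral>\<^sup>+t. 1 + ennreal ((norm (X \<omega> t))\<^sup>2) \<partial>lborel01)"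
      proof (rule nn_integral_mono)
        fix t
        have "2 * \<bar>x\<bar> \<le> 1 + x\<^sup>2" for x :: real
          using sum_squares_bound[of "\<bar>x\<bar>" 1] by simp
        from this[of "X \<omega> t"] have "\<bar>X \<omega> t\<bar> \<le> 1 + (norm (X \<omega> t))\<^sup>2" by simp
        then have "ennreal \<bar>X \<omega> t\<bar> \<le> ennreal (1 + (norm (X \<omega> t))\<^sup>2)" by (rule ennreal_leI)
        then show "ennreal \<bar>X \<omega> t\<bar> \<le> 1 + ennreal ((norm (X \<omega> t))\<^sup>2)" by simp
      qed
      also have "\<dots> = 1 + ennreal ((L2_norm (X \<omega>))\<^sup>2)"
        using lborel01.emeasure_space_1
        by (simp add: nn_integral_add ennreal_L2_norm_square[OF XL2[OF \<omega>]])
      finally show "(\<integral>\<^sup>+t. ennreal \<bar>X \<omega> t\<bar> \<partial>lborel01) \<le> 1 + ennreal ((L2_norm (X \<omega>))\<^sup>2)" .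
    qed
    also have "\<dots> < \<infinity>"
    proof -
      have [measurable]: "(\<lambda>\<omega>. L2_norm (X \<omega>)) \<in> borel_measurable M"
        unfolding L2_norm_def by measurable
      show ?thesis
        using X by (subst nn_integral_add) (auto simp: centered_random_function_def emeasure_space_1)
    qed
    finally show "(\<integral>\<^sup>+z. ennreal (norm (?f z)) \<partial>(M \<Otimes>\<^sub>M lborel01)) < \<infinity>" .
  qed
  from MT.Fubini_integral[OF this]
  have "(\<integral>\<omega>. \<integral>t. of_real (X \<omega> t) * trig (- k) t \<partial>lborel01 \<partial>M) = (\<integral>t. \<integral>\<omega>. of_real (X \<omega> t) * trig (- k) t \<partial>M \<partial>lborel01)"
    by simp
  also have "\<dots> = (\<integral>t. 0 \<partial>lborel01)"
  proof (intro Bochner_Integration.integral_cong refl)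
    fix t assume "t \<in> space lborel01"
    then have "(\<integral>\<omega>. X \<omega> t \<partial>M) = 0"
      using X by (auto simp: centered_random_function_def)
    then show "(\<integral>\<omega>. of_real (X \<omega> t) * trig (- k) t \<partial>M) = 0"
      by simp
  qed
  finally show ?thesis
    by (simp add: coef_def L2_inner_def cnj_trig)
qed

text \<open>This is \<open>\<lambda>\<^sub>k \<le> x\<^sub>k\<close>: by Cauchy-Schwarz, since centering makes \<open>w\<^sub>k\<close> a second moment.\<close>

lemma lam_val_le_energy:
  assumes M: "prob_space M" and X: "centered_random_function M X" and W: "centered_random_function M W"
  shows "ennreal (lam_val M X W k) \<le> (\<integral>\<^sup>+\<omega>. ennreal ((cmod (coef X k \<omega>))\<^sup>2) \<partial>M)"
proof -
  interpret prob_space M by fact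
  note [measurable] = coef_measurable[OF X] coef_measurable[OF W]
  define w where "w = (\<integral>\<^sup>+\<omega>. ennreal ((cmod (coef W k \<omega>))\<^sup>2) \<partial>M)"
  have bessel1: "(cmod (coef W k \<omega>))\<^sup>2 \<le> (L2_norm (W \<omega>))\<^sup>2" if "\<omega> \<in> space M" for \<omega>
  proof -
    have "cpx (W \<omega>) \<in> L2"
      using W that by (auto simp: centered_random_function_def intro: cpx_L2)
    from bessel_inequality[OF this, of "{k}"] show ?thesis
      by (simp add: coef_def L2_norm_def)
  qed
  have "w \<le> (\<integral>\<^sup>+\<omega>. ennreal ((L2_norm (W \<omega>))\<^sup>2) \<partial>M)"
    unfolding w_def by (intro nn_integral_mono ennreal_leI bessel1)
  also have "\<dots> < \<infinity>"
    using W by (simp add: centered_random_function_def)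
  finally have w_fin: "w < \<infinity>" .
  have int: "integrable M (\<lambda>\<omega>. (cmod (coef W k \<omega>))\<^sup>2)"
    using w_fin by (intro integrableI_bounded) (auto simp: w_def)
  have var: "ennreal (var_val M W k) = w"
    unfolding var_val_def Var_def coef_mean_zero[OF M W] w_def
    using nn_integral_eq_integral[OF int] by simp
  have "ennreal (cmod (cross_val M X W k)) \<le> (\<integral>\<^sup>+\<omega>. ennreal (cmod (coef X k \<omega>)) * ennreal (cmod (coef W k \<omega>)) \<partial>M)"
  proof -
    have "cross_val M X W k = (\<integral>\<omega>. cnj (coef X k \<omega>) * coef W k \<omega> \<partial>M)"
      by (simp add: cross_val_def coef_def L2_inner_commute)
    moreover have "ennreal (cmod (\<integral>\<omega>. cnj (coef X k \<omega>) * coef W k \<omega> \<partial>M)) \<le> (\<integral>\<^sup>+\<omega>. ennreal (cmod (cnj (coef X k \<omega>) * coef W k \<omega>)) \<partial>M)"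
    \<comment> \<open>For a non-integrable product the Bochner integral has the default value 0,
      which satisfies the bound.\<close>
    proof (cases "integrable M (\<lambda>\<omega>. cnj (coef X k \<omega>) * coef W k \<omega>)")
      case True
      then show ?thesis by (rule integral_norm_bound_ennreal)
    qed (simp add: not_integrable_integral_eq)
    ultimately show ?thesis by (simp add: norm_mult ennreal_mult)
  qed
  then have "(ennreal (cmod (cross_val M X W k)))\<^sup>2 \<le> (\<integral>\<^sup>+\<omega>. ennreal (cmod (coef X k \<omega>)) * ennreal (cmod (coef W k \<omega>)) \<partial>M)\<^sup>2"
    by (rule power_mono_ennreal)
  also have "\<dots> \<le> (\<integral>\<^sup>+\<omega>. (ennreal (cmod (coef X k \<omega>)))\<^sup>2 \<partial>M) * (\<integral>\<^sup>+\<omega>. (ennreal (cmod (coef W k \<omega>)))\<^sup>2 \<partial>M)"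
    by (rule Cauchy_Schwarz_nn_integral) measurable
  also have "\<dots> = (\<integral>\<^sup>+\<omega>. ennreal ((cmod (coef X k \<omega>))\<^sup>2) \<partial>M) * w"
    by (simp add: w_def ennreal_power)
  finally have cs: "ennreal ((cmod (cross_val M X W k))\<^sup>2) \<le> (\<integral>\<^sup>+\<omega>. ennreal ((cmod (coef X k \<omega>))\<^sup>2) \<partial>M) * ennreal (var_val M W k)"
    by (simp add: ennreal_power var)
  show ?thesis
  proof (cases "var_val M W k > 0")
    case True
    then have "ennreal (lam_val M X W k) = ennreal ((cmod (cross_val M X W k))\<^sup>2) / ennreal (var_val M W k)"
      by (simp add: lam_val_def divide_ennreal)
    also have "\<dots> \<le> (\<integral>\<^sup>+\<omega>. ennreal ((cmod (coef X k \<omega>))\<^sup>2) \<partial>M) * ennreal (var_val M W k) / ennreal (var_val M W k)"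
      by (rule divide_right_mono_ennreal[OF cs])
    also have "\<dots> = (\<integral>\<^sup>+\<omega>. ennreal ((cmod (coef X k \<omega>))\<^sup>2) \<partial>M)"
      using True by (simp add: ennreal_mult_divide_eq)
    finally show ?thesis .
  next
    \<comment> \<open>Here \<open>var_val\<close> is 0, and division by zero makes
      \<open>lam_val\<close> equal to 0.\<close>
    case False
    then have "lam_val M X W k \<le> 0"
      by (simp add: lam_val_def divide_nonneg_nonpos)
    then show ?thesis by (simp add: ennreal_neg)
  qed
qed

text \<open>Each eigenvalue is at most the energy of \<open>X\<close> at its frequency, and Bessel's
  inequality under the expectation bounds the sum of these energies by that of
  \<open>X\<close>.\<close>

lemma sum_lam_val_le:
  assumes "(M, X, W) \<in> F_class m \<eta> \<tau> \<kappa> p \<nu> d \<Lambda>" "\<Lambda> \<ge> 0" "finite I"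
  shows "(\<Sum>k\<in>I. lam_val M X W k) \<le> \<Lambda>"
proof -
  have M: "prob_space M" and X: "centered_random_function M X" and W: "centered_random_function M W"
    and \<Lambda>: "(\<integral>\<^sup>+\<omega>. ennreal ((L2_norm (X \<omega>))\<^sup>2) \<partial>M) \<le> ennreal \<Lambda>"
    and nonneg: "lam_val M X W k \<ge> 0" for k
    using assms(1) by (auto simp: F_class_def moment_class_def stationary_pair_def link_class_def)
  note [measurable] = coef_measurable[OF X]
  have "ennreal (\<Sum>k\<in>I. lam_val M X W k) = (\<Sum>k\<in>I. ennreal (lam_val M X W k))"
    by (simp add: sum_ennreal nonneg)
  also have "\<dots> \<le> (\<Sum>k\<in>I. \<integral>\<^sup>+\<omega>. ennreal ((cmod (coef X k \<omega>))\<^sup>2) \<partial>M)"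
    by (intro sum_mono lam_val_le_energy M X W)
  also have "\<dots> = (\<integral>\<^sup>+\<omega>. ennreal (\<Sum>k\<in>I. (cmod (coef X k \<omega>))\<^sup>2) \<partial>M)"
    by (subst nn_integral_sum[symmetric]) (auto simp: sum_ennreal)
  also have "\<dots> \<le> (\<integral>\<^sup>+\<omega>. ennreal ((L2_norm (X \<omega>))\<^sup>2) \<partial>M)"
  proof (intro nn_integral_mono ennreal_leI)
    fix \<omega> assume "\<omega> \<in> space M"
    then have "cpx (X \<omega>) \<in> L2"
      using X by (auto simp: centered_random_function_def intro: cpx_L2)
    from bessel_inequality[OF this \<open>finite I\<close>]
    show "(\<Sum>k\<in>I. (cmod (coef X k \<omega>))\<^sup>2) \<le> (L2_norm (X \<omega>))\<^sup>2"
      by (simp add: coef_def L2_norm_def)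
  qed
  finally have "ennreal (\<Sum>k\<in>I. lam_val M X W k) \<le> ennreal \<Lambda>"
    using \<Lambda> by simp
  then show ?thesis using assms(2) by simp
qed

section \<open>The hypercube of slopes\<close>

lemma wt_ge_1: "wt k \<ge> 1"
  by (simp add: wt_def)

lemma wt_pos [simp]: "wt k > 0" "wt k \<noteq> 0" "wt k \<ge> 0"
  using wt_ge_1[of k] by simp_all

lemma wt_abs: "wt (- k) = wt k" "wt \<bar>k\<bar> = wt k"
  by (auto simp: wt_def abs_if power2_eq_square)

lemma wt_mono: "\<bar>j\<bar> \<le> \<bar>k\<bar> \<Longrightarrow> wt j \<le> wt k"
proof -
  assume "\<bar>j\<bar> \<le> \<bar>k\<bar>"
  then have "\<bar>2 * pi * of_int j\<bar> \<le> \<bar>2 * pi * of_int k\<bar>"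
    by (simp add: abs_mult del: of_int_abs)
  then show ?thesis
    unfolding wt_def by (intro add_left_mono power_mono) auto
qed

text \<open>Compares the weight with the number of frequencies up to K, which is where the extra 1 /
  2 in the exponent originates. The constant is 2 \<pi> \<le> 7.\<close>

lemma wt_sqrt_le: "wt (int K) powr (1 / 2) \<le> 7 * (real K + 1)"
proof -
  have "2 * pi \<le> 7" using pi_less_4 pi_approx by simp
  have "wt (int K) \<le> (1 + 2 * pi * real K)\<^sup>2"
    by (simp add: wt_def power2_eq_square algebra_simps)
  then have "sqrt (wt (int K)) \<le> 1 + 2 * pi * real K"
    by (intro real_le_lsqrt) auto
  also have "\<dots> \<le> 7 * (real K + 1)"
    using mult_right_mono[OF \<open>2 * pi \<le> 7\<close>, of "real K"] by simp
  finally show ?thesis by (simp add: powr_half_sqrt)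
qed

lemma wt_eq: "wt k = 1 + 4 * (pi\<^sup>2 * (of_int k)\<^sup>2)"
  by (simp add: wt_def power_mult_distrib)

text \<open>At least (K + 1) / 2 frequencies k lie between K / 2 and K, each of weight at least a
  quarter of the last one. With \<open>wt_sqrt_le\<close> this gives 14 = 2 * 7 and the factor
  \<open>4 powr q\<close>.\<close>

lemma sum_wt_lower:
  assumes q: "q \<ge> 0"
  shows "wt (int K) powr (q + 1 / 2) \<le> 14 * 4 powr q * (\<Sum>k | \<bar>k\<bar> \<le> int K. wt k powr q)"
proof -
  have fin: "finite {k. \<bar>k\<bar> \<le> int K}"
    by (rule finite_subset[of _ "{- int K..int K}"]) auto
  \<comment> \<open>Rounding K / 2 up ensures 2 k \<ge> K for all k \<ge> h, and {h..K} still
    contains at least (K + 1) / 2 integers, also for K = 0.\<close>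
  define h where "h = (K + 1) div 2"
  have term_ge: "(wt (int K) / 4) powr q \<le> wt k powr q" if "k \<in> {int h..int K}" for k
  proof -
    have "real K \<le> 2 * of_int k"
    proof -
      have "int K \<le> 2 * k" using that by (auto simp: h_def)
      then have "real_of_int (int K) \<le> real_of_int (2 * k)" by (simp only: of_int_le_iff)
      then show ?thesis by simp
    qed
    then have "(real K)\<^sup>2 \<le> (2 * of_int k)\<^sup>2"
      by (intro power_mono) auto
    then have le: "pi\<^sup>2 * (real K)\<^sup>2 \<le> pi\<^sup>2 * (4 * (of_int k)\<^sup>2)"
      by (intro mult_left_mono) (auto simp: power_mult_distrib)
    have "(1 + 4 * (c * x)) / 4 \<le> 1 + 4 * (c * y)" if "c * x \<le> c * (4 * y)" for c x y :: real
      using that by (simp add: algebra_simps)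
    from this[OF le] have "wt (int K) / 4 \<le> wt k"
      unfolding wt_eq by simp
    then show ?thesis
      using q by (intro powr_mono2) auto
  qed
  have "wt (int K) powr (1 / 2) * (wt (int K) / 4) powr q \<le> 7 * (real K + 1) * (wt (int K) / 4) powr q"
    by (intro mult_right_mono wt_sqrt_le) simp
  also have "\<dots> \<le> 14 * (real (card {int h..int K}) * (wt (int K) / 4) powr q)"
  proof -
    have "K + 1 \<le> 2 * card {int h..int K}"
      by (auto simp: h_def)
    then have "real (K + 1) \<le> real (2 * card {int h..int K})"
      by (rule of_nat_mono)
    then have "real K + 1 \<le> 2 * real (card {int h..int K})"
      by (simp only: of_nat_add of_nat_mult of_nat_1 of_nat_numeral)
    then have "(real K + 1) * (7 * (wt (int K) / 4) powr q) \<le> (2 * real (card {int h..int K})) * (7 * (wt (int K) / 4) powr q)"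
      by (intro mult_right_mono) auto
    then show ?thesis by (simp only: mult_ac)
  qed
  also have "real (card {int h..int K}) * (wt (int K) / 4) powr q \<le> (\<Sum>k\<in>{int h..int K}. wt k powr q)"
    using sum_mono[of "{int h..int K}" "\<lambda>_. (wt (int K) / 4) powr q" "\<lambda>k. wt k powr q"] term_ge by simp
  also have "\<dots> \<le> (\<Sum>k | \<bar>k\<bar> \<le> int K. wt k powr q)"
    by (rule sum_mono2[OF fin]) auto
  finally have "wt (int K) powr (1 / 2) * (wt (int K) / 4) powr q \<le> 14 * (\<Sum>k | \<bar>k\<bar> \<le> int K. wt k powr q)"
    by simp
  then show ?thesis
    unfolding powr_add by (simp add: powr_divide field_simps)
qed

lemma sum_int_le_twice_sum_nat:
  fixes f :: "int \<Rightarrow> real"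
  assumes "\<And>k. f k \<ge> 0" "\<And>k. f (- k) = f k"
  shows "(\<Sum>k | \<bar>k\<bar> \<le> int K. f k) \<le> 2 * (\<Sum>j\<le>K. f (int j))"
proof -
  let ?A = "int ` {..K}" and ?B = "(\<lambda>j. - int j) ` {..K}"
  have "k \<in> ?A \<union> ?B" if "\<bar>k\<bar> \<le> int K" for k
  proof (cases "k \<ge> 0")
    case True
    then have "k = int (nat k)" "nat k \<le> K" using that by auto
    then show ?thesis by blast
  next
    case False
    then have "k = - int (nat (- k))" "nat (- k) \<le> K" using that by auto
    then show ?thesis by blast
  qed
  then have eq: "{k. \<bar>k\<bar> \<le> int K} = ?A \<union> ?B" by auto
  have "(\<Sum>k | \<bar>k\<bar> \<le> int K. f k) \<le> (\<Sum>k\<in>?A. f k) + (\<Sum>k\<in>?B. f k)"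
    unfolding eq using sum.union_inter[of ?A ?B f] sum_nonneg[of "?A \<inter> ?B" f] assms(1) by simp
  also have "(\<Sum>k\<in>?A. f k) = (\<Sum>j\<le>K. f (int j))"
    by (subst sum.reindex) (auto simp: inj_on_def)
  also have "(\<Sum>k\<in>?B. f k) = (\<Sum>j\<le>K. f (int j))"
    by (subst sum.reindex) (auto simp: inj_on_def assms(2))
  finally show ?thesis by simp
qed

section \<open>Cosine polynomials as real slopes\<close>

definition cos_sum :: "(nat \<Rightarrow> real) \<Rightarrow> nat set \<Rightarrow> real \<Rightarrow> real" where
  "cos_sum b S t = (\<Sum>j\<in>S. b j * cos (2 * pi * real j * t))"

lemma cos_eq_Re_trig: "cos (2 * pi * real j * t) = Re (trig (int j) t)"
  by (simp add: trig_def Re_exp mult_ac)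

lemma cos_L2: "(\<lambda>t. c * cos (2 * pi * real j * t)) \<in> L2"
proof (rule L2_bounded[where B = "\<bar>c\<bar>"])
  show "(\<lambda>t. c * cos (2 * pi * real j * t)) \<in> borel_measurable lborel01"
    by (intro measurable_lborel01_borel) measurable
  show "norm (c * cos (2 * pi * real j * t)) \<le> \<bar>c\<bar>" for t
    using mult_left_mono[OF abs_cos_le_one[of "2 * pi * real j * t"], of "\<bar>c\<bar>"] by (simp add: abs_mult)
qed

lemma cos_sum_L2: "cos_sum b S \<in> L2"
proof (rule L2_bounded[where B = "\<Sum>j\<in>S. \<bar>b j\<bar>"])
  show "cos_sum b S \<in> borel_measurable lborel01"
    unfolding cos_sum_def[abs_def] by (intro measurable_lborel01_borel) measurable
  show "norm (cos_sum b S t) \<le> (\<Sum>j\<in>S. \<bar>b j\<bar>)" for t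
    unfolding cos_sum_def real_norm_def
  proof (rule order_trans[OF sum_abs], rule sum_mono)
    fix j
    show "\<bar>b j * cos (2 * pi * real j * t)\<bar> \<le> \<bar>b j\<bar>"
      using mult_left_mono[OF abs_cos_le_one[of "2 * pi * real j * t"], of "\<bar>b j\<bar>"] by (simp add: abs_mult)
  qed
qed

text \<open>Frequencies j and -j share the amplitude \<open>b j\<close> because the slope is real,
  so the cube has one coordinate for each j \<ge> 0.\<close>

lemma coef_cos_sum:
  assumes "finite S"
  shows "L2_inner (cpx (cos_sum b S)) (trig k) =
    of_real (if nat \<bar>k\<bar> \<in> S then if k = 0 then b 0 else b (nat \<bar>k\<bar>) / 2 else 0)"
proof -
  have coef_cos: "L2_inner (cpx (\<lambda>t. cos (2 * pi * real j * t))) (trig k)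
      = (if nat \<bar>k\<bar> = j then if k = 0 then 1 else 1 / 2 else 0)" for j
  proof -
    \<comment> \<open>For j = 0 the index set collapses to one element, hence the factor 1 there
      instead of 1 / 2.\<close>
    have eq: "cpx (\<lambda>t. cos (2 * pi * real j * t)) = (\<lambda>t. \<Sum>i\<in>{int j, - int j}. (if j = 0 then 1 else 1 / 2) * trig i t)"
    proof
      fix t
      have "complex_of_real (Re z) = (z + cnj z) / 2" for z
        by (simp add: complex_eq_iff)
      then show "cpx (\<lambda>t. cos (2 * pi * real j * t)) t = (\<Sum>i\<in>{int j, - int j}. (if j = 0 then 1 else 1 / 2) * trig i t)"
        unfolding cos_eq_Re_trig by (cases "j = 0") (auto simp: cnj_trig add_divide_distrib)
    qed
    have "k \<in> {int j, - int j} \<longleftrightarrow> nat \<bar>k\<bar> = j" "nat \<bar>k\<bar> = j \<Longrightarrow> j = 0 \<longleftrightarrow> k = 0"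
      by auto
    moreover have "L2_inner (\<lambda>t. \<Sum>i\<in>{int j, - int j}. (if j = 0 then 1 else 1 / 2) * trig i t) (trig k)
        = (if k \<in> {int j, - int j} then if j = 0 then 1 else 1 / 2 else 0)"
      by (rule L2_inner_trig_sum) simp
    ultimately show ?thesis
      unfolding eq by simp
  qed
  have "L2_inner (cpx (cos_sum b S)) (trig k) = (\<Sum>j\<in>S. of_real (b j) * L2_inner (cpx (\<lambda>t. cos (2 * pi * real j * t))) (trig k))"
    using cos_L2[of 1] unfolding cos_sum_def[abs_def]
    by (subst L2_inner_sum_left[symmetric]) (auto intro!: cpx_L2)
  also have "\<dots> = of_real (if nat \<bar>k\<bar> \<in> S then if k = 0 then b 0 else b (nat \<bar>k\<bar>) / 2 else 0)"
    unfolding coef_cos using assms by (auto simp: if_distrib[of "\<lambda>x. _ * x"] sum.delta' cong: if_cong)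
  finally show ?thesis .
qed

lemma lin_form_cos_sum:
  assumes x: "x \<in> L2" and S: "finite S"
  shows "lin_form (cos_sum b S) x = (\<Sum>j\<in>S. b j * Re (L2_inner (cpx x) (trig (int j))))"
proof -
  have Re: "(\<integral>t. cos (2 * pi * real j * t) * x t \<partial>lborel01) = Re (L2_inner (cpx x) (trig (int j)))" for j
    unfolding L2_inner_def cos_eq_Re_trig
    by (subst integral_Re[symmetric]) (auto simp: L2_integrable_mult_cnj[OF cpx_L2[OF x] trig_L2] mult.commute)
  have int: "integrable lborel01 (\<lambda>t. b j * (cos (2 * pi * real j * t) * x t))" for j
    using L2_integrable_inner[OF cos_L2[of 1 j] x] by (intro integrable_mult_right) simp
  have "lin_form (cos_sum b S) x = (\<integral>t. (\<Sum>j\<in>S. b j * (cos (2 * pi * real j * t) * x t)) \<partial>lborel01)"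
    by (simp add: lin_form_def cos_sum_def sum_distrib_right mult.assoc)
  also have "\<dots> = (\<Sum>j\<in>S. b j * Re (L2_inner (cpx x) (trig (int j))))"
    using int by (subst Bochner_Integration.integral_sum) (auto simp: Re)
  finally show ?thesis .
qed

text \<open>Keeping nonnegative frequencies only leaves one term of the loss for each coordinate of
  the cube, as \<open>assouad\<close> expects.\<close>

lemma wnorm_sq_ge:
  assumes "finite J"
  shows "(\<Sum>j\<in>J. ennreal (wt (int j) powr \<nu> * (cmod (L2_inner f (trig (int j))))\<^sup>2)) \<le> wnorm_sq \<nu> f"
proof -
  let ?F = "\<lambda>k. ennreal (wt k powr \<nu> * (cmod (L2_inner f (trig k)))\<^sup>2)"
  have "(\<Sum>j\<in>J. ?F (int j)) = (\<Sum>k\<in>int ` J. ?F k)"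
    by (simp add: sum.reindex)
  also have "\<dots> = infsum ?F (int ` J)"
    using assms by simp
  also have "\<dots> \<le> infsum ?F UNIV"
    by (rule infsum_mono_neutral) (auto intro: nonneg_summable_on_complete)
  finally show ?thesis by (simp add: wnorm_sq_def)
qed

lemma cos_sum_sobolev_ball:
  assumes S: "S \<subseteq> {..K}" and \<rho>: "(\<Sum>k | \<bar>k\<bar> \<le> int K. wt k powr p * (b (nat \<bar>k\<bar>))\<^sup>2) \<le> \<rho>"
  shows "cpx (cos_sum b S) \<in> sobolev_ball p \<rho>"
proof -
  let ?c = "\<lambda>k. (cmod (L2_inner (cpx (cos_sum b S)) (trig k)))\<^sup>2"
  let ?I = "{k. \<bar>k\<bar> \<le> int K}"
  have finS: "finite S" using S by (rule finite_subset) simp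
  have fin: "finite ?I"
    by (rule finite_subset[of _ "{- int K..int K}"]) auto
  have c_le: "?c k \<le> (b (nat \<bar>k\<bar>))\<^sup>2" for k
    unfolding coef_cos_sum[OF finS] norm_of_real power2_abs by (auto simp: power_divide)
  have c0: "?c k = 0" if "\<not> \<bar>k\<bar> \<le> int K" for k
    using that S unfolding coef_cos_sum[OF finS] by auto
  have "wnorm_sq p (cpx (cos_sum b S)) = infsum (\<lambda>k. ennreal (wt k powr p * ?c k)) ?I"
    unfolding wnorm_sq_def using c0 by (intro infsum_cong_neutral) auto
  also have "\<dots> = (\<Sum>k\<in>?I. ennreal (wt k powr p * ?c k))"
    using fin by simp
  also have "\<dots> \<le> (\<Sum>k\<in>?I. ennreal (wt k powr p * (b (nat \<bar>k\<bar>))\<^sup>2))"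
    by (intro sum_mono ennreal_leI mult_left_mono c_le) simp
  also have "\<dots> \<le> ennreal \<rho>"
    using \<rho> by (subst sum_ennreal) (auto intro!: ennreal_leI)
  finally have "wnorm_sq p (cpx (cos_sum b S)) \<le> ennreal \<rho>" .
  then show ?thesis
    using cpx_L2[OF cos_sum_L2] by (auto simp: sobolev_ball_def sobolev_def intro: le_less_trans)
qed

text \<open>The coefficient of the slope at j depends on S only through whether j belongs to S, so
  the loss splits into the coordinates of Assouad's argument. Toggling j moves the standardized
  response by at most |b_j| r_j / \<sigma> on every path; the hypothesis on \<open>b\<close> thus
  keeps neighbouring n-samples close.\<close>

lemma (in random_shift) hypercube_risk:
  assumes \<sigma>: "\<sigma> > 0" and n: "n \<ge> 1"
    and b: "\<And>j. j \<le> K \<Longrightarrow> (b j * r (int j) / \<sigma>)\<^sup>2 \<le> 1 / (2 * real n)"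
    and est: "est \<in> estimators n"
    and R: "\<And>S. S \<subseteq> {..K} \<Longrightarrow> risk \<nu> n est (cos_sum b S) (obs \<sigma> (cos_sum b S)) \<le> R"
  shows "(\<Sum>j\<le>K. ennreal (wt (int j) powr \<nu> * (b j)\<^sup>2 / 16)) \<le> 2 * R"
proof -
  have est_meas: "(\<lambda>z. L2_inner (\<lambda>t. est z t - cpx (cos_sum b S) t) (trig k)) \<in> borel_measurable (\<Pi>\<^sub>M i\<in>{..<n}. P)"
    and est_L2: "z \<in> space (\<Pi>\<^sub>M i\<in>{..<n}. P) \<Longrightarrow> est z \<in> L2"
    if P: "sets P = sets obs_space" for S k P z
  proof -
    have "sets (\<Pi>\<^sub>M i\<in>{..<n}. P) = sets (\<Pi>\<^sub>M i\<in>{..<n}. obs_space)"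
      by (intro sets_PiM_cong refl P)
    then have e: "est \<in> (\<Pi>\<^sub>M i\<in>{..<n}. P) \<rightarrow>\<^sub>M L2_borel"
      using est unfolding estimators_def by (simp cong: measurable_cong_sets)
    show L2: "est z \<in> L2" if "z \<in> space (\<Pi>\<^sub>M i\<in>{..<n}. P)" for z
      using measurable_space[OF e that] by simp
    have "(\<lambda>z. L2_inner (est z) (trig k)) \<in> borel_measurable (\<Pi>\<^sub>M i\<in>{..<n}. P)"
      by (rule measurable_compose[OF e borel_measurable_L2_inner]) simp
    then have "(\<lambda>z. L2_inner (est z) (trig k) - L2_inner (cpx (cos_sum b S)) (trig k)) \<in> borel_measurable (\<Pi>\<^sub>M i\<in>{..<n}. P)"
      by measurable
    then show "(\<lambda>z. L2_inner (\<lambda>t. est z t - cpx (cos_sum b S) t) (trig k)) \<in> borel_measurable (\<Pi>\<^sub>M i\<in>{..<n}. P)"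
      by (rule measurable_cong[THEN iffD1, rotated]) (simp add: L2 L2_inner_diff_left cpx_L2[OF cos_sum_L2])
  qed
  define F where "F j S z = ennreal (wt (int j) powr \<nu> * (cmod (L2_inner (\<lambda>t. est z t - cpx (cos_sum b S) t) (trig (int j))))\<^sup>2)"
    for j S z
  define a where "a j S = (\<integral>\<^sup>+z. F j S z \<partial>(\<Pi>\<^sub>M i\<in>{..<n}. obs \<sigma> (cos_sum b S)))" for j S
  have F_meas: "F j S \<in> borel_measurable (\<Pi>\<^sub>M i\<in>{..<n}. P)" if "sets P = sets obs_space" for j S P
  proof -
    note [measurable] = est_meas[OF that]
    show ?thesis unfolding F_def[abs_def] by measurable
  qed
  show ?thesis
  proof (rule assouad[where a = a])
    show "finite {..K}" by simp
  next
    fix S assume S: "S \<subseteq> {..K}"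
    have "(\<Sum>j\<in>{..K}. a j S) = (\<integral>\<^sup>+z. (\<Sum>j\<in>{..K}. F j S z) \<partial>(\<Pi>\<^sub>M i\<in>{..<n}. obs \<sigma> (cos_sum b S)))"
      unfolding a_def by (rule nn_integral_sum[symmetric]) (simp add: F_meas)
    also have "\<dots> \<le> risk \<nu> n est (cos_sum b S) (obs \<sigma> (cos_sum b S))"
      unfolding risk_def F_def by (intro nn_integral_mono wnorm_sq_ge) simp
    also have "\<dots> \<le> R" by (rule R[OF S])
    finally show "(\<Sum>j\<in>{..K}. a j S) \<le> R" .
  next
    fix j S assume S: "S \<subseteq> {..K}" and j: "j \<in> {..K}" and jS: "j \<notin> S"
    have finS: "finite S" using S by (rule finite_subset) simp
    define \<beta> where "\<beta> = cos_sum b S"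
    define \<beta>' where "\<beta>' = cos_sum b (insert j S)"
    have L2: "\<beta> \<in> L2" "\<beta>' \<in> L2" by (simp_all add: \<beta>_def \<beta>'_def cos_sum_L2)
    note dens = obs_density[OF L2 \<sigma>]
    have shift: "((lin_form \<beta>' (wave g (v, e)) - lin_form \<beta> (wave g (v, e))) / \<sigma>)\<^sup>2 \<le> 1 / (2 * real n)"
      if v: "v \<in> {0..1}" for v e
    proof -
      let ?z = "L2_inner (cpx (wave g (v, e))) (trig (int j))"
      have "lin_form \<beta>' (wave g (v, e)) - lin_form \<beta> (wave g (v, e)) = b j * Re ?z"
        using finS jS by (simp add: \<beta>_def \<beta>'_def lin_form_cos_sum wave_L2[OF v])
      then have "((lin_form \<beta>' (wave g (v, e)) - lin_form \<beta> (wave g (v, e))) / \<sigma>)\<^sup>2 = (b j / \<sigma>)\<^sup>2 * (Re ?z)\<^sup>2"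
        by (simp add: power_mult_distrib power_divide)
      also have "\<dots> \<le> (b j / \<sigma>)\<^sup>2 * (cmod ?z)\<^sup>2"
        by (intro mult_left_mono) (auto simp: cmod_power2)
      also have "cmod ?z = r (int j)"
        using r_pos[of "int j"] by (simp add: coef_wave[OF v] norm_mult)
      finally show ?thesis
        using b[of j] j by (simp add: power_mult_distrib power_divide)
    qed
    \<comment> \<open>The bound 1 / (2 n) on the squared shift makes the second moment over n
      observations at most exp (1 / 2), within the bound 2 of
      \<open>le_cam_two_point\<close>.\<close>
    have two: "exp (1 / (2 * real n)) ^ n \<le> (2 :: real)"
    proof -
      have "exp (1 / (2 * real n)) ^ n = exp (1 / 2 :: real)"
        using n by (simp add: exp_of_nat_mult[symmetric])
      also have "\<dots> \<le> 2"
        using exp_bound_half[of "1 / 2 :: real"] by simp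
      finally show ?thesis .
    qed
    \<comment> \<open>The two slopes differ at frequency j by at least |b_j| / 2 (the whole of b_j
      if j = 0). One of two errors must pay for this: the squared errors add up to at least b_j^2 /
      8, and the affinity bound halves that to b_j^2 / 16.\<close>
    have "ennreal (wt (int j) powr \<nu> * (b j)\<^sup>2 / 8) / 2 \<le>
      (\<integral>\<^sup>+z. F j S z \<partial>(\<Pi>\<^sub>M i\<in>{..<n}. obs \<sigma> \<beta>)) +
      (\<integral>\<^sup>+z. F j (insert j S) z \<partial>(\<Pi>\<^sub>M i\<in>{..<n}. density (obs \<sigma> \<beta>) (\<lambda>x. ennreal (lik_ratio \<sigma> \<beta> \<beta>' x))))"
    proof (rule le_cam_two_point[where q = "exp (1 / (2 * real n))"])
      show "prob_space (density (obs \<sigma> \<beta>) (\<lambda>x. ennreal (lik_ratio \<sigma> \<beta> \<beta>' x)))"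
        unfolding dens[symmetric] by (rule prob_space_obs[OF L2(2)])
      show "lik_ratio \<sigma> \<beta> \<beta>' \<in> borel_measurable (obs \<sigma> \<beta>)"
        using measurable_lik_ratio[OF L2] by (simp cong: measurable_cong_sets)
      show "lik_ratio \<sigma> \<beta> \<beta>' x \<ge> 0" for x
        by (simp add: lik_ratio_def split: prod.split)
      show "(\<integral>\<^sup>+x. ennreal ((lik_ratio \<sigma> \<beta> \<beta>' x)\<^sup>2) \<partial>obs \<sigma> \<beta>) \<le> ennreal (exp (1 / (2 * real n)))"
        by (rule obs_lik_ratio_square[OF L2 \<sigma> shift])
      show "exp (1 / (2 * real n)) ^ card {..<n} \<le> 2"
        using two by simp
      fix z assume z: "z \<in> space (\<Pi>\<^sub>M i\<in>{..<n}. obs \<sigma> \<beta>)"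
      have eL2: "est z \<in> L2" by (rule est_L2[OF _ z]) simp
      define u where "u = L2_inner (est z) (trig (int j))"
      have "L2_inner (\<lambda>t. est z t - cpx \<beta> t) (trig (int j)) = u"
        using jS finS
        by (simp add: u_def L2_inner_diff_left[OF eL2 cpx_L2[OF cos_sum_L2]] \<beta>_def coef_cos_sum)
      moreover have "L2_inner (\<lambda>t. est z t - cpx \<beta>' t) (trig (int j)) = u - of_real (if j = 0 then b j else b j / 2)"
        using finS
        by (simp add: u_def L2_inner_diff_left[OF eL2 cpx_L2[OF cos_sum_L2]] \<beta>'_def coef_cos_sum)
      ultimately have "F j S z + F j (insert j S) z
        = ennreal (wt (int j) powr \<nu> * (cmod u)\<^sup>2) + ennreal (wt (int j) powr \<nu> * (cmod (u - of_real (if j = 0 then b j else b j / 2)))\<^sup>2)"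
        by (simp add: F_def \<beta>_def \<beta>'_def)
      also have "\<dots> = ennreal (wt (int j) powr \<nu> * ((cmod u)\<^sup>2 + (cmod (u - of_real (if j = 0 then b j else b j / 2)))\<^sup>2))"
        by (simp add: distrib_left)
      also have "\<dots> \<ge> ennreal (wt (int j) powr \<nu> * ((b j)\<^sup>2 / 8))"
      proof (intro ennreal_leI mult_left_mono)
        let ?c = "of_real (if j = 0 then b j else b j / 2) :: complex"
        have "(b j)\<^sup>2 / 4 \<le> (cmod ?c)\<^sup>2"
          by (auto simp: power_divide)
        also have "\<dots> = (cmod (u - (u - ?c)))\<^sup>2"
          by (simp only: diff_diff_eq2 add_diff_cancel_left')
        also have "\<dots> \<le> 2 * (cmod u)\<^sup>2 + 2 * (cmod (u - ?c))\<^sup>2"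
          by (rule norm_diff_square_le)
        finally show "(b j)\<^sup>2 / 8 \<le> (cmod u)\<^sup>2 + (cmod (u - ?c))\<^sup>2" by simp
      qed simp
      finally show "ennreal (wt (int j) powr \<nu> * (b j)\<^sup>2 / 8) \<le> F j S z + F j (insert j S) z"
        by simp
    qed (simp_all add: prob_space_obs L2 F_meas)
    moreover have "ennreal (wt (int j) powr \<nu> * (b j)\<^sup>2 / 8) / 2 = ennreal (wt (int j) powr \<nu> * (b j)\<^sup>2 / 16)"
      by (subst divide_ennreal[of _ 2, simplified]) auto
    ultimately show "ennreal (wt (int j) powr \<nu> * (b j)\<^sup>2 / 16) \<le> a j S + a j (insert j S)"
      unfolding dens[symmetric] by (simp add: a_def \<beta>_def \<beta>'_def)
  qed
qed

section \<open>Membership in the classes\<close>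

lemma the_inv_into_powr:
  assumes "e > 0" "y \<ge> (0::real)"
  shows "the_inv_into {0..} (\<lambda>t. t powr e) y = y powr (1 / e)"
proof (rule the_inv_into_f_eq)
  show "inj_on (\<lambda>t. t powr e) {0::real..}"
  proof (rule inj_onI)
    fix s t :: real assume st: "s \<in> {0..}" "t \<in> {0..}" and eq: "s powr e = t powr e"
    have root: "(x powr e) powr (1 / e) = x" if "x \<in> {0..}" for x
      using that assms by (simp add: powr_powr)
    have "s = (s powr e) powr (1 / e)"
      using root[OF st(1)] by (rule sym)
    also have "\<dots> = t"
      unfolding eq by (rule root[OF st(2)])
    finally show "s = t" .
  qed
  show "(y powr (1 / e)) powr e = y"
    using assms by (simp add: powr_powr)
qed simp

text \<open>The inverse of \<kappa> takes \<gamma> ^ (\<nu> - p) to \<gamma> ^ (- a - \<nu>), so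
  clearing the factor \<gamma> ^ \<nu> leaves eigenvalues comparable to \<gamma> ^ (- a), up to d
  and \<open>lam_plus\<close>.\<close>

lemma link_class_iff:
  fixes a p \<nu> d :: real
  assumes "0 \<le> \<nu>" "\<nu> < p" "a > 0"
  shows "lam \<in> link_class (\<lambda>t. t powr ((p - \<nu>) / (a + \<nu>))) p \<nu> d \<longleftrightarrow>
    (\<forall>k. 0 \<le> lam k) \<and> lam summable_on UNIV \<and>
    (\<forall>k. inverse d * wt k powr (- a) * lam_plus lam \<le> lam k \<and> lam k \<le> d * wt k powr (- a) * lam_plus lam)"
proof -
  have lp: "lam_plus lam > 0"
    unfolding lam_plus_def by (rule less_le_trans[OF zero_less_one max.cobounded1])
  have inv: "the_inv_into {0..} (\<lambda>t. t powr ((p - \<nu>) / (a + \<nu>))) (wt k powr (\<nu> - p)) = wt k powr (- a) / wt k powr \<nu>" for k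
  proof -
    have e: "(\<nu> - p) * ((a + \<nu>) / (p - \<nu>)) = - a - \<nu>"
      using assms by (simp add: field_simps)
    have "the_inv_into {0..} (\<lambda>t. t powr ((p - \<nu>) / (a + \<nu>))) (wt k powr (\<nu> - p)) = (wt k powr (\<nu> - p)) powr ((a + \<nu>) / (p - \<nu>))"
      using assms by (subst the_inv_into_powr) simp_all
    also have "\<dots> = wt k powr (- a - \<nu>)"
      by (simp only: powr_powr e)
    also have "\<dots> = wt k powr (- a) / wt k powr \<nu>"
      by (rule powr_diff)
    finally show ?thesis .
  qed
  have cancel: "c * (x / y) * (y * z) = c * x * z" if "y > 0" for c x y z :: real
    using that by simp
  have pos: "wt k powr \<nu> * lam_plus lam > 0" "wt k powr \<nu> > 0" for k
    using lp by simp_all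
  show ?thesis
    unfolding link_class_def Let_def inv mem_Collect_eq
      pos_le_divide_eq[OF pos(1)] pos_divide_le_eq[OF pos(1)] cancel[OF pos(2)] ..
qed

text \<open>As \<open>lam_plus\<close> is at least 1, the lower link bound places these weights
  below the eigenvalues of the given member, whose sum is at most \<Lambda>. This yields both the
  existence of \<open>g\<close> and its energy bound.\<close>

lemma F_class_weights:
  fixes a p \<nu> d \<Lambda> :: real
  assumes "(M, X, W) \<in> F_class m \<eta> \<tau> (\<lambda>t. t powr ((p - \<nu>) / (a + \<nu>))) p \<nu> d \<Lambda>"
    and "0 \<le> \<nu>" "\<nu> < p" "a > 0" "d \<ge> 1" "\<Lambda> \<ge> 1"
  shows "(\<lambda>k. wt k powr (- a) / d) summable_on UNIV" "(\<Sum>\<^sub>\<infinity>k. wt k powr (- a) / d) \<le> \<Lambda>"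
proof -
  let ?l = "\<lambda>k. wt k powr (- a) / d"
  have "lam_val M X W \<in> link_class (\<lambda>t. t powr ((p - \<nu>) / (a + \<nu>))) p \<nu> d"
    using assms(1) by (simp add: F_class_def)
  then have lower: "inverse d * wt k powr (- a) * lam_plus (lam_val M X W) \<le> lam_val M X W k" for k
    using assms by (simp add: link_class_iff)
  have le: "?l k \<le> lam_val M X W k" for k
  proof -
    have "1 \<le> lam_plus (lam_val M X W)" by (simp add: lam_plus_def)
    then have "?l k * 1 \<le> ?l k * lam_plus (lam_val M X W)"
      using assms by (intro mult_left_mono) auto
    then show ?thesis using lower[of k] by (simp add: field_simps)
  qed
  have fin: "(\<Sum>k\<in>I. ?l k) \<le> \<Lambda>" if "finite I" for I
    using sum_mono[of I ?l "lam_val M X W", OF le] sum_lam_val_le[OF assms(1) _ that] assms by simp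
  show sum: "?l summable_on UNIV"
    using fin assms by (intro nonneg_bdd_above_summable_on bdd_aboveI2) auto
  show "infsum ?l UNIV \<le> \<Lambda>"
    by (rule infsum_le_finite_sums[OF sum fin]) auto
qed

text \<open>The instrument of the least favourable model is the regressor itself, with
  \<open>x\<^sub>k = w\<^sub>k = \<lambda>\<^sub>k = \<gamma>\<^sub>k\<^sup>-\<^sup>a / d\<close>; the factor \<open>1 / d\<close> makes \<open>\<lambda>\<^sub>+ = 1\<close>.\<close>

lemma random_shift_models:
  fixes a p \<nu> d \<tau> \<Lambda> :: real
  assumes rs: "random_shift M \<pi> g (\<lambda>k. sqrt (wt k powr (- a) / d))"
    and par: "0 \<le> \<nu>" "\<nu> < p" "a > 0" "d \<ge> 1" "\<tau> \<ge> 1" "\<eta> \<ge> 1"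
    and l: "ennreal \<eta> \<ge> (\<integral>\<^sup>+u. ennreal (\<bar>u\<bar> ^ l) \<partial>std_gaussian)"
    and sum: "(\<lambda>k. wt k powr (- a) / d) summable_on UNIV"
    and g: "(L2_norm g)\<^sup>2 \<le> \<Lambda>"
    and \<beta>: "cpx \<beta> \<in> sobolev_ball p \<rho>"
  shows "(\<beta>, M, random_shift.proc \<pi> g, random_shift.proc \<pi> g, random_shift.err \<pi>)
    \<in> models m l \<eta> \<tau> (\<lambda>t. t powr ((p - \<nu>) / (a + \<nu>))) p \<nu> d \<Lambda> \<rho>"
proof -
  interpret random_shift M \<pi> g "\<lambda>k. sqrt (wt k powr (- a) / d)" by (rule rs)
  have lam: "lam_val M proc proc = (\<lambda>k. wt k powr (- a) / d)"
    using par by (intro ext) (simp add: lam_val_proc)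
  have wt_le: "wt k powr (- a) \<le> 1" for k
    using wt_ge_1[of k] par by (simp add: powr_le_one_le powr_minus_divide ge_one_powr_ge_zero)
  then have "wt k powr (- a) / d \<le> 1" for k
    using order_trans[OF wt_le[of k] par(4)] par by (simp add: divide_le_eq)
  then have plus: "lam_plus (\<lambda>k. wt k powr (- a) / d) = 1"
    unfolding lam_plus_def by (intro max_absorb1 cSUP_least) auto
  \<comment> \<open>With \<open>lam_plus\<close> equal to 1 the lower link bound is an equality, and
    the upper one amounts to d^2 \<ge> 1.\<close>
  have "lam_val M proc proc \<in> link_class (\<lambda>t. t powr ((p - \<nu>) / (a + \<nu>))) p \<nu> d"
  proof -
    have "wt k powr (- a) / d \<le> d * wt k powr (- a)" for k
    proof -
      have "wt k powr (- a) * 1 \<le> wt k powr (- a) * (d * d)"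
        using par by (intro mult_left_mono mult_ge1_I) auto
      then show ?thesis using par by (simp add: divide_le_eq mult_ac)
    qed
    then show ?thesis
      unfolding lam link_class_iff[OF par(1-3)] plus
      using par sum by (simp add: divide_inverse mult.commute)
  qed
  moreover have "(\<integral>\<^sup>+\<omega>. ennreal ((L2_norm (proc \<omega>))\<^sup>2) \<partial>M) \<le> ennreal \<Lambda>"
    using g by (simp add: L2_norm_proc emeasure_space_1 ennreal_leI cong: nn_integral_cong)
  ultimately show ?thesis
    using \<beta> moment_class_proc[OF \<open>\<eta> \<ge> 1\<close> \<open>\<tau> \<ge> 1\<close>] error_class_err[OF l] mean_err_proc
    by (simp add: models_def F_class_def)
qed

section \<open>Choice of the constants and derivation of the rate\<close>

theorem proposition4p1:
  fixes \<sigma> p \<rho> a \<nu> d \<tau> \<Lambda> :: real and m l :: nat and \<kappa> \<phi> :: "real \<Rightarrow> real"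
  assumes "\<sigma> > 0" "p > 0" "\<rho> > 0" "a > 0" "0 \<le> \<nu>" "\<nu> < p" "d \<ge> 1" "\<tau> \<ge> 1" "\<Lambda> \<ge> 1"
    and "\<kappa> = (\<lambda>t. t powr ((p - \<nu>) / (a + \<nu>)))"
    and "\<phi> = (\<lambda>t. t powr ((a + \<nu>) / (p - \<nu>)))"
    and "\<exists>\<eta>\<^sub>0. \<forall>\<eta>\<ge>\<eta>\<^sub>0. F_class m \<eta> \<tau> \<kappa> p \<nu> d \<Lambda> \<noteq> {}"
  shows "\<exists>\<eta>\<^sub>0\<ge>1. \<forall>\<eta>\<ge>\<eta>\<^sub>0. \<forall>\<Delta>\<ge>1. \<exists>C>0. \<forall>n\<ge>1.
    (\<exists>k' :: nat.
       inverse \<Delta> \<le> (\<Sum>k\<in>{k. \<bar>k\<bar> \<le> int k'}. wt (int k') powr (p - \<nu>) / (real n * \<phi> (wt k powr (\<nu> - p)))) \<and>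
       (\<Sum>k\<in>{k. \<bar>k\<bar> \<le> int k'}. wt (int k') powr (p - \<nu>) / (real n * \<phi> (wt k powr (\<nu> - p)))) \<le> \<Delta>) \<longrightarrow>
    (INF est\<in>estimators n. SUP (\<beta>, M, X, W, U)\<in>models m l \<eta> \<tau> \<kappa> p \<nu> d \<Lambda> \<rho>.
        risk \<nu> n est \<beta> (obs_law \<sigma> \<beta> M X W U))
    \<ge> ennreal (C * real n powr (- (2 * (p - \<nu>) / (2 * (p + a) + 1))))"
proof -
  note par = assms(1-9)
  define lam where "lam k = wt k powr (- a) / d" for k
  obtain \<eta>' where "F_class m \<eta>' \<tau> \<kappa> p \<nu> d \<Lambda> \<noteq> {}"
    using assms(12) by blast
  then obtain M' X' W' where "(M', X', W') \<in> F_class m \<eta>' \<tau> (\<lambda>t. t powr ((p - \<nu>) / (a + \<nu>))) p \<nu> d \<Lambda>"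
    unfolding assms(10) by auto
  from F_class_weights[OF this] par
  have lam_sum: "lam summable_on UNIV" and lam_le: "(\<Sum>\<^sub>\<infinity>k. lam k) \<le> \<Lambda>"
    by (simp_all add: lam_def[abs_def])
  have lam_pos: "lam k > 0" for k
    using par by (simp add: lam_def)
  then have lam_sqrt: "(sqrt (lam k))\<^sup>2 = lam k" for k
    by (simp add: less_imp_le)
  have "(\<lambda>k. (sqrt (lam k))\<^sup>2) summable_on UNIV" "sqrt (lam (- k)) = sqrt (lam k)" for k
    using lam_sum unfolding lam_sqrt by (simp_all add: lam_def[abs_def] wt_abs)
  then obtain g where g: "g \<in> borel_measurable borel" "\<And>t. g (t + 1) = g t" "g \<in> L2"
      "\<And>k. L2_inner (cpx g) (trig k) = of_real (sqrt (lam k))" "(L2_norm g)\<^sup>2 \<le> (\<Sum>\<^sub>\<infinity>k. lam k)"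
    using riesz_fischer_real[of "\<lambda>k. sqrt (lam k)"] unfolding lam_sqrt by blast
  obtain M :: "real measure" and \<pi> where M: "prob_space M" "\<pi> \<in> M \<rightarrow>\<^sub>M shift_space" "distr M shift_space \<pi> = shift_space"
    by (rule shift_space_on_reals)
  have rs: "random_shift M \<pi> g (\<lambda>k. sqrt (lam k))"
    using M g lam_pos by (intro random_shift.intro random_shift_axioms.intro) auto
  interpret random_shift M \<pi> g "\<lambda>k. sqrt (lam k)" by (rule rs)
  define \<mu> where "\<mu> = (\<integral>u. \<bar>u\<bar> ^ l \<partial>std_gaussian)"
  have \<mu>: "(\<integral>\<^sup>+u. ennreal (\<bar>u\<bar> ^ l) \<partial>std_gaussian) = ennreal \<mu>"
    unfolding \<mu>_def
  proof (rule nn_integral_eq_integral)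
    show "integrable std_gaussian (\<lambda>u. \<bar>u\<bar> ^ l)"
      unfolding std_gaussian_def
      by (subst integrable_density) (auto simp: integrable_std_normal_moment_abs)
  qed simp
  show ?thesis
  \<comment> \<open>The normalized coefficients have all moments equal to 1, and the noise needs its
    l-th absolute Gaussian moment \<mu>; neither depends on n or \<Delta>.\<close>
  proof (rule exI[of _ "max 1 \<mu>"], rule conjI, simp, intro allI impI)
    fix \<eta> \<Delta> :: real assume \<eta>: "\<eta> \<ge> max 1 \<mu>" and \<Delta>: "\<Delta> \<ge> 1"
    define q where "q = a + \<nu>"
    define e where "e = (p - \<nu>) / (p + a + 1 / 2)"
    define D where "D = 14 * 4 powr q * \<Delta>"
    \<comment> \<open>The first bound keeps neighbouring samples indistinguishable, the second keeps
      the slopes in the Sobolev ball.\<close>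
    define \<zeta> where "\<zeta> = min (\<sigma>\<^sup>2 / 2) (\<rho> / \<Delta>)"
    \<comment> \<open>The factor 64 collects 16 from the coordinate bound, 2 from Assouad, and 2
      from folding negative frequencies onto nonnegative ones.\<close>
    define C where "C = \<zeta> / (64 * \<Delta>) * D powr (- e)"
    have q: "q \<ge> 0" using par by (simp add: q_def)
    have D: "D > 0" using \<Delta> by (simp add: D_def)
    have \<zeta>: "\<zeta> > 0" using par \<Delta> by (simp add: \<zeta>_def)
    have \<zeta>_le: "\<zeta> \<le> \<sigma>\<^sup>2 / 2" "\<zeta> \<le> \<rho> / \<Delta>"
      unfolding \<zeta>_def by (rule min.cobounded1, rule min.cobounded2)
    show "\<exists>C>0. \<forall>n\<ge>1.
      (\<exists>k' :: nat.
         inverse \<Delta> \<le> (\<Sum>k\<in>{k. \<bar>k\<bar> \<le> int k'}. wt (int k') powr (p - \<nu>) / (real n * \<phi> (wt k powr (\<nu> - p)))) \<and>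
         (\<Sum>k\<in>{k. \<bar>k\<bar> \<le> int k'}. wt (int k') powr (p - \<nu>) / (real n * \<phi> (wt k powr (\<nu> - p)))) \<le> \<Delta>) \<longrightarrow>
      (INF est\<in>estimators n. SUP (\<beta>, M, X, W, U)\<in>models m l \<eta> \<tau> \<kappa> p \<nu> d \<Lambda> \<rho>.
          risk \<nu> n est \<beta> (obs_law \<sigma> \<beta> M X W U))
      \<ge> ennreal (C * real n powr (- (2 * (p - \<nu>) / (2 * (p + a) + 1))))"
    proof (intro exI[of _ C] conjI allI impI)
      show "C > 0" using \<zeta> \<Delta> D by (simp add: C_def)
      fix n :: nat assume n: "n \<ge> 1"
      assume "\<exists>k' :: nat.
         inverse \<Delta> \<le> (\<Sum>k\<in>{k. \<bar>k\<bar> \<le> int k'}. wt (int k') powr (p - \<nu>) / (real n * \<phi> (wt k powr (\<nu> - p)))) \<and>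
         (\<Sum>k\<in>{k. \<bar>k\<bar> \<le> int k'}. wt (int k') powr (p - \<nu>) / (real n * \<phi> (wt k powr (\<nu> - p)))) \<le> \<Delta>"
      then obtain K where K:
        "inverse \<Delta> \<le> (\<Sum>k\<in>{k. \<bar>k\<bar> \<le> int K}. wt (int K) powr (p - \<nu>) / (real n * \<phi> (wt k powr (\<nu> - p))))"
        "(\<Sum>k\<in>{k. \<bar>k\<bar> \<le> int K}. wt (int K) powr (p - \<nu>) / (real n * \<phi> (wt k powr (\<nu> - p)))) \<le> \<Delta>"
        by blast
      define A where "A = (\<Sum>k | \<bar>k\<bar> \<le> int K. wt k powr q)"
      define G where "G = wt (int K) powr (p - \<nu>)"
      have G: "G > 0" by (simp add: G_def)
      have \<phi>: "\<phi> (wt k powr (\<nu> - p)) = wt k powr (- q)" for k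
      proof -
        have "(\<nu> - p) * ((a + \<nu>) / (p - \<nu>)) = - q"
          using par by (simp add: q_def field_simps)
        then show ?thesis by (simp only: assms(11) powr_powr)
      qed
      have sum_eq: "(\<Sum>k\<in>{k. \<bar>k\<bar> \<le> int K}. wt (int K) powr (p - \<nu>) / (real n * \<phi> (wt k powr (\<nu> - p)))) = G * A / real n"
        unfolding \<phi> A_def G_def sum_distrib_left sum_divide_distrib
        by (intro sum.cong refl) (simp add: powr_minus divide_inverse mult_ac)
      have lower: "inverse \<Delta> \<le> G * A / real n" and upper: "G * A / real n \<le> \<Delta>"
        using K unfolding sum_eq by auto
      have nonneg: "0 \<le> G * A / real n"
        using G unfolding A_def by (intro divide_nonneg_nonneg mult_nonneg_nonneg sum_nonneg) auto
      \<comment> \<open>The factor \<gamma> ^ a cancels the decay of the eigenvalues, so every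
        coordinate shifts the response by the same order \<open>1 / sqrt n\<close>.\<close>
      define b where "b j = sqrt (\<zeta> * wt (int j) powr a / real n)" for j
      have b_sq: "(b j)\<^sup>2 = \<zeta> * wt (int j) powr a / real n" for j
        using \<zeta> by (simp add: b_def)
      have b_shift: "(b j * sqrt (lam (int j)) / \<sigma>)\<^sup>2 \<le> 1 / (2 * real n)" for j
      proof -
        have "(b j * sqrt (lam (int j)) / \<sigma>)\<^sup>2 = \<zeta> * (wt (int j) powr a * wt (int j) powr (- a)) / (real n * d * \<sigma>\<^sup>2)"
          unfolding power_divide power_mult_distrib b_sq lam_sqrt by (simp add: lam_def)
        also have "\<dots> = \<zeta> / (real n * d * \<sigma>\<^sup>2)"
          by (simp add: powr_minus)
        also have "\<dots> \<le> (\<sigma>\<^sup>2 / 2) / (real n * 1 * \<sigma>\<^sup>2)"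
          using par n \<zeta> \<zeta>_le by (intro frac_le mult_mono) auto
        also have "\<dots> = 1 / (2 * real n)"
          using par by simp
        finally show ?thesis .
      qed
      have ball: "cpx (cos_sum b S) \<in> sobolev_ball p \<rho>" if S: "S \<subseteq> {..K}" for S
      proof (rule cos_sum_sobolev_ball[OF S])
        \<comment> \<open>Bounding \<gamma> ^ (p - \<nu>) by its value at K turns the Sobolev sum
          into \<zeta> times the balancing sum, which is at most \<Delta>.\<close>
        have "(\<Sum>k | \<bar>k\<bar> \<le> int K. wt k powr p * (b (nat \<bar>k\<bar>))\<^sup>2) \<le> (\<Sum>k | \<bar>k\<bar> \<le> int K. \<zeta> / real n * (G * wt k powr q))"
        proof (rule sum_mono)
          fix k assume "k \<in> {k. \<bar>k\<bar> \<le> int K}"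
          then have "wt k \<le> wt (int K)" by (intro wt_mono) simp
          then have "wt k powr (p - \<nu>) \<le> G"
            unfolding G_def using par by (intro powr_mono2) auto
          have "wt k powr p * (b (nat \<bar>k\<bar>))\<^sup>2 = \<zeta> / real n * (wt k powr p * wt k powr a)"
            by (simp add: b_sq wt_abs)
          also have "wt k powr p * wt k powr a = wt k powr (p - \<nu>) * wt k powr q"
            by (simp add: q_def powr_add[symmetric])
          also have "\<zeta> / real n * \<dots> \<le> \<zeta> / real n * (G * wt k powr q)"
            using \<open>wt k powr (p - \<nu>) \<le> G\<close> \<zeta> by (intro mult_left_mono mult_right_mono) auto
          finally show "wt k powr p * (b (nat \<bar>k\<bar>))\<^sup>2 \<le> \<zeta> / real n * (G * wt k powr q)" .
        qed
        also have "\<dots> = \<zeta> * (G * A / real n)"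
          by (simp add: A_def sum_distrib_left sum_divide_distrib mult_ac)
        also have "\<dots> \<le> (\<rho> / \<Delta>) * \<Delta>"
          using upper \<zeta> \<zeta>_le \<Delta> par by (intro mult_mono nonneg) auto
        finally show "(\<Sum>k | \<bar>k\<bar> \<le> int K. wt k powr p * (b (nat \<bar>k\<bar>))\<^sup>2) \<le> \<rho>"
          using \<Delta> by simp
      qed
      have model: "(cos_sum b S, M, proc, proc, err) \<in> models m l \<eta> \<tau> \<kappa> p \<nu> d \<Lambda> \<rho>" if "S \<subseteq> {..K}" for S
        unfolding assms(10)
        by (rule random_shift_models[OF rs[unfolded lam_def]])
          (use par \<eta> lam_sum lam_le g(5) ball[OF that] \<mu> in \<open>auto simp: lam_def[abs_def] intro: ennreal_leI\<close>)
      have rate: "C * real n powr (- (2 * (p - \<nu>) / (2 * (p + a) + 1))) \<le> \<zeta> / (64 * \<Delta>) / G"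
      proof -
        have e: "2 * (p - \<nu>) / (2 * (p + a) + 1) = e"
          using par by (simp add: e_def field_simps)
        \<comment> \<open>This splitting exposes \<open>G\<close> and the quantity bounded in
          \<open>sum_wt_lower\<close>. The upper balancing bound then gives
          \<open>D * real n\<close>, and raising to the power \<open>e\<close> isolates
          \<open>G\<close>.\<close>
        have "p + a + 1 / 2 = (p - \<nu>) + (q + 1 / 2)"
          by (simp add: q_def)
        then have "wt (int K) powr (p + a + 1 / 2) = G * wt (int K) powr (q + 1 / 2)"
          by (simp only: powr_add G_def)
        also have "\<dots> \<le> G * (14 * 4 powr q * A)"
          unfolding A_def using G by (intro mult_left_mono sum_wt_lower q) auto
        also have "\<dots> = 14 * 4 powr q * (G * A / real n) * real n"
          using n by simp
        also have "\<dots> \<le> 14 * 4 powr q * \<Delta> * real n"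
          using upper by (intro mult_left_mono mult_right_mono) auto
        finally have "wt (int K) powr (p + a + 1 / 2) \<le> D * real n"
          by (simp add: D_def)
        then have "(wt (int K) powr (p + a + 1 / 2)) powr e \<le> (D * real n) powr e"
          using par by (intro powr_mono2) (auto simp: e_def)
        moreover have "(wt (int K) powr (p + a + 1 / 2)) powr e = G"
          using par by (simp add: powr_powr e_def G_def)
        ultimately have "G \<le> (D * real n) powr e" by simp
        then have "inverse ((D * real n) powr e) \<le> inverse G"
          using G by (rule le_imp_inverse_le)
        moreover have "inverse ((D * real n) powr e) = D powr (- e) * real n powr (- e)"
          using D by (simp only: powr_minus inverse_mult_distrib[symmetric]) (simp add: powr_mult)
        ultimately have "\<zeta> / (64 * \<Delta>) * (D powr (- e) * real n powr (- e)) \<le> \<zeta> / (64 * \<Delta>) * inverse G"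
          using \<zeta> \<Delta> by (intro mult_left_mono) auto
        then show ?thesis
          unfolding e C_def by (simp only: divide_inverse[of _ G] mult.assoc)
      qed
      show "ennreal (C * real n powr (- (2 * (p - \<nu>) / (2 * (p + a) + 1)))) \<le>
        (INF est\<in>estimators n. SUP (\<beta>, M, X, W, U)\<in>models m l \<eta> \<tau> \<kappa> p \<nu> d \<Lambda> \<rho>.
          risk \<nu> n est \<beta> (obs_law \<sigma> \<beta> M X W U))"
      proof (rule INF_greatest)
        fix est :: "(nat \<Rightarrow> real \<times> (real \<Rightarrow> real) \<times> (real \<Rightarrow> real)) \<Rightarrow> real \<Rightarrow> complex"
        assume est: "est \<in> estimators n"
        define R where "R = (SUP (\<beta>, M, X, W, U)\<in>models m l \<eta> \<tau> \<kappa> p \<nu> d \<Lambda> \<rho>. risk \<nu> n est \<beta> (obs_law \<sigma> \<beta> M X W U))"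
        have "risk \<nu> n est (cos_sum b S) (obs \<sigma> (cos_sum b S)) \<le> R" if "S \<subseteq> {..K}" for S
          unfolding R_def by (rule SUP_upper2[OF model[OF that]]) simp
        from hypercube_risk[OF par(1) n b_shift est this]
        have "ennreal (\<Sum>j\<le>K. wt (int j) powr \<nu> * (b j)\<^sup>2 / 16) \<le> 2 * R"
          by (subst sum_ennreal[symmetric]) auto
        moreover have "2 * (\<zeta> / (64 * \<Delta>) / G) \<le> (\<Sum>j\<le>K. wt (int j) powr \<nu> * (b j)\<^sup>2 / 16)"
        proof -
          \<comment> \<open>The lower balancing bound enters here: it prevents the sum of the
            squared amplitudes, weighted by \<gamma> ^ \<nu>, from falling below the order of 1 /
            \<open>G\<close>.\<close>
          have "inverse \<Delta> / G \<le> A / real n"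
            using lower G by (simp add: pos_divide_le_eq mult.commute)
          also have "\<dots> \<le> 2 * (\<Sum>j\<le>K. wt (int j) powr q) / real n"
            unfolding A_def
            by (intro divide_right_mono sum_int_le_twice_sum_nat) (auto simp: wt_abs)
          finally have "\<zeta> / 32 * (inverse \<Delta> / G) \<le> \<zeta> / 32 * (2 * (\<Sum>j\<le>K. wt (int j) powr q) / real n)"
            using \<zeta> by (intro mult_left_mono) auto
          also have "\<dots> = (\<Sum>j\<le>K. wt (int j) powr \<nu> * (b j)\<^sup>2 / 16)"
            unfolding b_sq sum_distrib_left sum_divide_distrib
            by (intro sum.cong refl) (simp add: q_def powr_add mult_ac)
          finally have "\<zeta> / 32 * (inverse \<Delta> / G) \<le> (\<Sum>j\<le>K. wt (int j) powr \<nu> * (b j)\<^sup>2 / 16)" .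
          moreover have "2 * (\<zeta> / (64 * \<Delta>) / G) = \<zeta> / 32 * (inverse \<Delta> / G)"
            by (simp add: inverse_eq_divide)
          ultimately show ?thesis by linarith
        qed
        ultimately have "ennreal (2 * (\<zeta> / (64 * \<Delta>) / G)) \<le> 2 * R"
          using order_trans[OF ennreal_leI] by blast
        then have "2 * ennreal (\<zeta> / (64 * \<Delta>) / G) \<le> 2 * R"
          using ennreal_mult'[of 2 "\<zeta> / (64 * \<Delta>) / G"] by simp
        then have "ennreal (\<zeta> / (64 * \<Delta>) / G) \<le> R"
          by (subst (asm) ennreal_mult_le_mult_iff) simp_all
        then show "ennreal (C * real n powr (- (2 * (p - \<nu>) / (2 * (p + a) + 1)))) \<le>
          (SUP (\<beta>, M, X, W, U)\<in>models m l \<eta> \<tau> \<kappa> p \<nu> d \<Lambda> \<rho>. risk \<nu> n est \<beta> (obs_law \<sigma> \<beta> M X W U))"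
          unfolding R_def[symmetric] by (rule order_trans[OF ennreal_leI[OF rate]])
      qed
    qed
  qed
qed

end
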